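(* Let $(S,X)$ be a locally compact Markov shift on some alphabet $\mathcal A$, with regular part $X^\#$. Let $\pi:(S,X^\#)\to(T,Y)$ be a Borel semiconjugacy such that: <br/>- $(T,Y)$ is a Borel automorphism; <br/>- $\pi$ is finite-to-one, i.e., $\pi^{-1}(y)$ is finite for every $y\in Y$; <br/>- $\pi$ has the Bowen property with respect to a locally finite relation on $\mathcal A$. <br/>Then there are a locally compact Markov shift $(\tilde S,\tilde X)$ and a $1$-Lipschitz map $\phi:\tilde X\to X^\#$ such that $\pi\circ\phi:\tilde X\to Y$ defines a semiconjugacy from $(\tilde S,\tilde X)$ to $(T,Y)$ satisfying: <br/>- the restriction of $\pi\circ\phi$ to $\tilde X^\#$ is injective; <br/>- $\pi\circ\phi(\tilde X^\#)$ carries all invariant measures of $\pi(X^\#)$, i.e. every $T$-invariant ergodic Borel probability measure $\mu$ with $\mu(\pi(X^\#))=1$ satisfies $\mu(\pi\circ\phi(\tilde X^\#))=1$.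
   Context: All measures are ergodic, invariant, Borel probability measures. A Borel automorphism is a Borel isomorphism $T$ of a standard Borel space $Y$ onto itself. A symbolic system $(S,X)$ over a countable (possibly finite) alphabet $\mathcal A$ is a shift-invariant subset $X\subset\mathcal A^{\mathbb Z}$ (not necessarily closed) with the shift $S:(x_n)_{n\in\mathbb Z}\mapsto(x_{n+1})_{n\in\mathbb Z}$ and the distance $d(x,y)=\exp(-\inf\{|n|:x_n\neq y_n\})$. A Markov shift is a symbolic system of the form $X=\{x\in\mathcal A^{\mathbb Z}:\forall n\in\mathbb Z,\ x_n\to x_{n+1}\}$ for some simple directed graph with vertex set $\mathcal A$ (at most one arrow from $a$ to $b$ for any vertices $a,b$). Local compactness refers to the topology of the distance $d(x,y)=\exp(-\inf\{|n|:x_n\neq y_n\})$. The regular part $X^\#$ of a Markov shift $X$ is the set of $x\in X$ for which there are $u,v\in\mathcal A$ such that $u$ occurs infinitely many times in $(x_n)_{n\le0}$ and $v$ occurs infinitely many times in $(x_n)_{n\ge0}$. A semiconjugacy $\pi:(S,X)\to(T,Y)$ is a map $\pi:X\to Y$ (not necessarily onto) with $\pi\circ S=T\circ\pi$. A map $\phi$ between metric spaces is $1$-Lipschitz if $d(\phi(x),\phi(y))\le d(x,y)$ for all $x,y$; $\phi$ is not required to commute with the shifts. A semiconjugacy $\pi$ defined on a symbolic system $Z\subset\mathcal A^{\mathbb Z}$ has the Bowen property with respect to a reflexive and symmetric relation $\sim$ on $\mathcal A$ if, for all $x,y\in Z$: $\pi(x)=\pi(y)\iff\forall n\in\mathbb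 Z\ x_n\sim y_n$. The relation $\sim$ is locally finite if $\{b\in\mathcal A:b\sim a\}$ is finite for each $a\in\mathcal A$. *)

theory Defs
  imports "HOL-Probability.Probability"
begin

definition shift_map :: "(int \<Rightarrow> 'a) \<Rightarrow> int \<Rightarrow> 'a" where
  "shift_map x = (\<lambda>n. x (n + 1))"

text \<open>The case split implements the convention that the infimum of the empty set is
  infinite: in \<^typ>\<open>nat\<close> the infimum of the empty set would be \<open>0\<close>.\<close>

definition seq_dist :: "(int \<Rightarrow> 'a) \<Rightarrow> (int \<Rightarrow> 'a) \<Rightarrow> real" where
  "seq_dist x y = (if x = y then 0 else exp (- real (INF n\<in>{n. x n \<noteq> y n}. nat \<bar>n\<bar>)))"

text \<open>\<^const>\<open>Metric_space.mtopology\<close> is meaningful only for metrics.\<close>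

lemma Metric_space_seq_dist: "Metric_space X seq_dist"
proof
  fix x y z :: "int \<Rightarrow> 'a"
  show "0 \<le> seq_dist x y" by (simp add: seq_dist_def)
  have "{n. x n \<noteq> y n} = {n. y n \<noteq> x n}" by auto
  then show "seq_dist x y = seq_dist y x" unfolding seq_dist_def by (simp add: eq_commute)
  show "seq_dist x y = 0 \<longleftrightarrow> x = y" by (simp add: seq_dist_def)
  show "seq_dist x z \<le> seq_dist x y + seq_dist y z"
  proof (cases "x = z \<or> x = y \<or> y = z")
    case True
    then show ?thesis by (auto simp: seq_dist_def)
  next
    case False
    define D where "D u v = (\<lambda>n. nat \<bar>n\<bar>) ` {n. u n \<noteq> v n}" for u v :: "int \<Rightarrow> 'a"
    have "{n. x n \<noteq> z n} \<noteq> {}" using False by auto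
    then have "Inf (D x z) \<in> D x z" unfolding D_def by (intro Inf_nat_def1) auto
    then obtain n where n: "x n \<noteq> z n" "Inf (D x z) = nat \<bar>n\<bar>" by (auto simp: D_def)
    then have "x n \<noteq> y n \<or> y n \<noteq> z n" by auto
    then have "Inf (D x y) \<le> Inf (D x z) \<or> Inf (D y z) \<le> Inf (D x z)"
      unfolding n(2) by (auto simp: D_def intro!: cInf_lower)
    then have "exp (- real (Inf (D x z))) \<le> exp (- real (Inf (D x y)))
        \<or> exp (- real (Inf (D x z))) \<le> exp (- real (Inf (D y z)))" by auto
    moreover have "0 < exp (- real (Inf (D x y)))" "0 < exp (- real (Inf (D y z)))" by auto
    ultimately have "exp (- real (Inf (D x z))) \<le>
        exp (- real (Inf (D x y))) + exp (- real (Inf (D y z)))" by linarith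
    then show ?thesis using False by (simp add: seq_dist_def D_def)
  qed
qed

abbreviation seq_topology :: "(int \<Rightarrow> 'a) set \<Rightarrow> (int \<Rightarrow> 'a) topology" where
  "seq_topology X \<equiv> Metric_space.mtopology X seq_dist"

text \<open>A simple directed graph with vertex set \<open>A\<close> is a relation \<open>E\<close> on \<open>A\<close>;
  loops are allowed.\<close>

definition markov_shift :: "'a set \<Rightarrow> (int \<Rightarrow> 'a) set \<Rightarrow> bool" where
  "markov_shift A X \<longleftrightarrow> countable A \<and>
     (\<exists>E \<subseteq> A \<times> A. X = {x. (\<forall>n. x n \<in> A) \<and> (\<forall>n. (x n, x (n + 1)) \<in> E)})"

definition regular_part :: "'a set \<Rightarrow> (int \<Rightarrow> 'a) set \<Rightarrow> (int \<Rightarrow> 'a) set" where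
  "regular_part A X = {x \<in> X. \<exists>u\<in>A. \<exists>v\<in>A.
     infinite {n. n \<le> 0 \<and> x n = u} \<and> infinite {n. 0 \<le> n \<and> x n = v}}"

definition borel_of_topology :: "'b topology \<Rightarrow> 'b measure" where
  "borel_of_topology \<T> = sigma (topspace \<T>) {U. openin \<T> U}"

text \<open>Only the \<open>\<sigma>\<close>-algebra of \<open>Y\<close> matters below, not its measure.\<close>

definition standard_borel_space :: "'b measure \<Rightarrow> bool" where
  "standard_borel_space Y \<longleftrightarrow> (\<exists>\<T>. completely_metrizable_space \<T> \<and> second_countable \<T> \<and>
     space Y = topspace \<T> \<and> sets Y = sets (borel_of_topology \<T>))"

definition borel_automorphism :: "'b measure \<Rightarrow> ('b \<Rightarrow> 'b) \<Rightarrow> bool" where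
  "borel_automorphism Y T \<longleftrightarrow> standard_borel_space Y \<and> bij_betw T (space Y) (space Y) \<and>
     T \<in> measurable Y Y \<and> inv_into (space Y) T \<in> measurable Y Y"

definition ergodic_invariant_prob :: "'b measure \<Rightarrow> ('b \<Rightarrow> 'b) \<Rightarrow> 'b measure \<Rightarrow> bool" where
  "ergodic_invariant_prob Y T \<mu> \<longleftrightarrow> prob_space \<mu> \<and> sets \<mu> = sets Y \<and> distr \<mu> Y T = \<mu> \<and>
     (\<forall>B\<in>sets Y. T -` B \<inter> space Y = B \<longrightarrow> emeasure \<mu> B = 0 \<or> emeasure \<mu> B = 1)"

definition semiconjugacy ::
    "('x \<Rightarrow> 'x) \<Rightarrow> 'x set \<Rightarrow> ('y \<Rightarrow> 'y) \<Rightarrow> 'y set \<Rightarrow> ('x \<Rightarrow> 'y) \<Rightarrow> bool" where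
  "semiconjugacy S X T Y \<pi> \<longleftrightarrow> \<pi> \<in> X \<rightarrow> Y \<and> (\<forall>x\<in>X. \<pi> (S x) = T (\<pi> x))"

definition bowen_property ::
    "(int \<Rightarrow> 'a) set \<Rightarrow> ((int \<Rightarrow> 'a) \<Rightarrow> 'y) \<Rightarrow> 'a set \<Rightarrow> ('a \<times> 'a) set \<Rightarrow> bool" where
  "bowen_property Z \<pi> A R \<longleftrightarrow> R \<subseteq> A \<times> A \<and> refl_on A R \<and> sym R \<and>
     (\<forall>x\<in>Z. \<forall>y\<in>Z. \<pi> x = \<pi> y \<longleftrightarrow> (\<forall>n. (x n, y n) \<in> R))"

definition locally_finite_rel :: "'a set \<Rightarrow> ('a \<times> 'a) set \<Rightarrow> bool" where
  "locally_finite_rel A R \<longleftrightarrow> (\<forall>a\<in>A. finite {b \<in> A. (b, a) \<in> R})"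

definition one_lipschitz ::
    "(int \<Rightarrow> 'a) set \<Rightarrow> (int \<Rightarrow> 'b) set \<Rightarrow> ((int \<Rightarrow> 'a) \<Rightarrow> (int \<Rightarrow> 'b)) \<Rightarrow> bool" where
  "one_lipschitz X Z \<phi> \<longleftrightarrow> \<phi> \<in> X \<rightarrow> Z \<and>
     (\<forall>x\<in>X. \<forall>y\<in>X. seq_dist (\<phi> x) (\<phi> y) \<le> seq_dist x y)"

end

theory Submission
  imports Defs "HOL-Library.Diagonal_Subsequence"
begin

text \<open>Two points of a fiber of \<open>\<pi>\<close> that collide and separate recurrently could be spliced at
  infinitely many times inside the fiber; so almost every fiber is a finite family of paths that never
  meet. By compactness such a fiber contains a magic window: any word related to the window has its
  middle letter among the middle letters of the window. A fiber is cut into blocks at the occurrences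
  of its best magic window. A path related to a concatenation of blocks starts and ends each block on
  the family; spliced into the fiber the block came from, it must follow that family. Hence a
  sequence of blocks determines a whole fiber, and \<open>\<phi>\<close> selects the member with least letter at time \<open>0\<close>.

  The blocks at one marker have unbounded length, which would destroy local compactness. Therefore each
  symbol also records the least 1-Lipschitz majorant of the logarithms of the gap lengths, seen from
  the past and from the future. It makes in- and out-degrees finite, it is almost surely
  finite by Borel--Cantelli, and along regular paths it is determined by the fiber: a competing
  solution of the local rule would grow with slope one and could not recur.\<close>

section \<open>Sequence spaces\<close>

text \<open>That \<open>\<phi>\<close> be 1-Lipschitz leaves no slack: letters up to time n may
  depend only on symbols up to time n. Noncollision makes this possible. A symbol shows all members
  of its fiber on a window of radius at least 1, so one letter and the symbol at its time yield both
  neighboring letters; only the letter at time 0 has to be chosen. Logarithms make a crude estimate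
  sufficient: disjoint translates bound the probability of a gap longer than g by 1 / g only, which
  is not summable over g, but is summable along g = 2 ^ k. Images under a Borel map are a priori
  only analytic. Each condition on fibers is therefore pulled back to a Borel set of regular paths
  that is a union of fibers; this set and its complement have disjoint images, and Lusin separation
  makes both images measurable. Local compactness of \<open>X\<close> does not by itself bound the
  degrees of the given graph, so the graph is reduced to the edges that regular points use.\<close>

definition agree_upto :: "nat \<Rightarrow> (int \<Rightarrow> 'a) \<Rightarrow> (int \<Rightarrow> 'a) \<Rightarrow> bool" where
  "agree_upto n x y \<longleftrightarrow> (\<forall>k. \<bar>k\<bar> \<le> int n \<longrightarrow> x k = y k)"

lemma agree_upto_refl [simp]: "agree_upto n x x"
  by (simp add: agree_upto_def)

lemma agree_upto_trans: "agree_upto n x y \<Longrightarrow> agree_upto n y z \<Longrightarrow> agree_upto n x z"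
  by (simp add: agree_upto_def)

lemma seq_dist_first_difference:
  assumes "x \<noteq> y"
  obtains m where "seq_dist x y = exp (- real m)" "x (int m) \<noteq> y (int m) \<or> x (- int m) \<noteq> y (- int m)"
    "\<And>k. \<bar>k\<bar> < int m \<Longrightarrow> x k = y k"
proof -
  define D where "D = (\<lambda>n. nat \<bar>n\<bar>) ` {n. x n \<noteq> y n}"
  have "D \<noteq> {}" using assms by (auto simp: D_def)
  then have "Inf D \<in> D" by (rule Inf_nat_def1)
  then obtain k where k: "x k \<noteq> y k" "Inf D = nat \<bar>k\<bar>" by (auto simp: D_def)
  show thesis
  proof (rule that)
    show "seq_dist x y = exp (- real (Inf D))" using assms by (simp add: seq_dist_def D_def)
    show "x (int (Inf D)) \<noteq> y (int (Inf D)) \<or> x (- int (Inf D)) \<noteq> y (- int (Inf D))"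
      using k by (cases "k \<ge> 0") auto
    fix j assume j: "\<bar>j\<bar> < int (Inf D)"
    show "x j = y j"
    proof (rule ccontr)
      assume "x j \<noteq> y j"
      then have "Inf D \<le> nat \<bar>j\<bar>" by (auto simp: D_def intro!: cInf_lower)
      then show False using j by linarith
    qed
  qed
qed

text \<open>A first disagreement at radius m gives distance exactly exp (- m), so strict balls
  correspond to windows that include both end points.\<close>

lemma seq_dist_less_iff: "seq_dist x y < exp (- real n) \<longleftrightarrow> agree_upto n x y"
proof (cases "x = y")
  case True
  then show ?thesis by (simp add: seq_dist_def)
next
  case False
  from False obtain m where m: "seq_dist x y = exp (- real m)"
    "x (int m) \<noteq> y (int m) \<or> x (- int m) \<noteq> y (- int m)" "\<And>k. \<bar>k\<bar> < int m \<Longrightarrow> x k = y k"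
    using seq_dist_first_difference by blast
  have "agree_upto n x y \<longleftrightarrow> n < m"
  proof
    assume "agree_upto n x y"
    show "n < m"
    proof (rule ccontr)
      assume "\<not> n < m"
      then have "x (int m) = y (int m)" "x (- int m) = y (- int m)"
        using \<open>agree_upto n x y\<close> by (auto simp: agree_upto_def)
      then show False using m(2) by blast
    qed
  next
    assume "n < m"
    then show "agree_upto n x y" using m(3) by (auto simp: agree_upto_def)
  qed
  then show ?thesis using m(1) by simp
qed

lemma exists_exp_le: 
  assumes "(e::real) > 0" obtains n where "exp (- real n) \<le> e"
proof -
  obtain n where "- ln e \<le> real n" using real_arch_simple by blast
  then have "exp (- real n) \<le> exp (ln e)" by (subst exp_le_cancel_iff) linarith
  then show thesis using assms that by simp
qed

text \<open>Nonzero distances all have the form exp (- m): if the images differ first at radius m,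
  the arguments cannot agree up to m.\<close>

lemma one_lipschitzI:
  assumes "\<And>x. x \<in> X \<Longrightarrow> \<phi> x \<in> Z"
    and "\<And>x y n. x \<in> X \<Longrightarrow> y \<in> X \<Longrightarrow> agree_upto n x y \<Longrightarrow> agree_upto n (\<phi> x) (\<phi> y)"
  shows "one_lipschitz X Z \<phi>"
  unfolding one_lipschitz_def
proof (intro conjI ballI)
  show "\<phi> \<in> X \<rightarrow> Z" using assms(1) by blast
  fix x y assume xy: "x \<in> X" "y \<in> X"
  show "seq_dist (\<phi> x) (\<phi> y) \<le> seq_dist x y"
  proof (cases "\<phi> x = \<phi> y")
    case True
    then show ?thesis by (simp add: seq_dist_def)
  next
    case False
    from False obtain m where m: "seq_dist (\<phi> x) (\<phi> y) = exp (- real m)"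
      using seq_dist_first_difference by blast
    then have "\<not> agree_upto m (\<phi> x) (\<phi> y)" by (simp flip: seq_dist_less_iff)
    then have "\<not> agree_upto m x y" using assms(2)[OF xy] by blast
    then show ?thesis using m by (simp flip: seq_dist_less_iff)
  qed
qed

lemma openin_seq_topology:
  "openin (seq_topology X) U \<longleftrightarrow> U \<subseteq> X \<and> (\<forall>x\<in>U. \<exists>n. \<forall>y\<in>X. agree_upto n x y \<longrightarrow> y \<in> U)"
proof -
  interpret Metric_space X seq_dist by (rule Metric_space_seq_dist)
  show ?thesis
    unfolding openin_mtopology
  proof (intro conj_cong refl)
    assume U: "U \<subseteq> X"
    show "(\<forall>x. x \<in> U \<longrightarrow> (\<exists>r>0. mball x r \<subseteq> U))
      \<longleftrightarrow> (\<forall>x\<in>U. \<exists>n. \<forall>y\<in>X. agree_upto n x y \<longrightarrow> y \<in> U)"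
    proof (safe)
      fix x assume "\<forall>x. x \<in> U \<longrightarrow> (\<exists>r>0. mball x r \<subseteq> U)" "x \<in> U"
      then obtain r where r: "r > 0" "mball x r \<subseteq> U" by blast
      obtain n where n: "exp (- real n) \<le> r" using exists_exp_le r(1) by blast
      show "\<exists>n. \<forall>y\<in>X. agree_upto n x y \<longrightarrow> y \<in> U"
      proof (intro exI ballI impI)
        fix y assume "y \<in> X" "agree_upto n x y"
        then have "y \<in> mball x r" using n \<open>x \<in> U\<close> U
          by (auto simp: mball_def simp flip: seq_dist_less_iff)
        then show "y \<in> U" using r by blast
      qed
    next
      fix x assume "\<forall>x\<in>U. \<exists>n. \<forall>y\<in>X. agree_upto n x y \<longrightarrow> y \<in> U" "x \<in> U"
      then obtain n where "\<forall>y\<in>X. agree_upto n x y \<longrightarrow> y \<in> U" by blast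
      then have "mball x (exp (- real n)) \<subseteq> U"
        by (auto simp: mball_def seq_dist_less_iff)
      then show "\<exists>r>0. mball x r \<subseteq> U" by (intro exI[of _ "exp (- real n)"]) auto
    qed
  qed
qed

lemma topspace_seq_topology [simp]: "topspace (seq_topology X) = X"
  by (simp add: Metric_space.topspace_mtopology[OF Metric_space_seq_dist])

lemma openin_cylinder: "openin (seq_topology X) {y \<in> X. agree_upto n x y}"
  unfolding openin_seq_topology
proof (intro conjI ballI)
  fix z assume "z \<in> {y \<in> X. agree_upto n x y}"
  then show "\<exists>n'. \<forall>y\<in>X. agree_upto n' z y \<longrightarrow> y \<in> {y \<in> X. agree_upto n x y}"
    by (intro exI[of _ n]) (auto intro: agree_upto_trans)
qed auto

text \<open>Diagonal extraction over the coordinates, enumerated by \<open>int_decode\<close>.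
  Letters are discrete, so convergence of a coordinate means being eventually constant.\<close>

lemma pointwise_convergent_subsequence:
  fixes s :: "nat \<Rightarrow> int \<Rightarrow> 'b"
  assumes fin: "\<And>n. finite (range (\<lambda>k. s k n))"
  obtains r l where "strict_mono r" "\<And>n. \<forall>\<^sub>F k in sequentially. s (r k) n = l n"
proof -
  define P where "P n r \<longleftrightarrow> (\<exists>l. \<forall>k. s (r k) (int_decode n) = l)" for n and r :: "nat \<Rightarrow> nat"
  interpret subseqs P
  proof
    fix n and q :: "nat \<Rightarrow> nat" assume q: "strict_mono q"
    define c where "c = int_decode n"
    have "finite (range (\<lambda>k. s (q k) c))"
      by (rule finite_subset[OF _ fin[of c]]) auto
    then obtain l where "infinite {k. s (q k) c = l}"
      using pigeonhole_infinite[of UNIV "\<lambda>k. s (q k) c"] by auto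
    then obtain r' :: "nat \<Rightarrow> nat" where "strict_mono r'" "\<forall>k. r' k \<in> {k. s (q k) c = l}"
      using infinite_enumerate by blast
    then show "\<exists>r'. strict_mono r' \<and> P n (q \<circ> r')" unfolding P_def c_def by auto
  qed
  have "\<exists>l. \<forall>\<^sub>F k in sequentially. s (diagseq k) n = l" for n
  proof -
    have "P (int_encode n) (diagseq \<circ> ((+) (Suc (int_encode n))))"
      by (rule diagseq_holds) (auto simp: P_def)
    then obtain l where l: "\<And>k. s (diagseq (Suc (int_encode n) + k)) n = l"
      unfolding P_def by auto
    show ?thesis
      by (rule exI[of _ l], rule eventually_sequentiallyI[of "Suc (int_encode n)"])
        (use l in \<open>metis le_add_diff_inverse\<close>)
  qed
  then obtain l where "\<And>n. \<forall>\<^sub>F k in sequentially. s (diagseq k) n = l n" by metis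
  then show thesis using that subseq_diagseq by blast
qed

lemma eventually_agree_upto:
  fixes s :: "nat \<Rightarrow> int \<Rightarrow> 'b"
  assumes "\<And>n. \<forall>\<^sub>F k in sequentially. s k n = l n"
  shows "\<forall>\<^sub>F k in sequentially. agree_upto n (s k) l"
proof -
  have "\<forall>\<^sub>F k in sequentially. \<forall>j\<in>{- int n..int n}. s k j = l j"
    using assms by (intro eventually_ball_finite) auto
  then show ?thesis by eventually_elim (auto simp: agree_upto_def abs_le_iff)
qed

definition edge_paths :: "('a \<times> 'a) set \<Rightarrow> (int \<Rightarrow> 'a) set" where
  "edge_paths E = {x. \<forall>n. (x n, x (n + 1)) \<in> E}"

text \<open>Finite degrees keep the set of possible letters finite at each further step, in both
  time directions.\<close>

lemma finite_reachable:
  assumes out: "\<And>a. finite (E `` {a})" and inn: "\<And>a. finite (E\<inverse> `` {a})" and D: "finite D"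
  shows "finite {x n | x. x \<in> edge_paths E \<and> x k \<in> D}"
proof (induction n rule: int_induct[of _ k])
  case base
  show ?case by (rule finite_subset[OF _ D]) auto
next
  case (step1 i)
  have "finite (\<Union>a\<in>{x i | x. x \<in> edge_paths E \<and> x k \<in> D}. E `` {a})"
    using step1(2) out by blast
  then show ?case by (rule rev_finite_subset) (fastforce simp: edge_paths_def)
next
  case (step2 i)
  have "finite (\<Union>a\<in>{x i | x. x \<in> edge_paths E \<and> x k \<in> D}. E\<inverse> `` {a})"
    using step2(2) inn by blast
  moreover have "(x (i - 1), x i) \<in> E" if "x \<in> edge_paths E" for x
    using that[unfolded edge_paths_def, simplified, rule_format, of "i - 1"] by simp
  ultimately show ?case by (elim rev_finite_subset) blast
qed

lemma edge_paths_limit: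
  assumes "\<And>k n. \<bar>n\<bar> < int k \<Longrightarrow> (s k n, s k (n + 1)) \<in> E" "strict_mono r"
    and "\<And>n. \<forall>\<^sub>F k in sequentially. s (r k) n = l n"
  shows "l \<in> edge_paths E"
  unfolding edge_paths_def
proof (intro CollectI allI)
  fix n
  have "\<forall>\<^sub>F k in sequentially. \<bar>n\<bar> < int k"
    by (rule eventually_sequentiallyI[of "nat \<bar>n\<bar> + 1"]) linarith
  then have "\<forall>\<^sub>F k in sequentially. (l n, l (n + 1)) \<in> E"
    using assms(3)[of n] assms(3)[of "n + 1"]
  proof eventually_elim
    case (elim k)
    have "k \<le> r k" using assms(2) by (rule seq_suble)
    then show ?case using assms(1)[of n "r k"] elim by auto
  qed
  then show "(l n, l (n + 1)) \<in> E" by simp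
qed

lemma locally_compact_edge_paths:
  assumes out: "\<And>a. finite (E `` {a})" and inn: "\<And>a. finite (E\<inverse> `` {a})"
  shows "locally_compact_space (seq_topology (edge_paths E))"
proof -
  let ?X = "edge_paths E"
  interpret Metric_space ?X seq_dist by (rule Metric_space_seq_dist)
  show ?thesis unfolding locally_compact_space_def
  proof (intro ballI)
    fix x assume "x \<in> topspace (seq_topology ?X)"
    then have x: "x \<in> ?X" by simp
    \<comment> \<open>Fixing the letter at time 0 suffices: finite degrees leave finitely many
      letters at every other time, and diagonal extraction gives sequential compactness.\<close>
    let ?U = "{y \<in> ?X. agree_upto 0 x y}"
    have "compactin mtopology ?U"
      unfolding compactin_sequentially
    proof (intro conjI allI impI)
      fix s :: "nat \<Rightarrow> int \<Rightarrow> 'a" assume "range s \<subseteq> ?U"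
      then have s: "s k \<in> ?X" "agree_upto 0 x (s k)" for k by blast+
      have "finite (range (\<lambda>k. s k n))" for n
      proof (rule finite_subset)
        show "finite {y n | y. y \<in> edge_paths E \<and> y 0 \<in> {x 0}}"
          by (rule finite_reachable[OF out inn]) simp
        show "range (\<lambda>k. s k n) \<subseteq> {y n | y. y \<in> edge_paths E \<and> y 0 \<in> {x 0}}"
        proof (rule image_subsetI)
          fix k
          have "s k \<in> edge_paths E" "s k 0 = x 0" using s[of k] by (simp_all add: agree_upto_def)
          then show "s k n \<in> {y n | y. y \<in> edge_paths E \<and> y 0 \<in> {x 0}}" by blast
        qed
      qed
      then obtain r l where r: "strict_mono r" and l: "\<And>n. \<forall>\<^sub>F k in sequentially. s (r k) n = l n"
        using pointwise_convergent_subsequence by metis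
      have lX: "l \<in> ?X"
        by (rule edge_paths_limit[OF _ r l]) (use s in \<open>auto simp: edge_paths_def\<close>)
      have "\<forall>\<^sub>F k in sequentially. agree_upto 0 (s (r k)) l"
        by (rule eventually_agree_upto) (rule l)
      then obtain k where "agree_upto 0 (s (r k)) l" by (auto dest: eventually_happens)
      then have lU: "l \<in> ?U" using lX s by (auto intro: agree_upto_trans)
      have "limitin mtopology (s \<circ> r) l sequentially"
        unfolding limitin_metric
      proof (intro conjI allI impI lX)
        fix e :: real assume "e > 0"
        then obtain n where n: "exp (- real n) \<le> e" using exists_exp_le by blast
        have "\<forall>\<^sub>F k in sequentially. agree_upto n (s (r k)) l"
          by (rule eventually_agree_upto) (rule l)
        then show "\<forall>\<^sub>F k in sequentially. (s \<circ> r) k \<in> ?X \<and> seq_dist ((s \<circ> r) k) l < e"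
        proof eventually_elim
          case (elim k)
          then show ?case using n s by (auto simp flip: seq_dist_less_iff)
        qed
      qed
      then show "\<exists>l r. l \<in> ?U \<and> strict_mono r \<and> limitin mtopology (s \<circ> r) l sequentially"
        using lU r by blast
    qed auto
    then show "\<exists>U K. openin (seq_topology ?X) U \<and> compactin (seq_topology ?X) K \<and> x \<in> U \<and> U \<subseteq> K"
      using openin_cylinder[of ?X 0 x] x by (intro exI[of _ ?U]) auto
  qed
qed

text \<open>Fixing the letter at time j is an open condition, and these disjoint open sets cover
  \<open>K\<close>.\<close>

lemma compactin_seq_topology_finite_coordinate:
  assumes "compactin (seq_topology X) K"
  shows "finite ((\<lambda>q. q j) ` K)"
proof -
  let ?C = "(\<lambda>a. {q \<in> X. q j = a}) ` UNIV"
  have "openin (seq_topology X) {q \<in> X. q j = a}" for a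
    unfolding openin_seq_topology by (auto simp: agree_upto_def intro!: exI[of _ "nat \<bar>j\<bar>"])
  moreover have "K \<subseteq> X" using compactin_subset_topspace[OF assms] by simp
  then have "K \<subseteq> \<Union>?C" by auto
  ultimately have "\<exists>\<F>. finite \<F> \<and> \<F> \<subseteq> ?C \<and> K \<subseteq> \<Union>\<F>"
    using assms unfolding compactin_def by auto
  then obtain B where B: "finite B" "K \<subseteq> (\<Union>a\<in>B. {q \<in> X. q j = a})"
    by (metis (no_types, lifting) finite_subset_image)
  then have "(\<lambda>q. q j) ` K \<subseteq> B" by auto
  then show ?thesis using B(1) finite_subset by blast
qed

lemma locally_compact_finite_coordinates:
  assumes "locally_compact_space (seq_topology X)" "p \<in> X"
  obtains n where "\<And>j. finite {q j | q. q \<in> X \<and> agree_upto n p q}"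
proof -
  obtain U K where U: "openin (seq_topology X) U" "compactin (seq_topology X) K" "p \<in> U" "U \<subseteq> K"
    using assms unfolding locally_compact_space_def by auto
  then obtain n where "\<And>q. q \<in> X \<Longrightarrow> agree_upto n p q \<Longrightarrow> q \<in> U"
    unfolding openin_seq_topology by blast
  then have "{q j | q. q \<in> X \<and> agree_upto n p q} \<subseteq> (\<lambda>q. q j) ` K" for j
    using U by auto
  then show thesis
    using that compactin_seq_topology_finite_coordinate[OF U(2)] finite_subset by blast
qed

section \<open>Separation of analytic sets\<close>

text \<open>Projections of closed sets along Baire space. With the point kept as a separate factor,
  countable unions and intersections only recombine the codes.\<close>

definition analytic_set :: "'a::topological_space set \<Rightarrow> bool" where
  "analytic_set B \<longleftrightarrow> (\<exists>K :: ('a \<times> (nat \<Rightarrow> nat)) set. closed K \<and> B = fst ` K)"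

lemma closed_imp_analytic_set: "closed B \<Longrightarrow> analytic_set B"
  unfolding analytic_set_def by (intro exI[of _ "B \<times> UNIV"]) (auto intro: closed_Times)

lemma tendsto_coordinatewiseI:
  fixes f :: "'c \<Rightarrow> 'a \<Rightarrow> 'b::topological_space"
  assumes "\<And>i. ((\<lambda>c. f c i) \<longlongrightarrow> l i) F"
  shows "(f \<longlongrightarrow> l) F"
proof -
  have "limitin (product_topology (\<lambda>_. euclidean) UNIV) f l F"
    using assms by (simp add: limitin_componentwise)
  then show ?thesis by (simp add: euclidean_product_topology)
qed

lemma continuous_on_snd_coordinate:
  "continuous_on UNIV (\<lambda>p :: 'a::topological_space \<times> (nat \<Rightarrow> nat). snd p n)"
  by (rule continuous_on_product_then_coordinatewise) (rule continuous_on_snd[OF continuous_on_id])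

lemma analytic_set_UN:
  fixes B :: "nat \<Rightarrow> 'a::topological_space set"
  assumes "\<And>i. analytic_set (B i)"
  shows "analytic_set (\<Union>i. B i)"
proof -
  obtain K :: "nat \<Rightarrow> ('a \<times> (nat \<Rightarrow> nat)) set" where K: "\<And>i. closed (K i)" "\<And>i. B i = fst ` K i"
    using assms unfolding analytic_set_def by metis
  \<comment> \<open>The first entry of a code selects the index i; the remaining entries are a code
    for \<open>K i\<close>.\<close>
  define L where "L = {p :: 'a \<times> (nat \<Rightarrow> nat). (fst p, \<lambda>n. snd p (Suc n)) \<in> K (snd p 0)}"
  have cont: "continuous_on UNIV (\<lambda>p :: 'a \<times> (nat \<Rightarrow> nat). (fst p, \<lambda>n. snd p (Suc n)))"
    by (intro continuous_on_Pair continuous_on_fst continuous_on_id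
        continuous_on_coordinatewise_then_product continuous_on_snd_coordinate)
  have "- L = (\<Union>i. ((\<lambda>p. snd p 0) -` {i}) \<inter> ((\<lambda>p. (fst p, \<lambda>n. snd p (Suc n))) -` (- K i)))"
    unfolding L_def by auto
  also have "open \<dots>"
    using K(1) Topological_Spaces.open_discrete[of "{_::nat}"] by (intro open_UN ballI open_Int open_vimage cont continuous_on_snd_coordinate) auto
  finally have "closed L" by (simp add: closed_def)
  moreover have "(\<Union>i. B i) = fst ` L"
  proof (intro equalityI subsetI)
    fix x assume "x \<in> (\<Union>i. B i)"
    then obtain i w where "(x, w) \<in> K i" using K(2) by auto
    then have "(x, case_nat i w) \<in> L" by (simp add: L_def)
    then show "x \<in> fst ` L" by force
  next
    fix x assume "x \<in> fst ` L"
    then show "x \<in> (\<Union>i. B i)" using K(2) unfolding L_def by force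
  qed
  ultimately show ?thesis unfolding analytic_set_def by blast
qed

lemma analytic_set_INT:
  fixes B :: "nat \<Rightarrow> 'a::topological_space set"
  assumes "\<And>i. analytic_set (B i)"
  shows "analytic_set (\<Inter>i. B i)"
proof -
  obtain K :: "nat \<Rightarrow> ('a \<times> (nat \<Rightarrow> nat)) set" where K: "\<And>i. closed (K i)" "\<And>i. B i = fst ` K i"
    using assms unfolding analytic_set_def by metis
  \<comment> \<open>One code is split along \<open>prod_encode\<close> into a sequence of codes, one
    for each i.\<close>
  define g where "g i p = (fst p, \<lambda>n. snd p (prod_encode (i, n)))" for i and p :: "'a \<times> (nat \<Rightarrow> nat)"
  have cont: "continuous_on UNIV (g i)" for i
    unfolding g_def
    by (intro continuous_on_Pair continuous_on_fst continuous_on_id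
        continuous_on_coordinatewise_then_product continuous_on_snd_coordinate)
  define L where "L = (\<Inter>i. g i -` K i)"
  have "closed L" unfolding L_def using K(1) cont by (intro closed_INT ballI closed_vimage) auto
  moreover have "(\<Inter>i. B i) = fst ` L"
  proof (intro equalityI subsetI)
    fix x assume "x \<in> (\<Inter>i. B i)"
    then have "\<forall>i. \<exists>w. (x, w) \<in> K i" using K(2) by force
    then obtain w where w: "\<And>i. (x, w i) \<in> K i" by metis
    have "(x, \<lambda>m. w (fst (prod_decode m)) (snd (prod_decode m))) \<in> L"
      unfolding L_def g_def using w by auto
    then show "x \<in> fst ` L" by force
  next
    fix x assume "x \<in> fst ` L"
    then obtain w where "(x, w) \<in> L" by auto
    then have "g i (x, w) \<in> K i" for i unfolding L_def by auto
    then show "x \<in> (\<Inter>i. B i)" using K(2) unfolding g_def by (auto intro!: image_eqI)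
  qed
  ultimately show ?thesis unfolding analytic_set_def by blast
qed

lemma open_imp_analytic_set:
  fixes U :: "'a::topological_space set"
  assumes "metrizable_space (euclidean :: 'a topology)" "open U"
  shows "analytic_set U"
proof -
  have "fsigma_in euclidean U" using assms by (intro open_imp_fsigma_in) auto
  then obtain C where "\<And>n::nat. closed (C n)" "(\<Union>n. C n) = U"
    unfolding fsigma_in_ascending by auto
  then show ?thesis using analytic_set_UN[of C] closed_imp_analytic_set by metis
qed

lemma borel_imp_analytic_set:
  fixes B :: "'a::topological_space set"
  assumes metrizable: "metrizable_space (euclidean :: 'a topology)" and "B \<in> sets borel"
  shows "analytic_set B"
proof -
  have "B \<in> sigma_sets UNIV {S. open S}" using assms(2) by (simp add: borel_def)
  \<comment> \<open>Complements of analytic sets need not be analytic, so the induction carries a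
    set together with its complement.\<close>
  then have "analytic_set B \<and> analytic_set (- B)"
  proof (induction rule: sigma_sets.induct)
    case (Basic S)
    then show ?case by (auto intro: open_imp_analytic_set[OF metrizable] closed_imp_analytic_set)
  next
    case Empty
    then show ?case by (auto intro: closed_imp_analytic_set)
  next
    case (Compl S)
    then show ?case by (simp add: Compl_eq_Diff_UNIV double_diff)
  next
    case (Union S)
    have "- (\<Union>i. S i) = (\<Inter>i. - S i)" by auto
    then show ?case using Union.IH by (auto intro: analytic_set_UN analytic_set_INT)
  qed
  then show ?thesis by blast
qed

text \<open>The Lusin separation argument. If no measurable set separates the parts of \<open>P\<close> and \<open>Q\<close> with
  given finite prefixes of codes, the same holds for some one-step extensions of the prefixes; in
  the limit this yields two codes whose \<open>h\<close>-values agree.\<close>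

lemma analytic_separation:
  fixes K L :: "(nat \<Rightarrow> nat) set" and r :: "nat \<Rightarrow> nat" and h :: "'y \<Rightarrow> nat \<Rightarrow> nat"
  assumes closed: "closed K" "closed L"
    and disj: "\<And>u v. u \<in> K \<Longrightarrow> v \<in> L \<Longrightarrow> r \<circ> u \<noteq> r \<circ> v"
    and h: "\<And>n k. {y \<in> space M. h y n = k} \<in> sets M"
    and P: "\<And>y. y \<in> P \<Longrightarrow> y \<in> space M \<and> (\<exists>u\<in>K. h y = r \<circ> u)"
    and Q: "\<And>y. y \<in> Q \<Longrightarrow> y \<in> space M \<and> (\<exists>v\<in>L. h y = r \<circ> v)"
  obtains D where "D \<in> sets M" "P \<subseteq> D" "D \<inter> Q = {}"
proof (rule ccontr)
  assume "\<not> thesis"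
  then have nsep: "\<not> (\<exists>D\<in>sets M. P \<subseteq> D \<and> D \<inter> Q = {})" using that by blast
  define cyl where "cyl A C n u = {y \<in> A. \<exists>w\<in>C. h y = r \<circ> w \<and> (\<forall>i<n. w i = u i)}"
    for A :: "'y set" and C :: "(nat \<Rightarrow> nat) set" and n and u :: "nat \<Rightarrow> nat"
  define sep where "sep A B \<longleftrightarrow> (\<exists>D\<in>sets M. A \<subseteq> D \<and> D \<inter> B = {})" for A B
  \<comment> \<open>If \<open>D i j\<close> separates piece i from piece j, the union over i of the
    intersections over j separates the unions.\<close>
  have sep_UN: "sep A B" if A: "A = (\<Union>i::nat. A' i)" and B: "B = (\<Union>i::nat. B' i)"
      and sep: "\<And>i j. sep (A' i) (B' j)" for A B A' B'
  proof -
    obtain D where D: "\<And>i j. D i j \<in> sets M" "\<And>i j. A' i \<subseteq> D i j" "\<And>i j. D i j \<inter> B' j = {}"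
      using sep unfolding sep_def by metis
    show ?thesis unfolding sep_def
    proof (intro bexI conjI)
      show "(\<Union>i. \<Inter>j. D i j) \<in> sets M" using D(1) by (intro sets.countable_UN sets.countable_INT) auto
      show "A \<subseteq> (\<Union>i. \<Inter>j. D i j)" unfolding A using D(2) by blast
      show "(\<Union>i. \<Inter>j. D i j) \<inter> B = {}" unfolding B using D(3) by blast
    qed
  qed
  define S where "S n p \<longleftrightarrow> \<not> sep (cyl P K n (fst p)) (cyl Q L n (snd p))"
    for n and p :: "(nat \<Rightarrow> nat) \<times> (nat \<Rightarrow> nat)"
  have split: "cyl A C n u = (\<Union>k. cyl A C (Suc n) (u(n := k)))" for A C n u
    unfolding cyl_def by (auto simp: less_Suc_eq)
  have "\<exists>f. \<forall>n. S n (f n) \<and> (\<forall>i<n. fst (f (Suc n)) i = fst (f n) i \<and> snd (f (Suc n)) i = snd (f n) i)"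
  proof (rule dependent_nat_choice)
    have "cyl P K 0 u = P" "cyl Q L 0 u = Q" for u unfolding cyl_def using P Q by auto
    then show "\<exists>p. S 0 p" unfolding S_def sep_def using nsep by auto
  next
    fix p n assume "S n p"
    then obtain k l where "\<not> sep (cyl P K (Suc n) ((fst p)(n := k))) (cyl Q L (Suc n) ((snd p)(n := l)))"
      unfolding S_def using sep_UN[OF split split] by blast
    then show "\<exists>q. S (Suc n) q \<and> (\<forall>i<n. fst q i = fst p i \<and> snd q i = snd p i)"
      unfolding S_def by (intro exI[of _ "((fst p)(n := k), (snd p)(n := l))"]) auto
  qed
  then obtain f where f: "\<And>n. S n (f n)"
    and step: "\<And>n i. i < n \<Longrightarrow> fst (f (Suc n)) i = fst (f n) i \<and> snd (f (Suc n)) i = snd (f n) i" by metis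
  define u v where "u i = fst (f (Suc i)) i" and "v i = snd (f (Suc i)) i" for i
  have stable: "i < n \<Longrightarrow> fst (f n) i = u i \<and> snd (f n) i = v i" for i n
  proof (induction n)
    case (Suc n)
    then show ?case using step[of i n] unfolding u_def v_def by (cases "i = n") auto
  qed simp
  have fu: "cyl A C n (fst (f n)) = cyl A C n u" and fv: "cyl A C n (snd (f n)) = cyl A C n v" for A C n
    unfolding cyl_def using stable by auto
  have S: "\<not> sep (cyl P K n u) (cyl Q L n v)" for n using f[of n] unfolding S_def fu fv .
  \<comment> \<open>A sequence all of whose finite prefixes extend to members of a closed set lies
    in that set, so both limits are genuine codes.\<close>
  have limit: "w \<in> C" if C: "closed C" and ne: "\<And>n. cyl A C n w \<noteq> {}" for A C w
  proof (rule ccontr)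
    assume "w \<notin> C"
    have "\<forall>n. \<exists>w'\<in>C. \<forall>i<n. w' i = w i" using ne unfolding cyl_def by blast
    then obtain s where s: "\<And>n. s n \<in> C" "\<And>n i. i < n \<Longrightarrow> s n i = w i" by metis
    have "s \<longlonglongrightarrow> w"
    proof (intro tendsto_coordinatewiseI tendsto_eventually)
      fix i show "\<forall>\<^sub>F n in sequentially. s n i = w i"
        by (rule eventually_sequentiallyI[of "Suc i"]) (simp add: s(2))
    qed
    then have "w \<in> C" using C s(1) closed_sequentially by blast
    then show False using \<open>w \<notin> C\<close> by simp
  qed
  have "u \<in> K"
  proof (rule limit[OF closed(1)])
    show "cyl P K n u \<noteq> {}" for n using S[of n] unfolding sep_def by auto
  qed
  moreover have "v \<in> L"
  proof (rule limit[OF closed(2)])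
    fix n
    have "cyl P K n u \<subseteq> space M" unfolding cyl_def using P by blast
    then show "cyl Q L n v \<noteq> {}" using S[of n] unfolding sep_def by auto
  qed
  ultimately obtain n where n: "r (u n) \<noteq> r (v n)" using disj by fastforce
  \<comment> \<open>On the two cylinders of length n + 1 the n-th value of \<open>h\<close> is
    constant, with different constants, so a level set of \<open>h\<close> separates them.\<close>
  have "sep (cyl P K (Suc n) u) (cyl Q L (Suc n) v)"
    unfolding sep_def
  proof (intro bexI conjI)
    show "{y \<in> space M. h y n = r (u n)} \<in> sets M" by (rule h)
    show "cyl P K (Suc n) u \<subseteq> {y \<in> space M. h y n = r (u n)}"
      unfolding cyl_def using P by auto
    show "{y \<in> space M. h y n = r (u n)} \<inter> cyl Q L (Suc n) v = {}"
      unfolding cyl_def using n by auto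
  qed
  then show False using S by blast
qed

text \<open>Images under a Borel map \<open>p\<close> of two Borel sets whose images are disjoint; codes are triples of
  a point, the membership pattern of its image, and a witness for the graph of \<open>p\<close> being
  analytic.\<close>

lemma borel_image_separation:
  fixes p :: "(int \<Rightarrow> nat) \<Rightarrow> 'y" and U :: "nat \<Rightarrow> 'y set"
  assumes Z: "Z \<in> sets borel" and p: "p \<in> measurable (restrict_space borel Z) M"
    and U: "\<And>n. U n \<in> sets M"
    and separating: "\<And>y y'. y \<in> space M \<Longrightarrow> y' \<in> space M \<Longrightarrow> (\<And>n. y \<in> U n \<longleftrightarrow> y' \<in> U n) \<Longrightarrow> y = y'"
    and B: "B \<in> sets borel" "B \<subseteq> Z" and C: "C \<in> sets borel" "C \<subseteq> Z"
    and disj: "p ` B \<inter> p ` C = {}"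
  obtains D where "D \<in> sets M" "p ` B \<subseteq> D" "D \<inter> p ` C = {}"
proof -
  \<comment> \<open>Entry n of a code is a pair: a letter of the point, and a second pair consisting
    of the n-th value of \<open>h\<close> and an entry of the witness. \<open>?r\<close> reads off
    the value of \<open>h\<close>.\<close>
  let ?r = "fst \<circ> prod_decode \<circ> snd \<circ> prod_decode"
  define h where "h y n = (if y \<in> U n then 1 else 0 :: nat)" for y n
  have pZ: "p x \<in> space M" if "x \<in> Z" for x
    using measurable_space[OF p] that by (simp add: space_restrict_space)
  have "discrete_topology UNIV = (euclidean :: nat topology)"
    by (simp add: discrete_topology_unique Topological_Spaces.open_discrete)
  then have "metrizable_space (euclidean :: nat topology)"
    by (metis metrizable_space_discrete_topology)
  then have metrizable: "metrizable_space (euclidean :: ((int \<Rightarrow> nat) \<times> (nat \<Rightarrow> nat)) topology)"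
    unfolding prod_topology_euclidean[symmetric] euclidean_product_topology[symmetric]
      metrizable_space_prod_topology metrizable_space_product_topology
    by simp
  \<comment> \<open>The graph of the membership pattern over \<open>A\<close>. It is Borel because
    each entry of the pattern only tests one set \<open>U n\<close>.\<close>
  define \<Gamma> where "\<Gamma> A = {q :: (int \<Rightarrow> nat) \<times> (nat \<Rightarrow> nat). fst q \<in> A \<and> snd q = h (p (fst q))}" for A
  have \<Gamma>: "\<Gamma> A \<in> sets borel" if A: "A \<in> sets borel" "A \<subseteq> Z" for A
  proof -
    have pre: "{x \<in> Z. p x \<in> U n} \<in> sets borel" for n
    proof -
      have "p -` U n \<inter> space (restrict_space borel Z) \<in> sets (restrict_space borel Z)"
        using p U by (rule measurable_sets)
      then show ?thesis
        using Z by (auto simp: sets_restrict_space_iff space_restrict_space Int_def conj_commute)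
    qed
    define W where "W n = {x \<in> Z. p x \<in> U n}" for n
    have [measurable]: "W n \<in> sets borel" "A \<in> sets borel" for n using pre A by (auto simp: W_def)
    have [measurable]: "fst \<in> borel_measurable (borel :: ((int \<Rightarrow> nat) \<times> (nat \<Rightarrow> nat)) measure)"
      by (intro borel_measurable_continuous_onI continuous_intros)
    have m: "(\<lambda>q. snd q n) \<in> borel_measurable (borel :: ((int \<Rightarrow> nat) \<times> (nat \<Rightarrow> nat)) measure)" for n
      by (intro borel_measurable_continuous_onI continuous_on_snd_coordinate)
    have "\<Gamma> A = {q \<in> space borel. fst q \<in> A \<and> (\<forall>n. snd q n = (if fst q \<in> W n then 1 else 0))}"
      unfolding \<Gamma>_def W_def h_def using A(2) by (auto simp: fun_eq_iff)
    also have "\<dots> \<in> sets borel"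
      using m by measurable
    finally show ?thesis .
  qed
  have ex: "\<exists>K :: (nat \<Rightarrow> nat) set. closed K \<and> (\<forall>u\<in>K. \<exists>x\<in>A. h (p x) = ?r \<circ> u)
      \<and> (\<forall>x\<in>A. \<exists>u\<in>K. h (p x) = ?r \<circ> u)"
    if A: "A \<in> sets borel" "A \<subseteq> Z" for A
  proof -
    obtain K0 :: "(((int \<Rightarrow> nat) \<times> (nat \<Rightarrow> nat)) \<times> (nat \<Rightarrow> nat)) set"
      where K0: "closed K0" "\<Gamma> A = fst ` K0"
      using borel_imp_analytic_set[OF metrizable \<Gamma>[OF A]] unfolding analytic_set_def by blast
    define dec where "dec u = ((\<lambda>i. fst (prod_decode (u (int_encode i))),
        \<lambda>n. fst (prod_decode (snd (prod_decode (u n))))), \<lambda>n. snd (prod_decode (snd (prod_decode (u n)))))"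
      for u :: "nat \<Rightarrow> nat"
    have disc: "continuous_on UNIV (\<lambda>u::nat \<Rightarrow> nat. g (u n))" for g :: "nat \<Rightarrow> nat" and n
      by (rule continuous_on_compose2[of UNIV g UNIV "\<lambda>u. u n"])
        (auto intro: continuous_on_product_coordinates)
    have "continuous_on UNIV dec"
      unfolding dec_def
      by (intro continuous_on_Pair continuous_on_coordinatewise_then_product
          disc[of "\<lambda>m. fst (prod_decode m)"] disc[of "\<lambda>m. fst (prod_decode (snd (prod_decode m)))"]
          disc[of "\<lambda>m. snd (prod_decode (snd (prod_decode m)))"])
    then have "closed (dec -` K0)" using K0(1) by (intro closed_vimage)
    moreover have "\<exists>x\<in>A. h (p x) = ?r \<circ> u" if "u \<in> dec -` K0" for u
    proof -
      have "fst (dec u) \<in> \<Gamma> A" using that K0(2) by auto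
      then show ?thesis unfolding \<Gamma>_def dec_def by (intro bexI[of _ "fst (fst (dec u))"]) (auto simp: dec_def fun_eq_iff)
    qed
    moreover have "\<exists>u\<in>dec -` K0. h (p x) = ?r \<circ> u" if "x \<in> A" for x
    proof -
      have "(x, h (p x)) \<in> \<Gamma> A" using that by (simp add: \<Gamma>_def)
      then obtain w where w: "((x, h (p x)), w) \<in> K0" using K0(2) by auto
      define u where "u n = prod_encode (x (int_decode n), prod_encode (h (p x) n, w n))" for n
      have "dec u = ((x, h (p x)), w)" unfolding dec_def u_def by simp
      moreover have "h (p x) = ?r \<circ> u" unfolding u_def by auto
      ultimately show ?thesis using w by (intro bexI[of _ u]) auto
    qed
    ultimately show ?thesis by blast
  qed
  obtain K where K: "closed K" "\<And>u. u \<in> K \<Longrightarrow> \<exists>x\<in>B. h (p x) = ?r \<circ> u"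
    "\<And>x. x \<in> B \<Longrightarrow> \<exists>u\<in>K. h (p x) = ?r \<circ> u"
    using ex[OF B] by blast
  obtain L where L: "closed L" "\<And>u. u \<in> L \<Longrightarrow> \<exists>x\<in>C. h (p x) = ?r \<circ> u"
    "\<And>x. x \<in> C \<Longrightarrow> \<exists>u\<in>L. h (p x) = ?r \<circ> u"
    using ex[OF C] by blast
  show thesis
  proof (rule analytic_separation[OF K(1) L(1), where M = M and P = "p ` B" and Q = "p ` C" and h = h
        and r = ?r])
    fix u v assume "u \<in> K" "v \<in> L"
    then obtain x x' where x: "x \<in> B" "h (p x) = ?r \<circ> u"
      "x' \<in> C" "h (p x') = ?r \<circ> v" using K(2) L(2) by blast
    show "?r \<circ> u \<noteq> ?r \<circ> v"
    proof
      assume "?r \<circ> u = ?r \<circ> v"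
      then have "h (p x) = h (p x')" using x by simp
      then have "p x \<in> U n \<longleftrightarrow> p x' \<in> U n" for n
        unfolding h_def by (metis one_neq_zero)
      then have "p x = p x'" using separating[of "p x" "p x'"] pZ x B(2) C(2) by blast
      then show False using disj x by blast
    qed
  next
    fix n k
    have "{y \<in> space M. h y n = k} = (if k = 1 then U n else if k = 0 then space M - U n else {})"
      using sets.sets_into_space[OF U[of n]] by (auto simp: h_def)
    then show "{y \<in> space M. h y n = k} \<in> sets M" using U by auto
  qed (use K(3) L(3) pZ B(2) C(2) that in auto)
qed

section \<open>Fibers, markers and the transition graph\<close>

lemma infinite_nonpos_iff: "infinite {n::int. n \<le> 0 \<and> P n} \<longleftrightarrow> (\<forall>m. \<exists>n\<le>m. P n)"
proof
  assume inf: "infinite {n. n \<le> 0 \<and> P n}"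
  show "\<forall>m. \<exists>n\<le>m. P n"
  proof (rule allI, rule ccontr)
    fix m assume "\<not> (\<exists>n\<le>m. P n)"
    then have "m \<le> n" if "P n" for n using that by (cases "n \<le> m") auto
    then have "{n. n \<le> 0 \<and> P n} \<subseteq> {m..0}" by auto
    then show False using inf finite_subset by blast
  qed
next
  assume *: "\<forall>m. \<exists>n\<le>m. P n"
  show "infinite {n. n \<le> 0 \<and> P n}"
  proof
    assume fin: "finite {n. n \<le> 0 \<and> P n}"
    then obtain n where n: "n \<le> min 0 (Min (insert 0 {n. n \<le> 0 \<and> P n}) - 1)" "P n" using * by blast
    then have "n \<ge> Min (insert 0 {n. n \<le> 0 \<and> P n})" using fin by (intro Min_le) auto
    then show False using n by linarith
  qed
qed

lemma infinite_nonneg_iff: "infinite {n::int. 0 \<le> n \<and> P n} \<longleftrightarrow> (\<forall>m. \<exists>n\<ge>m. P n)"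
proof -
  have "{n. n \<le> 0 \<and> P (- n)} = uminus ` {n. 0 \<le> n \<and> P n}"
  proof (intro equalityI subsetI)
    fix n assume "n \<in> {n. n \<le> 0 \<and> P (- n)}"
    then show "n \<in> uminus ` {n. 0 \<le> n \<and> P n}" by (intro image_eqI[of _ _ "- n"]) auto
  qed auto
  then have "infinite {n. 0 \<le> n \<and> P n} \<longleftrightarrow> infinite {n. n \<le> 0 \<and> P (- n)}"
    by (simp add: finite_image_iff)
  also have "\<dots> \<longleftrightarrow> (\<forall>m. \<exists>n\<le>m. P (- n))" by (rule infinite_nonpos_iff)
  also have "\<dots> \<longleftrightarrow> (\<forall>m. \<exists>n\<ge>m. P n)"
  proof (intro iffI allI)
    fix m assume "\<forall>m. \<exists>n\<le>m. P (- n)"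
    then obtain n where "n \<le> - m" "P (- n)" by blast
    then show "\<exists>n\<ge>m. P n" by (intro exI[of _ "- n"]) auto
  next
    fix m assume "\<forall>m. \<exists>n\<ge>m. P n"
    then obtain n where "n \<ge> - m" "P n" by blast
    then show "\<exists>n\<le>m. P (- n)" by (intro exI[of _ "- n"]) auto
  qed
  finally show ?thesis .
qed

lemma regular_part_iff:
  "x \<in> regular_part A X \<longleftrightarrow> x \<in> X \<and> (\<exists>u\<in>A. \<forall>m. \<exists>n\<le>m. x n = u) \<and> (\<exists>v\<in>A. \<forall>m. \<exists>n\<ge>m. x n = v)"
  unfolding regular_part_def infinite_nonpos_iff infinite_nonneg_iff by blast

definition shift_by :: "int \<Rightarrow> (int \<Rightarrow> 'a) \<Rightarrow> int \<Rightarrow> 'a" where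
  "shift_by k x = (\<lambda>n. x (n + k))"

lemma shift_by_apply [simp]: "shift_by k x n = x (n + k)"
  by (simp add: shift_by_def)

lemma shift_by_add [simp]: "shift_by k (shift_by l x) = shift_by (k + l) x"
  by (simp add: shift_by_def add.assoc)

lemma shift_by_image_add [simp]: "shift_by k ` shift_by l ` F = shift_by (k + l) ` F"
  by (simp add: image_image)

lemma shift_by_0 [simp]: "shift_by 0 x = x" "shift_by 0 ` F = F"
  by (auto simp: shift_by_def)

lemma shift_map_eq: "shift_map = shift_by 1"
  by (auto simp: shift_map_def fun_eq_iff)

lemma shift_by_eq_iff [simp]: "shift_by k x = shift_by k y \<longleftrightarrow> x = y"
proof
  assume "shift_by k x = shift_by k y"
  then have "shift_by (- k) (shift_by k x) = shift_by (- k) (shift_by k y)" by (rule arg_cong)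
  then show "x = y" by simp
qed simp

lemma shift_by_mem_image_iff [simp]: "shift_by k x \<in> shift_by k ` F \<longleftrightarrow> x \<in> F"
  by auto

lemma shift_by_edge_paths [simp]: "shift_by k x \<in> edge_paths E \<longleftrightarrow> x \<in> edge_paths E"
proof
  show "shift_by k x \<in> edge_paths E" if "x \<in> edge_paths E" for k and x
  proof -
    have "(x (n + k), x (n + k + 1)) \<in> E" for n using that unfolding edge_paths_def by blast
    then show ?thesis unfolding edge_paths_def by (simp add: add_ac)
  qed
  from this[of "shift_by k x" "- k"] show "shift_by k x \<in> edge_paths E \<Longrightarrow> x \<in> edge_paths E" by simp
qed

definition seg :: "int \<Rightarrow> int \<Rightarrow> (int \<Rightarrow> 'a) \<Rightarrow> 'a list" where
  "seg a b x = map x [a..b]"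

lemma seg_eq_iff: "seg a b x = seg a b y \<longleftrightarrow> (\<forall>k. a \<le> k \<and> k \<le> b \<longrightarrow> x k = y k)"
  by (auto simp: seg_def)

lemma seg_nth: "a \<le> k \<Longrightarrow> k \<le> b \<Longrightarrow> seg a b x ! nat (k - a) = x k"
  by (simp add: seg_def nth_map)

lemma length_seg [simp]: "length (seg a b x) = nat (b - a + 1)"
  by (simp add: seg_def)

lemma seg_shift_by: "seg a b (shift_by k x) = seg (a + k) (b + k) x"
  by (rule nth_equalityI) (auto simp: seg_def add_ac)

lemma seg_shift_by_image: "seg a b ` shift_by k ` F = seg (a + k) (b + k) ` F"
  by (simp add: image_image seg_shift_by)

lemma seg_subseg:
  assumes "A \<le> a" "b \<le> B"
  shows "seg a b x = map (\<lambda>k. seg A B x ! nat (k - A)) [a..b]"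
  unfolding seg_def[of a b] using assms by (auto simp: seg_nth)

lemma seg_image_subseg:
  assumes "seg A B ` F = seg A B ` F'" "A \<le> a" "b \<le> B"
  shows "seg a b ` F = seg a b ` F'"
proof -
  have "seg a b ` H = (\<lambda>w. map (\<lambda>k. w ! nat (k - A)) [a..b]) ` seg A B ` H" for H :: "(int \<Rightarrow> 'a) set"
    unfolding image_image by (rule image_cong) (simp_all only: seg_subseg[OF assms(2,3)])
  then show ?thesis using assms(1) by simp
qed

lemma seg_image_eqD:
  assumes "seg a b ` F = seg a b ` F'" "x \<in> F"
  obtains y where "y \<in> F'" "\<And>k. a \<le> k \<Longrightarrow> k \<le> b \<Longrightarrow> y k = x k"
proof -
  have "seg a b x \<in> seg a b ` F'" using assms by blast
  then show thesis using that by (auto simp: seg_eq_iff)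
qed

text \<open>Dependent choice is run to the right and to the left of \<open>n\<close>, and the two
  branches are glued at their common start.\<close>

lemma int_bidirectional_choice:
  fixes P :: "int \<Rightarrow> 'b \<Rightarrow> bool"
  assumes start: "P n a"
    and fwd: "\<And>m a. P m a \<Longrightarrow> \<exists>b. P (m + 1) b \<and> Q m a b"
    and bwd: "\<And>m b. P (m + 1) b \<Longrightarrow> \<exists>a. P m a \<and> Q m a b"
  obtains w where "w n = a" "\<And>m. P m (w m)" "\<And>m. Q m (w m) (w (m + 1))"
proof -
  have "\<exists>f. \<forall>i. (P (n + int i) (f i) \<and> (i = 0 \<longrightarrow> f i = a)) \<and> Q (n + int i) (f i) (f (Suc i))"
  proof (rule dependent_nat_choice)
    fix b i assume "P (n + int i) b \<and> (i = 0 \<longrightarrow> b = a)"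
    then obtain c where "P (n + int i + 1) c" "Q (n + int i) b c" using fwd by blast
    then show "\<exists>c. (P (n + int (Suc i)) c \<and> (Suc i = 0 \<longrightarrow> c = a)) \<and> Q (n + int i) b c"
      by (intro exI[of _ c]) (simp add: add_ac)
  qed (use start in auto)
  then obtain f where f: "\<And>i. P (n + int i) (f i)" "f 0 = a" "\<And>i. Q (n + int i) (f i) (f (Suc i))" by blast
  have "\<exists>g. \<forall>i. (P (n - int i) (g i) \<and> (i = 0 \<longrightarrow> g i = a)) \<and> Q (n - int (Suc i)) (g (Suc i)) (g i)"
  proof (rule dependent_nat_choice)
    fix b i assume "P (n - int i) b \<and> (i = 0 \<longrightarrow> b = a)"
    then show "\<exists>c. (P (n - int (Suc i)) c \<and> (Suc i = 0 \<longrightarrow> c = a)) \<and> Q (n - int (Suc i)) c b"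
      using bwd[of "n - int (Suc i)" b] by (auto simp: algebra_simps)
  qed (use start in auto)
  then obtain g where g: "\<And>i. P (n - int i) (g i)" "g 0 = a" "\<And>i. Q (n - int (Suc i)) (g (Suc i)) (g i)" by blast
  define w where "w m = (if n \<le> m then f (nat (m - n)) else g (nat (n - m)))" for m
  show thesis
  proof (rule that)
    show "w n = a" by (simp add: w_def f)
    fix m
    show "P m (w m)" using f(1)[of "nat (m - n)"] g(1)[of "nat (n - m)"] by (auto simp: w_def)
    consider "n \<le> m" | "m = n - 1" | "m < n - 1" by linarith
    then show "Q m (w m) (w (m + 1))"
    proof cases
      case 1
      then have "nat (m + 1 - n) = Suc (nat (m - n))" by simp
      then show ?thesis using 1 f(3)[of "nat (m - n)"] by (simp add: w_def)
    next
      case 2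
      then show ?thesis using g(3)[of 0] f(2) g(2) by (simp add: w_def)
    next
      case 3
      then have "nat (n - m) = Suc (nat (n - (m + 1)))" by simp
      then show ?thesis using 3 g(3)[of "nat (n - (m + 1))"] by (simp add: w_def)
    qed
  qed
qed

text \<open>This numbering makes "least window" meaningful. It is injective on finite sets only,
  which is enough because fibers are finite.\<close>

definition enc :: "nat list set \<Rightarrow> nat" where
  "enc = to_nat_on {V. finite V}"

lemma enc_inj: "finite V \<Longrightarrow> finite V' \<Longrightarrow> enc V = enc V' \<Longrightarrow> V = V'"
  unfolding enc_def
  using to_nat_on_inj[of "{V :: nat list set. finite V}" V V'] countable_Collect_finite by auto

text \<open>The binary logarithm rounded up, with value 0 at 0; \<open>log_ceil_le_iff\<close> is
  its working characterization.\<close>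

definition log_ceil :: "nat \<Rightarrow> nat" where
  "log_ceil g = (LEAST c. g \<le> 2 ^ c)"

lemma log_ceil_le_iff: "log_ceil g \<le> c \<longleftrightarrow> g \<le> 2 ^ c"
proof
  have "g \<le> 2 ^ log_ceil g" unfolding log_ceil_def by (rule LeastI[of _ g]) (simp add: less_imp_le)
  also assume "log_ceil g \<le> c"
  then have "(2::nat) ^ log_ceil g \<le> 2 ^ c" by simp
  finally show "g \<le> 2 ^ c" .
next
  assume "g \<le> 2 ^ c"
  then show "log_ceil g \<le> c" unfolding log_ceil_def by (rule Least_le)
qed

lemma log_ceil_mono: "g \<le> h \<Longrightarrow> log_ceil g \<le> log_ceil h"
  using log_ceil_le_iff le_trans by blast

text \<open>Reflexivity and transitivity of \<open>R\<close> are asked only along regular paths: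
  there the Bowen property makes \<open>R\<close> the relation of having equal images, whereas on
  single letters it need not be transitive.\<close>

locale coded_shift =
  fixes E R :: "(nat \<times> nat) set"
  assumes finite_out: "\<And>a. finite (E `` {a})"
    and finite_in: "\<And>a. finite (E\<inverse> `` {a})"
    and R_sym: "\<And>a b. (a, b) \<in> R \<Longrightarrow> (b, a) \<in> R"
    and R_finite: "\<And>a. finite (R `` {a})"
    and R_refl: "\<And>x n. x \<in> regular_part UNIV (edge_paths E) \<Longrightarrow> (x n, x n) \<in> R"
    and R_trans: "\<And>x y z. x \<in> regular_part UNIV (edge_paths E) \<Longrightarrow>
      y \<in> regular_part UNIV (edge_paths E) \<Longrightarrow> z \<in> regular_part UNIV (edge_paths E) \<Longrightarrow>
      (\<And>n. (x n, y n) \<in> R) \<Longrightarrow> (\<And>n. (y n, z n) \<in> R) \<Longrightarrow> (x n, z n) \<in> R"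
    and finite_classes: "\<And>x. x \<in> regular_part UNIV (edge_paths E) \<Longrightarrow>
      finite {y \<in> regular_part UNIV (edge_paths E). \<forall>n. (y n, x n) \<in> R}"
begin

definition Reg :: "(int \<Rightarrow> nat) set" where
  "Reg = regular_part UNIV (edge_paths E)"

text \<open>No regularity of \<open>y\<close> is demanded, so that membership is a closed condition
  and compactness applies; for regular \<open>x\<close> it follows from
  \<open>Reg_related\<close>.\<close>

definition cls :: "(int \<Rightarrow> nat) \<Rightarrow> (int \<Rightarrow> nat) set" where
  "cls x = {y \<in> edge_paths E. \<forall>n. (y n, x n) \<in> R}"

lemma Reg_iff:
  "x \<in> Reg \<longleftrightarrow> x \<in> edge_paths E \<and> (\<exists>u. \<forall>m. \<exists>n\<le>m. x n = u) \<and> (\<exists>v. \<forall>m. \<exists>n\<ge>m. x n = v)"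
  by (simp add: Reg_def regular_part_iff)

lemma Reg_path: "x \<in> Reg \<Longrightarrow> x \<in> edge_paths E"
  by (simp add: Reg_iff)

lemma finite_set_recurs:
  assumes "finite D" "\<And>m. \<exists>n\<ge>m. (x n :: nat) \<in> D" shows "\<exists>v. \<forall>m. \<exists>n\<ge>m::int. x n = v"
proof (rule ccontr)
  assume "\<not> ?thesis"
  then obtain M where M: "\<And>v n. n \<ge> M v \<Longrightarrow> x n \<noteq> v" by metis
  obtain n where n: "n \<ge> Max (insert 0 (M ` D))" "x n \<in> D" using assms(2) by blast
  then have "n \<ge> M (x n)" using assms(1) by auto
  then show False using M by blast
qed

lemma finite_set_recurs_past:
  assumes "finite D" "\<And>m. \<exists>n\<le>m. (x n :: nat) \<in> D" shows "\<exists>v. \<forall>m. \<exists>n\<le>m::int. x n = v"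
proof -
  have "\<exists>v. \<forall>m. \<exists>n\<ge>m. x (- n) = v"
  proof (rule finite_set_recurs[OF assms(1)])
    fix m
    obtain n where "n \<le> - m" "x n \<in> D" using assms(2) by blast
    then show "\<exists>n\<ge>m. x (- n) \<in> D" by (intro exI[of _ "- n"]) auto
  qed
  then obtain v where v: "\<And>m. \<exists>n\<ge>m. x (- n) = v" by blast
  have "\<exists>n\<le>m. x n = v" for m
  proof -
    obtain n where "n \<ge> - m" "x (- n) = v" using v by blast
    then show ?thesis by (intro exI[of _ "- n"]) auto
  qed
  then show ?thesis by blast
qed

text \<open>Whenever \<open>x\<close> visits its recurring letter u, \<open>y\<close> is in the
  finite set of letters related to u, so one of these recurs as well.\<close>

lemma Reg_related:
  assumes "y \<in> edge_paths E" "x \<in> Reg" "\<And>n. (y n, x n) \<in> R"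
  shows "y \<in> Reg"
proof -
  obtain u v where u: "\<And>m. \<exists>n\<le>m. x n = u" and v: "\<And>m. \<exists>n\<ge>m. x n = v"
    using assms(2) unfolding Reg_iff by blast
  have "y n \<in> R `` {x n}" for n using assms(3)[of n] R_sym by auto
  then have "\<exists>n\<le>m. y n \<in> R `` {u}" "\<exists>n\<ge>m. y n \<in> R `` {v}" for m
    using u[of m] v[of m] by blast+
  then show ?thesis unfolding Reg_iff
    using assms(1) finite_set_recurs[OF R_finite] finite_set_recurs_past[OF R_finite] by blast
qed

lemma shift_by_Reg_imp: "x \<in> Reg \<Longrightarrow> shift_by k x \<in> Reg"
  unfolding Reg_iff
proof (elim conjE exE, intro conjI)
  fix u v assume u: "\<forall>m. \<exists>n\<le>m. x n = u" and v: "\<forall>m. \<exists>n\<ge>m. x n = v"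
  have "\<exists>n\<le>m. shift_by k x n = u" for m
  proof -
    obtain n where "n \<le> m + k" "x n = u" using u by blast
    then show ?thesis by (intro exI[of _ "n - k"]) auto
  qed
  then show "\<exists>u. \<forall>m. \<exists>n\<le>m. shift_by k x n = u" by blast
  have "\<exists>n\<ge>m. shift_by k x n = v" for m
  proof -
    obtain n where "n \<ge> m + k" "x n = v" using v by blast
    then show ?thesis by (intro exI[of _ "n - k"]) auto
  qed
  then show "\<exists>v. \<forall>m. \<exists>n\<ge>m. shift_by k x n = v" by blast
qed simp

lemma shift_by_Reg [simp]: "shift_by k x \<in> Reg \<longleftrightarrow> x \<in> Reg"
  using shift_by_Reg_imp[of x k] shift_by_Reg_imp[of "shift_by k x" "- k"] by auto

definition is_fib :: "(int \<Rightarrow> nat) set \<Rightarrow> bool" where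
  "is_fib F \<longleftrightarrow> (\<exists>x\<in>Reg. F = cls x)"

lemma cls_self: "x \<in> Reg \<Longrightarrow> x \<in> cls x"
  using R_refl Reg_path by (auto simp: cls_def Reg_def)

lemma cls_Reg: "x \<in> Reg \<Longrightarrow> y \<in> cls x \<Longrightarrow> y \<in> Reg"
  using Reg_related by (auto simp: cls_def)

lemma cls_related: "x \<in> Reg \<Longrightarrow> y \<in> cls x \<Longrightarrow> z \<in> cls x \<Longrightarrow> (y n, z n) \<in> R"
  using cls_Reg[of x y] cls_Reg[of x z] R_trans[of y x z n] R_sym
  by (auto simp: cls_def Reg_def)

lemma cls_eq:
  assumes "x \<in> Reg" "y \<in> cls x" shows "cls x = cls y"
proof
  have y: "y \<in> Reg" "\<And>n. (y n, x n) \<in> R" using cls_Reg assms by (auto simp: cls_def)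
  show "cls x \<subseteq> cls y"
    using cls_related[OF assms(1) _ assms(2)] by (auto simp: cls_def)
  show "cls y \<subseteq> cls x"
    using cls_Reg[OF y(1)] R_trans[of _ y x] assms(1) y by (auto simp: cls_def Reg_def)
qed

lemma is_fib_cls: "x \<in> Reg \<Longrightarrow> is_fib (cls x)"
  by (auto simp: is_fib_def)

lemma fib_eq_cls: "is_fib F \<Longrightarrow> x \<in> F \<Longrightarrow> F = cls x"
  using cls_eq by (auto simp: is_fib_def)

lemma fib_Reg: "is_fib F \<Longrightarrow> x \<in> F \<Longrightarrow> x \<in> Reg"
  using cls_Reg by (auto simp: is_fib_def)

lemma fib_path: "is_fib F \<Longrightarrow> x \<in> F \<Longrightarrow> x \<in> edge_paths E"
  using fib_Reg Reg_path by blast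

lemma fib_nonempty: "is_fib F \<Longrightarrow> F \<noteq> {}"
  using cls_self by (auto simp: is_fib_def)

lemma fib_related: "is_fib F \<Longrightarrow> x \<in> F \<Longrightarrow> y \<in> F \<Longrightarrow> (x n, y n) \<in> R"
  using cls_related by (auto simp: is_fib_def)

lemma fib_closed: "is_fib F \<Longrightarrow> x \<in> F \<Longrightarrow> y \<in> edge_paths E \<Longrightarrow> (\<And>n. (y n, x n) \<in> R) \<Longrightarrow> y \<in> F"
  using fib_eq_cls[of F x] by (auto simp: cls_def)

lemma fib_finite: "is_fib F \<Longrightarrow> finite F"
proof -
  assume "is_fib F"
  then obtain x where x: "x \<in> Reg" "F = cls x" by (auto simp: is_fib_def)
  have "F \<subseteq> {y \<in> regular_part UNIV (edge_paths E). \<forall>n. (y n, x n) \<in> R}"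
    using cls_Reg[OF x(1)] unfolding x(2) by (auto simp: cls_def Reg_def)
  then show ?thesis using finite_classes x(1) finite_subset unfolding Reg_def by blast
qed

lemma cls_shift_by: "cls (shift_by k x) = shift_by k ` cls x"
proof (intro equalityI subsetI)
  fix y assume y: "y \<in> cls (shift_by k x)"
  have "shift_by (- k) y \<in> cls x"
    unfolding cls_def
  proof (intro CollectI conjI allI)
    show "shift_by (- k) y \<in> edge_paths E" using y by (auto simp: cls_def)
    fix n
    have "\<forall>m. (y m, shift_by k x m) \<in> R" using y by (simp add: cls_def del: shift_by_apply)
    then have "(y (n - k), shift_by k x (n - k)) \<in> R" by blast
    then show "(shift_by (- k) y n, x n) \<in> R" by simp
  qed
  then show "y \<in> shift_by k ` cls x" by (intro image_eqI[of _ _ "shift_by (- k) y"]) auto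
next
  fix y assume "y \<in> shift_by k ` cls x"
  then show "y \<in> cls (shift_by k x)" by (auto simp: cls_def)
qed

lemma fib_shift_by_imp: "is_fib F \<Longrightarrow> is_fib (shift_by k ` F)"
  unfolding is_fib_def using cls_shift_by shift_by_Reg by metis

lemma fib_shift_by [simp]: "is_fib (shift_by k ` F) \<longleftrightarrow> is_fib F"
  using fib_shift_by_imp[of F k] fib_shift_by_imp[of "shift_by k ` F" "- k"] by auto

text \<open>Compactness of fibers: local finiteness of \<open>R\<close> confines each coordinate to
  finitely many letters, and both edges and relations survive in the limit.\<close>

lemma related_words_limit:
  assumes path: "\<And>k m. \<bar>m\<bar> < int k \<Longrightarrow> (s k m, s k (m + 1)) \<in> E"
    and rel: "\<And>k m. \<bar>m\<bar> \<le> int k \<Longrightarrow> (s k m, y m) \<in> R"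
  obtains l r where "l \<in> cls y" "strict_mono r" "\<And>n. \<forall>\<^sub>F k in sequentially. s (r k) n = l n"
proof -
  have "finite (range (\<lambda>k. s k n))" for n
  proof (rule finite_subset)
    \<comment> \<open>The first |n| words are too short to be constrained at time n, so their
      letters are added by hand.\<close>
    show "finite (R `` {y n} \<union> (\<lambda>k. s k n) ` {..nat \<bar>n\<bar>})" using R_finite by blast
    have "s k n \<in> R `` {y n} \<union> (\<lambda>k. s k n) ` {..nat \<bar>n\<bar>}" for k
    proof (cases "\<bar>n\<bar> \<le> int k")
      case True
      then show ?thesis using rel R_sym by blast
    qed auto
    then show "range (\<lambda>k. s k n) \<subseteq> R `` {y n} \<union> (\<lambda>k. s k n) ` {..nat \<bar>n\<bar>}" by blast
  qed
  then obtain r l where r: "strict_mono r" and l: "\<And>n. \<forall>\<^sub>F k in sequentially. s (r k) n = l n"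
    using pointwise_convergent_subsequence by metis
  have "l \<in> edge_paths E" using path r l by (rule edge_paths_limit)
  moreover have "(l n, y n) \<in> R" for n
  proof -
    have "\<forall>\<^sub>F k in sequentially. \<bar>n\<bar> \<le> int k"
      by (rule eventually_sequentiallyI[of "nat \<bar>n\<bar>"]) linarith
    then have "\<forall>\<^sub>F k in sequentially. (l n, y n) \<in> R"
      using l[of n]
    proof eventually_elim
      case (elim k)
      have "k \<le> r k" using r by (rule seq_suble)
      then show ?case using rel[of n "r k"] elim by auto
    qed
    then show ?thesis by simp
  qed
  ultimately show thesis using that r l by (auto simp: cls_def)
qed

section \<open>Windows, magic words and markers\<close>

abbreviation win :: "nat \<Rightarrow> int \<Rightarrow> (int \<Rightarrow> nat) set \<Rightarrow> nat list set" where
  "win N n F \<equiv> seg (n - int N) (n + int N) ` F"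

lemma win_shift_by: "win N n (shift_by k ` F) = win N (n + k) F"
  by (simp add: seg_shift_by_image algebra_simps)

text \<open>The words of \<open>V\<close> have length 2 N + 1, and index k + N stands for position
  k. Requiring N \<ge> 1 ensures that a marker window shows the neighbors of its center, so that
  edges can be read off.\<close>

definition magic :: "nat \<Rightarrow> nat list set \<Rightarrow> bool" where
  "magic N V \<longleftrightarrow> N \<ge> 1 \<and> (\<forall>x. (\<forall>k. - int N \<le> k \<and> k < int N \<longrightarrow> (x k, x (k + 1)) \<in> E) \<longrightarrow>
     (\<forall>v\<in>V. \<forall>k. - int N \<le> k \<and> k \<le> int N \<longrightarrow> (x k, v ! nat (k + int N)) \<in> R) \<longrightarrow> (\<exists>v\<in>V. x 0 = v ! N))"

lemma magic_win_iff:
  "magic N (win N n F) \<longleftrightarrow> N \<ge> 1 \<and> (\<forall>x. (\<forall>k. - int N \<le> k \<and> k < int N \<longrightarrow> (x k, x (k + 1)) \<in> E) \<longrightarrow>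
     (\<forall>y\<in>F. \<forall>k. - int N \<le> k \<and> k \<le> int N \<longrightarrow> (x k, y (n + k)) \<in> R) \<longrightarrow> (\<exists>y\<in>F. x 0 = y n))"
proof -
  have nth: "seg (n - int N) (n + int N) y ! nat (k + int N) = y (n + k)"
    if "- int N \<le> k \<and> k \<le> int N" for y :: "int \<Rightarrow> nat" and k
    using seg_nth[of "n - int N" "n + k" "n + int N" y] that by (simp add: algebra_simps)
  have nth0: "seg (n - int N) (n + int N) y ! N = y n" for y :: "int \<Rightarrow> nat"
    using nth[of 0 y] by simp
  have "(\<forall>v\<in>win N n F. \<forall>k. - int N \<le> k \<and> k \<le> int N \<longrightarrow> (x k, v ! nat (k + int N)) \<in> R) \<longleftrightarrow>
      (\<forall>y\<in>F. \<forall>k. - int N \<le> k \<and> k \<le> int N \<longrightarrow> (x k, y (n + k)) \<in> R)" for x :: "int \<Rightarrow> nat"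
    by (simp add: nth)
  moreover have "(\<exists>v\<in>win N n F. x 0 = v ! N) \<longleftrightarrow> (\<exists>y\<in>F. x 0 = y n)" for x :: "int \<Rightarrow> nat"
    by (simp add: nth0)
  ultimately show ?thesis unfolding magic_def by (simp only:)
qed

text \<open>Counterexamples for growing windows subconverge, by compactness of the fiber, to a
  member whose letter at time n differs from that of every member. This works at every time
  n.\<close>

lemma magic_exists:
  assumes F: "is_fib F"
  shows "\<exists>N. magic N (win N n F)"
proof (rule ccontr)
  assume "\<not> ?thesis"
  then have "\<forall>k. \<exists>x. (\<forall>m. - int (Suc k) \<le> m \<and> m < int (Suc k) \<longrightarrow> (x m, x (m + 1)) \<in> E) \<and>
     (\<forall>y\<in>F. \<forall>m. - int (Suc k) \<le> m \<and> m \<le> int (Suc k) \<longrightarrow> (x m, y (n + m)) \<in> R) \<and> (\<forall>y\<in>F. x 0 \<noteq> y n)"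
    unfolding magic_win_iff by (metis le_add1 plus_1_eq_Suc)
  then obtain s where s: "\<And>k m. - int (Suc k) \<le> m \<Longrightarrow> m < int (Suc k) \<Longrightarrow> (s k m, s k (m + 1)) \<in> E"
    "\<And>k m y. y \<in> F \<Longrightarrow> - int (Suc k) \<le> m \<Longrightarrow> m \<le> int (Suc k) \<Longrightarrow> (s k m, y (n + m)) \<in> R"
    "\<And>k y. y \<in> F \<Longrightarrow> s k 0 \<noteq> y n" by metis
  obtain y where y: "y \<in> F" using fib_nonempty[OF F] by blast
  obtain l r where l: "l \<in> cls (shift_by n y)" "\<And>m. \<forall>\<^sub>F k in sequentially. s (r k) m = l m"
  proof (rule related_words_limit[of s "shift_by n y"])
    show "(s k m, s k (m + 1)) \<in> E" if "\<bar>m\<bar> < int k" for k m using s(1)[of k m] that by auto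
    show "(s k m, shift_by n y m) \<in> R" if "\<bar>m\<bar> \<le> int k" for k m
      using s(2)[OF y, of k m] that by (auto simp: add.commute)
  qed (use that in blast)
  obtain x where x: "x \<in> cls y" "l = shift_by n x" using l(1) unfolding cls_shift_by by blast
  have "x \<in> F" using x(1) fib_eq_cls[OF F y] by simp
  moreover have "\<exists>k. s (r k) 0 = l 0" using l(2)[of 0] by (auto dest: eventually_happens)
  ultimately show False using s(3) x(2) by auto
qed

text \<open>A marker is a magic window of least half-width \<open>hw\<close> and, among these, of least code \<open>key\<close>; being
  the least makes the choice of marker a function of the fiber that can be verified window by
  window.\<close>

definition hw :: "(int \<Rightarrow> nat) set \<Rightarrow> nat" where
  "hw F = (LEAST N. \<exists>n. magic N (win N n F))"

definition key :: "(int \<Rightarrow> nat) set \<Rightarrow> nat" where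
  "key F = (LEAST k. \<exists>n. magic (hw F) (win (hw F) n F) \<and> enc (win (hw F) n F) = k)"

definition mark :: "(int \<Rightarrow> nat) set \<Rightarrow> int \<Rightarrow> bool" where
  "mark F n \<longleftrightarrow> magic (hw F) (win (hw F) n F) \<and> enc (win (hw F) n F) = key F"

lemma ex_int_shift: "(\<exists>n. P (n + k)) \<longleftrightarrow> (\<exists>n::int. P n)"
  by (metis diff_add_cancel)

lemma hw_shift_by [simp]: "hw (shift_by k ` F) = hw F"
  unfolding hw_def win_shift_by using ex_int_shift[of "\<lambda>n. magic _ (win _ n F)" k] by simp

lemma key_shift_by [simp]: "key (shift_by k ` F) = key F"
  unfolding key_def hw_shift_by win_shift_by
  using ex_int_shift[of "\<lambda>n. magic _ (win _ n F) \<and> enc (win _ n F) = _" k] by simp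

lemma mark_shift_by [simp]: "mark (shift_by k ` F) n \<longleftrightarrow> mark F (n + k)"
  unfolding mark_def hw_shift_by key_shift_by win_shift_by ..

lemma hw_le: "magic N (win N n F) \<Longrightarrow> hw F \<le> N"
  unfolding hw_def by (rule Least_le) blast

lemma key_le: "magic (hw F) (win (hw F) n F) \<Longrightarrow> key F \<le> enc (win (hw F) n F)"
  unfolding key_def by (rule Least_le) blast

lemma mark_exists: "is_fib F \<Longrightarrow> \<exists>n. mark F n"
proof -
  assume "is_fib F"
  then have "\<exists>N n. magic N (win N n F)" using magic_exists by blast
  then have "\<exists>n. magic (hw F) (win (hw F) n F)" unfolding hw_def by (rule LeastI_ex)
  then have "\<exists>k n. magic (hw F) (win (hw F) n F) \<and> enc (win (hw F) n F) = k" by blast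
  then have "\<exists>n. magic (hw F) (win (hw F) n F) \<and> enc (win (hw F) n F) = key F"
    unfolding key_def by (rule LeastI_ex)
  then show ?thesis unfolding mark_def .
qed

lemma hw_pos: "mark F n \<Longrightarrow> hw F \<ge> 1"
  unfolding mark_def magic_def by blast

text \<open>Time 0 counts as a previous mark but not as a next one, so a marker time belongs to the
  block that it opens. \<open>lst_mark\<close> is strict, as it measures the gap that ends at time
  0.\<close>

definition prv_mark :: "(int \<Rightarrow> nat) set \<Rightarrow> nat" where
  "prv_mark F = (LEAST i. mark F (- int i))"

definition nxt_mark :: "(int \<Rightarrow> nat) set \<Rightarrow> nat" where
  "nxt_mark F = (LEAST j. 1 \<le> j \<and> mark F (int j))"

definition lst_mark :: "(int \<Rightarrow> nat) set \<Rightarrow> nat" where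
  "lst_mark F = (LEAST j. 1 \<le> j \<and> mark F (- int j))"

text \<open>The block is widened by \<open>hw F\<close> on each side so that the marker windows at
  both of its ends are contained in it.\<close>

definition blk :: "(int \<Rightarrow> nat) set \<Rightarrow> nat list set" where
  "blk F = seg (- int (prv_mark F) - int (hw F)) (int (nxt_mark F) + int (hw F)) ` F"

definition gap_next :: "(int \<Rightarrow> nat) set \<Rightarrow> nat" where
  "gap_next F = (if mark F 0 then log_ceil (nxt_mark F) else 0)"

definition gap_last :: "(int \<Rightarrow> nat) set \<Rightarrow> nat" where
  "gap_last F = (if mark F 0 then log_ceil (lst_mark F) else 0)"

text \<open>These are truncated: \<open>fwd_env\<close> is \<open>max 0 (SUP k. gap_next (S^k F) - k)\<close>. A gap is announced at its
  start to the past by \<open>fwd_env\<close> and at its end to the future by \<open>bwd_env\<close>; the first bounds the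
  successors of a symbol, the second its predecessors. If the envelope is infinite, \<open>LEAST\<close> is
  unspecified, which \<open>tame\<close> excludes.\<close>

definition fwd_env :: "(int \<Rightarrow> nat) set \<Rightarrow> nat" where
  "fwd_env F = (LEAST v. \<forall>k. gap_next (shift_by (int k) ` F) \<le> v + k)"

definition bwd_env :: "(int \<Rightarrow> nat) set \<Rightarrow> nat" where
  "bwd_env F = (LEAST v. \<forall>k. gap_last (shift_by (- int k) ` F) \<le> v + k)"

definition noncolliding :: "(int \<Rightarrow> nat) set \<Rightarrow> bool" where
  "noncolliding F \<longleftrightarrow> (\<forall>x\<in>F. \<forall>y\<in>F. \<forall>n. x n = y n \<longrightarrow> x = y)"

definition recurrent_marks :: "(int \<Rightarrow> nat) set \<Rightarrow> bool" where
  "recurrent_marks F \<longleftrightarrow> (\<forall>m. (\<exists>n\<ge>m. mark F n) \<and> (\<exists>n\<le>m. mark F n))"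

definition tame :: "(int \<Rightarrow> nat) set \<Rightarrow> bool" where
  "tame F \<longleftrightarrow> (\<forall>n. (\<exists>v. \<forall>k. gap_next (shift_by (n + int k) ` F) \<le> v + k) \<and>
     (\<exists>v. \<forall>k. gap_last (shift_by (n - int k) ` F) \<le> v + k))"

definition good :: "(int \<Rightarrow> nat) set \<Rightarrow> bool" where
  "good F \<longleftrightarrow> is_fib F \<and> noncolliding F \<and> recurrent_marks F \<and> tame F"

text \<open>The whole block is stored at each of its times, with the distances to its two ends, so
  that a symbol knows its place in the block.\<close>

definition symb :: "(int \<Rightarrow> nat) set \<Rightarrow> nat" where
  "symb F = to_nat (hw F, key F, enc (blk F), prv_mark F, nxt_mark F, fwd_env F, bwd_env F)"

text \<open>Only single steps come from a common fiber. That a whole path comes from one fiber has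
  to be proved, and for the envelopes it holds only along recurrent paths.\<close>

definition trans :: "(nat \<times> nat) set" where
  "trans = {(symb F, symb (shift_by 1 ` F)) | F. good F}"

lemma noncolliding_shift_by_imp: "noncolliding F \<Longrightarrow> noncolliding (shift_by k ` F)"
  unfolding noncolliding_def by (auto simp: image_iff)

lemma recurrent_marks_shift_by_imp: 
  assumes "recurrent_marks F" shows "recurrent_marks (shift_by k ` F)"
  unfolding recurrent_marks_def
proof (intro allI conjI)
  fix m
  obtain n n' where "n \<ge> m + k" "mark F n" "n' \<le> m + k" "mark F n'"
    using assms unfolding recurrent_marks_def by blast
  then show "\<exists>n\<ge>m. mark (shift_by k ` F) n" "\<exists>n\<le>m. mark (shift_by k ` F) n"
    by (intro exI[of _ "n - k"], simp, intro exI[of _ "n' - k"], simp)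
qed

lemma tame_shift_by_imp: 
  assumes "tame F" shows "tame (shift_by k ` F)"
  unfolding tame_def
proof
  fix n
  have eq: "n + int i + k = (n + k) + int i" "n - int i + k = (n + k) - int i" for i by auto
  show "(\<exists>v. \<forall>i. gap_next (shift_by (n + int i) ` shift_by k ` F) \<le> v + i) \<and>
     (\<exists>v. \<forall>i. gap_last (shift_by (n - int i) ` shift_by k ` F) \<le> v + i)"
    unfolding shift_by_image_add eq using assms[unfolded tame_def] by blast
qed

lemma good_shift_by_imp: "good F \<Longrightarrow> good (shift_by k ` F)"
  unfolding good_def
  using noncolliding_shift_by_imp recurrent_marks_shift_by_imp tame_shift_by_imp by simp

lemma good_shift_by [simp]: "good (shift_by k ` F) \<longleftrightarrow> good F"
  using good_shift_by_imp[of F k] good_shift_by_imp[of "shift_by k ` F" "- k"] by auto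

section \<open>Block data and envelopes under the shift\<close>

lemma
  assumes "recurrent_marks F"
  shows mark_prv: "mark F (- int (prv_mark F))"
    and not_mark_after_prv: "- int (prv_mark F) < n \<Longrightarrow> n \<le> 0 \<Longrightarrow> \<not> mark F n"
    and nxt_pos: "1 \<le> nxt_mark F"
    and mark_nxt: "mark F (int (nxt_mark F))"
    and not_mark_before_nxt: "1 \<le> n \<Longrightarrow> n < int (nxt_mark F) \<Longrightarrow> \<not> mark F n"
proof -
  obtain n where n: "n \<le> 0" "mark F n" using assms unfolding recurrent_marks_def by blast
  then have "\<exists>i. mark F (- int i)" by (intro exI[of _ "nat (- n)"]) simp
  then show "mark F (- int (prv_mark F))" unfolding prv_mark_def by (rule LeastI_ex)
  show "\<not> mark F n" if "- int (prv_mark F) < n" "n \<le> 0" for n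
    using not_less_Least[of "nat (- n)" "\<lambda>i. mark F (- int i)"] that unfolding prv_mark_def by simp
  obtain n where n: "n \<ge> 1" "mark F n" using assms unfolding recurrent_marks_def by blast
  then have "\<exists>j. 1 \<le> j \<and> mark F (int j)" by (intro exI[of _ "nat n"]) simp
  then have "1 \<le> nxt_mark F \<and> mark F (int (nxt_mark F))" unfolding nxt_mark_def by (rule LeastI_ex)
  then show "1 \<le> nxt_mark F" "mark F (int (nxt_mark F))" by auto
  show "\<not> mark F n" if "1 \<le> n" "n < int (nxt_mark F)" for n
    using not_less_Least[of "nat n" "\<lambda>j. 1 \<le> j \<and> mark F (int j)"] that unfolding nxt_mark_def by simp
qed

lemma prv_eqI:
  assumes "mark F (- int i)" "\<And>n. - int i < n \<Longrightarrow> n \<le> 0 \<Longrightarrow> \<not> mark F n"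
  shows "prv_mark F = i"
  unfolding prv_mark_def
proof (rule Least_equality)
  fix j assume "mark F (- int j)"
  then show "i \<le> j" using assms(2)[of "- int j"] by force
qed (rule assms(1))

lemma nxt_eqI:
  assumes "1 \<le> j" "mark F (int j)" "\<And>n. 1 \<le> n \<Longrightarrow> n < int j \<Longrightarrow> \<not> mark F n"
  shows "nxt_mark F = j"
  unfolding nxt_mark_def
proof (rule Least_equality)
  fix i assume "1 \<le> i \<and> mark F (int i)"
  then show "j \<le> i" using assms(3)[of "int i"] by force
qed (use assms in blast)

lemma lst_eqI:
  assumes "1 \<le> j" "mark F (- int j)" "\<And>n. - int j < n \<Longrightarrow> n \<le> -1 \<Longrightarrow> \<not> mark F n"
  shows "lst_mark F = j"
  unfolding lst_mark_def
proof (rule Least_equality)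
  fix i assume "1 \<le> i \<and> mark F (- int i)"
  then show "j \<le> i" using assms(3)[of "- int i"] by force
qed (use assms in blast)

lemma
  assumes F: "recurrent_marks F" and m: "- int (prv_mark F) \<le> m" "m < int (nxt_mark F)"
  shows prv_shift_by: "int (prv_mark (shift_by m ` F)) = int (prv_mark F) + m"
    and nxt_shift_by: "int (nxt_mark (shift_by m ` F)) = int (nxt_mark F) - m"
    and blk_shift_by: "blk (shift_by m ` F) = blk F"
proof -
  have "prv_mark (shift_by m ` F) = nat (int (prv_mark F) + m)"
  proof (rule prv_eqI)
    fix n assume "- int (nat (int (prv_mark F) + m)) < n" "n \<le> 0"
    then show "\<not> mark (shift_by m ` F) n"
      using not_mark_after_prv[OF F, of "n + m"] not_mark_before_nxt[OF F, of "n + m"] m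
      by (cases "n + m \<le> 0") auto
  qed (use m mark_prv[OF F] in auto)
  then show p: "int (prv_mark (shift_by m ` F)) = int (prv_mark F) + m" using m by simp
  have "nxt_mark (shift_by m ` F) = nat (int (nxt_mark F) - m)"
  proof (rule nxt_eqI)
    fix n assume "1 \<le> n" "n < int (nat (int (nxt_mark F) - m))"
    then show "\<not> mark (shift_by m ` F) n"
      using not_mark_after_prv[OF F, of "n + m"] not_mark_before_nxt[OF F, of "n + m"] m
      by (cases "n + m \<le> 0") auto
  qed (use m mark_nxt[OF F] in auto)
  then show q: "int (nxt_mark (shift_by m ` F)) = int (nxt_mark F) - m" using m by simp
  show "blk (shift_by m ` F) = blk F"
  proof -
    have "- (int (prv_mark F) + m) - int (hw F) + m = - int (prv_mark F) - int (hw F)"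
      "int (nxt_mark F) - m + int (hw F) + m = int (nxt_mark F) + int (hw F)" by simp_all
    then show ?thesis unfolding blk_def seg_shift_by_image p q hw_shift_by by simp
  qed
qed

lemma nxt_eq_1_iff: "recurrent_marks F \<Longrightarrow> nxt_mark F = 1 \<longleftrightarrow> mark F 1"
  using mark_nxt[of F] nxt_pos[of F] not_mark_before_nxt[of F 1]
  by (cases "nxt_mark F = 1") auto

lemma prv_eq_0_iff: "recurrent_marks F \<Longrightarrow> prv_mark F = 0 \<longleftrightarrow> mark F 0"
  using mark_prv[of F] not_mark_after_prv[of F 0]
  by (cases "prv_mark F = 0") auto

lemma prv_shift_by_1_le: "recurrent_marks F \<Longrightarrow> prv_mark (shift_by 1 ` F) \<le> prv_mark F + 1"
  using prv_shift_by[of F 1] nxt_eq_1_iff[of F] prv_eq_0_iff[of "shift_by 1 ` F"] nxt_pos[of F]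
    recurrent_marks_shift_by_imp[of F 1]
  by (cases "nxt_mark F = 1") auto

lemma nxt_shift_by_1_le: "recurrent_marks F \<Longrightarrow> nxt_mark F \<le> nxt_mark (shift_by 1 ` F) + 1"
  using nxt_shift_by[of F 1] nxt_pos[of F]
  by (cases "nxt_mark F = 1") auto

lemma lst_shift_by_1:
  assumes F: "recurrent_marks F"
  shows "lst_mark (shift_by 1 ` F) = prv_mark F + 1"
proof (rule lst_eqI)
  fix n assume "- int (prv_mark F + 1) < n" "n \<le> - 1"
  then show "\<not> mark (shift_by 1 ` F) n" using not_mark_after_prv[OF F, of "n + 1"] by simp
qed (use mark_prv[OF F] in auto)

lemma gap_last_shift_by_1:
  "recurrent_marks F \<Longrightarrow> gap_last (shift_by 1 ` F) = (if mark F 1 then log_ceil (prv_mark F + 1) else 0)"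
  unfolding gap_last_def by (simp add: lst_shift_by_1)

lemma fwd_env_ge: "tame F \<Longrightarrow> gap_next (shift_by (int k) ` F) \<le> fwd_env F + k"
proof -
  assume "tame F"
  then have "\<exists>v. \<forall>k. gap_next (shift_by (int k) ` F) \<le> v + k"
    using tame_def[of F] by (metis add_0)
  then have "\<forall>k. gap_next (shift_by (int k) ` F) \<le> fwd_env F + k" unfolding fwd_env_def by (rule LeastI_ex)
  then show ?thesis by blast
qed

lemma fwd_env_le: "(\<And>k. gap_next (shift_by (int k) ` F) \<le> v + k) \<Longrightarrow> fwd_env F \<le> v"
  unfolding fwd_env_def by (rule Least_le) blast

lemma bwd_env_ge: "tame F \<Longrightarrow> gap_last (shift_by (- int k) ` F) \<le> bwd_env F + k"
proof -
  assume "tame F"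
  then have "\<exists>v. \<forall>k. gap_last (shift_by (- int k) ` F) \<le> v + k"
    using tame_def[of F] by (metis diff_0)
  then have "\<forall>k. gap_last (shift_by (- int k) ` F) \<le> bwd_env F + k" unfolding bwd_env_def by (rule LeastI_ex)
  then show ?thesis by blast
qed

lemma bwd_env_le: "(\<And>k. gap_last (shift_by (- int k) ` F) \<le> v + k) \<Longrightarrow> bwd_env F \<le> v"
  unfolding bwd_env_def by (rule Least_le) blast

text \<open>This is the local rule of the forward envelope. Subtraction on \<open>nat\<close>
  supplies the truncation at 0.\<close>

lemma fwd_env_step:
  assumes "tame F"
  shows "fwd_env F = max (gap_next F) (fwd_env (shift_by 1 ` F) - 1)"
proof (rule antisym)
  have F1: "tame (shift_by 1 ` F)" using assms by (rule tame_shift_by_imp)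
  show "fwd_env F \<le> max (gap_next F) (fwd_env (shift_by 1 ` F) - 1)"
  proof (rule fwd_env_le)
    fix k show "gap_next (shift_by (int k) ` F) \<le> max (gap_next F) (fwd_env (shift_by 1 ` F) - 1) + k"
    proof (cases k)
      case (Suc j)
      then show ?thesis using fwd_env_ge[OF F1, of j] by (simp add: add.commute)
    qed simp
  qed
  have "gap_next F \<le> fwd_env F" using fwd_env_ge[OF assms, of 0] by simp
  moreover have "fwd_env (shift_by 1 ` F) \<le> fwd_env F + 1"
  proof (rule fwd_env_le)
    fix k show "gap_next (shift_by (int k) ` shift_by 1 ` F) \<le> fwd_env F + 1 + k"
      using fwd_env_ge[OF assms, of "Suc k"] by (simp add: add.commute)
  qed
  ultimately show "max (gap_next F) (fwd_env (shift_by 1 ` F) - 1) \<le> fwd_env F" by simp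
qed

lemma bwd_env_step:
  assumes "tame F"
  shows "bwd_env (shift_by 1 ` F) = max (gap_last (shift_by 1 ` F)) (bwd_env F - 1)"
proof (rule antisym)
  have F1: "tame (shift_by 1 ` F)" using assms by (rule tame_shift_by_imp)
  show "bwd_env (shift_by 1 ` F) \<le> max (gap_last (shift_by 1 ` F)) (bwd_env F - 1)"
  proof (rule bwd_env_le)
    fix k show "gap_last (shift_by (- int k) ` shift_by 1 ` F) \<le> max (gap_last (shift_by 1 ` F)) (bwd_env F - 1) + k"
    proof (cases k)
      case (Suc j)
      then show ?thesis using bwd_env_ge[OF assms, of j] by simp
    qed simp
  qed
  have "gap_last (shift_by 1 ` F) \<le> bwd_env (shift_by 1 ` F)" using bwd_env_ge[OF F1, of 0] by simp
  moreover have "bwd_env F \<le> bwd_env (shift_by 1 ` F) + 1"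
  proof (rule bwd_env_le)
    fix k show "gap_last (shift_by (- int k) ` F) \<le> bwd_env (shift_by 1 ` F) + 1 + k"
      using bwd_env_ge[OF F1, of "Suc k"] by simp
  qed
  ultimately show "max (gap_last (shift_by 1 ` F)) (bwd_env F - 1) \<le> bwd_env (shift_by 1 ` F)" by simp
qed

lemma finite_blk: "is_fib F \<Longrightarrow> finite (blk F)"
  unfolding blk_def using fib_finite by blast

text \<open>Equality of the symbols apart from their envelopes: the core is read off the current
  block, while envelopes depend on an entire half-line.\<close>

definition core_eq :: "(int \<Rightarrow> nat) set \<Rightarrow> (int \<Rightarrow> nat) set \<Rightarrow> bool" where
  "core_eq F F' \<longleftrightarrow> hw F = hw F' \<and> key F = key F' \<and> blk F = blk F' \<and> prv_mark F = prv_mark F' \<and> nxt_mark F = nxt_mark F'"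

lemma core_eq_sym: "core_eq F F' \<Longrightarrow> core_eq F' F"
  by (simp add: core_eq_def)

lemma core_eq_trans: "core_eq F F' \<Longrightarrow> core_eq F' F'' \<Longrightarrow> core_eq F F''"
  by (simp add: core_eq_def)

lemma symb_eq_iff:
  assumes "is_fib F" "is_fib F'"
  shows "symb F = symb F' \<longleftrightarrow> core_eq F F' \<and> fwd_env F = fwd_env F' \<and> bwd_env F = bwd_env F'"
proof -
  have "enc (blk F) = enc (blk F') \<longleftrightarrow> blk F = blk F'"
    using enc_inj[OF finite_blk[OF assms(1)] finite_blk[OF assms(2)]] by metis
  then show ?thesis by (simp add: symb_def core_eq_def conj_ac)
qed

lemma core_eq_seg:
  assumes "core_eq F F'" "- int (prv_mark F) - int (hw F) \<le> a" "b \<le> int (nxt_mark F) + int (hw F)"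
  shows "seg a b ` F = seg a b ` F'"
proof (rule seg_image_subseg[OF _ assms(2,3)])
  have e: "hw F' = hw F" "prv_mark F' = prv_mark F" "nxt_mark F' = nxt_mark F" and "blk F = blk F'"
    using assms(1) by (simp_all add: core_eq_def)
  from \<open>blk F = blk F'\<close> show "seg (- int (prv_mark F) - int (hw F)) (int (nxt_mark F) + int (hw F)) ` F =
    seg (- int (prv_mark F) - int (hw F)) (int (nxt_mark F) + int (hw F)) ` F'"
    unfolding blk_def e .
qed

lemma core_eq_shift_by:
  assumes "core_eq F F'" "recurrent_marks F" "recurrent_marks F'" "- int (prv_mark F) \<le> m" "m < int (nxt_mark F)"
  shows "core_eq (shift_by m ` F) (shift_by m ` F')"
proof -
  have m': "- int (prv_mark F') \<le> m" "m < int (nxt_mark F')" using assms by (simp_all add: core_eq_def)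
  have "int (prv_mark (shift_by m ` F)) = int (prv_mark (shift_by m ` F'))"
    "int (nxt_mark (shift_by m ` F)) = int (nxt_mark (shift_by m ` F'))"
    using prv_shift_by[OF assms(2,4,5)] prv_shift_by[OF assms(3) m']
      nxt_shift_by[OF assms(2,4,5)] nxt_shift_by[OF assms(3) m'] assms(1)
    by (simp_all add: core_eq_def)
  then show ?thesis
    using blk_shift_by[OF assms(2,4,5)] blk_shift_by[OF assms(3) m'] assms(1)
    by (simp add: core_eq_def)
qed

section \<open>Finite degrees of the transition graph\<close>

lemma good_recurrent_marks: "good F \<Longrightarrow> recurrent_marks F"
  by (simp add: good_def)

lemma good_is_fib: "good F \<Longrightarrow> is_fib F"
  by (simp add: good_def)

lemma good_tame: "good F \<Longrightarrow> tame F"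
  by (simp add: good_def)

lemma good_hw_pos: "good F \<Longrightarrow> 1 \<le> hw F"
  using mark_nxt[OF good_recurrent_marks] hw_pos by blast

text \<open>With the letters at time 0 confined to \<open>D\<close> and both block ends bounded,
  finite degrees of \<open>E\<close> leave only finitely many words, hence finitely many
  blocks.\<close>

lemma finite_bounded_symbols:
  assumes D: "finite D"
  shows "finite {symb F | F. good F \<and> hw F = N \<and> key F = K \<and> (\<forall>x\<in>F. x 0 \<in> D) \<and>
    prv_mark F \<le> P \<and> nxt_mark F \<le> J \<and> fwd_env F \<le> f \<and> bwd_env F \<le> b}" (is "finite ?S")
proof -
  define B where "B = (\<Union>i\<in>{..P}. \<Union>j\<in>{..J}. enc ` Pow (seg (- int i - int N) (int j + int N) ` {x \<in> edge_paths E. x 0 \<in> D}))"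
  have fin: "finite (seg a b ` {x \<in> edge_paths E. x 0 \<in> D})" for a b
  proof (rule finite_subset)
    let ?L = "\<Union>n\<in>{a..b}. {x n | x. x \<in> edge_paths E \<and> x 0 \<in> D}"
    have "finite ?L" using finite_reachable[OF finite_out finite_in D] by blast
    then show "finite {w. set w \<subseteq> ?L \<and> length w = nat (b - a + 1)}" by (rule finite_lists_length_eq)
    show "seg a b ` {x \<in> edge_paths E. x 0 \<in> D} \<subseteq> {w. set w \<subseteq> ?L \<and> length w = nat (b - a + 1)}"
    proof (intro image_subsetI CollectI conjI length_seg)
      fix x assume "x \<in> {x \<in> edge_paths E. x 0 \<in> D}"
      then have "x n \<in> {x n | x. x \<in> edge_paths E \<and> x 0 \<in> D}" for n by blast
      then show "set (seg a b x) \<subseteq> ?L" unfolding seg_def set_map set_upto by blast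
    qed
  qed
  have "finite B" unfolding B_def using fin by (intro finite_UN_I finite_imageI) auto
  then have "finite ((\<lambda>(B, i, j, f, b). to_nat (N, K, B, i, j, f, b)) ` (B \<times> {..P} \<times> {..J} \<times> {..f} \<times> {..b}))"
    by blast
  moreover have "?S \<subseteq> (\<lambda>(B, i, j, f, b). to_nat (N, K, B, i, j, f, b)) ` (B \<times> {..P} \<times> {..J} \<times> {..f} \<times> {..b})"
  proof
    fix s assume "s \<in> ?S"
    then obtain F where F: "s = symb F" "good F" "hw F = N" "key F = K" "\<forall>x\<in>F. x 0 \<in> D"
      "prv_mark F \<le> P" "nxt_mark F \<le> J" "fwd_env F \<le> f" "bwd_env F \<le> b" by blast
    have "blk F \<subseteq> seg (- int (prv_mark F) - int N) (int (nxt_mark F) + int N) ` {x \<in> edge_paths E. x 0 \<in> D}"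
      using F(3,5) fib_path[OF good_is_fib[OF F(2)]] by (auto simp: blk_def)
    then have "enc (blk F) \<in> B" using F(6,7) unfolding B_def by blast
    then show "s \<in> (\<lambda>(B, i, j, f, b). to_nat (N, K, B, i, j, f, b)) ` (B \<times> {..P} \<times> {..J} \<times> {..f} \<times> {..b})"
      using F by (auto simp: symb_def intro!: image_eqI[of _ _ "(enc (blk F), prv_mark F, nxt_mark F, fwd_env F, bwd_env F)"])
  qed
  ultimately show ?thesis by (rule rev_finite_subset)
qed

lemma gap_next_le: "gap_next F \<le> log_ceil (nxt_mark F)"
  by (simp add: gap_next_def)

text \<open>The neighbors of time 0 are visible in the block because half-widths are at least
  1.\<close>

lemma core_eq_letters:
  assumes F: "good F" "good F'" and eq: "core_eq F F'" and k: "- 1 \<le> k" "k \<le> 1"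
  shows "(\<lambda>x. x k) ` F = (\<lambda>x. x k) ` F'"
proof -
  have "seg k k ` F = seg k k ` F'"
    using k good_hw_pos[OF F(1)] by (intro core_eq_seg[OF eq]) auto
  then have "hd ` seg k k ` F = hd ` seg k k ` F'" by simp
  then show ?thesis by (simp add: image_image seg_def)
qed

text \<open>An unknown block can appear only if the successor is a marker. Its letters are confined
  by the known letters at time 1, its length by the forward envelope.\<close>

lemma finite_trans_out: "finite (trans `` {s})"
proof (cases "\<exists>F. good F \<and> s = symb F")
  case False
  then have "trans `` {s} = {}" by (auto simp: trans_def)
  then show ?thesis by simp
next
  case True
  then obtain F0 where F0: "good F0" "s = symb F0" by blast
  let ?D = "(\<lambda>x. x 1) ` F0"
  let ?S = "{symb F | F. good F \<and> hw F = hw F0 \<and> key F = key F0 \<and> (\<forall>x\<in>F. x 0 \<in> ?D) \<and> prv_mark F \<le> prv_mark F0 + 1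
    \<and> nxt_mark F \<le> max (nxt_mark F0) (2 ^ (fwd_env F0 + 1)) \<and> fwd_env F \<le> fwd_env F0 + 1
    \<and> bwd_env F \<le> max (log_ceil (prv_mark F0 + 1)) (bwd_env F0)}"
  have "finite ?S"
    using fib_finite[OF good_is_fib[OF F0(1)]] by (intro finite_bounded_symbols) blast
  moreover have "trans `` {s} \<subseteq> ?S"
  proof
    fix t assume "t \<in> trans `` {s}"
    then obtain F where F: "good F" "symb F = symb F0" "t = symb (shift_by 1 ` F)"
      using F0 by (auto simp: trans_def)
    let ?F1 = "shift_by 1 ` F"
    have eq: "core_eq F F0" "fwd_env F = fwd_env F0" "bwd_env F = bwd_env F0"
      using symb_eq_iff F F0 good_is_fib by blast+
    have hk: "hw F = hw F0" "key F = key F0" "prv_mark F = prv_mark F0" "nxt_mark F = nxt_mark F0" using eq(1) by (auto simp: core_eq_def)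
    have rm: "recurrent_marks F" using F(1) by (rule good_recurrent_marks)
    have G1: "good ?F1" using F(1) by simp
    have f1: "fwd_env ?F1 \<le> fwd_env F + 1"
      using fwd_env_step[OF good_tame[OF F(1)]] by linarith
    have b1: "bwd_env ?F1 \<le> max (log_ceil (prv_mark F + 1)) (bwd_env F)"
      using bwd_env_step[OF good_tame[OF F(1)]] gap_last_shift_by_1[OF rm] by auto
    \<comment> \<open>The length of a block opening at time 1 is announced by the envelope of the
      successor, which exceeds the present one by at most 1; hence the exponent.\<close>
    have n1: "nxt_mark ?F1 \<le> max (nxt_mark F) (2 ^ (fwd_env F + 1))"
    proof (cases "mark F 1")
      case True
      then have "log_ceil (nxt_mark ?F1) = gap_next ?F1" by (simp add: gap_next_def)
      also have "\<dots> \<le> fwd_env ?F1" using fwd_env_ge[OF good_tame[OF G1], of 0] by simp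
      also have "\<dots> \<le> fwd_env F + 1" by (rule f1)
      finally show ?thesis by (simp add: log_ceil_le_iff)
    next
      case False
      then have "1 < int (nxt_mark F)" using nxt_eq_1_iff[OF rm] nxt_pos[OF rm] by linarith
      then show ?thesis using nxt_shift_by[OF rm, of 1] by auto
    qed
    have "\<forall>x\<in>?F1. x 0 \<in> ?D" using core_eq_letters[OF F(1) F0(1) eq(1), of 1] by auto
    then show "t \<in> ?S"
      using F(3) G1 f1 b1 n1 prv_shift_by_1_le[OF rm] eq hk by auto
  qed
  ultimately show ?thesis by (rule rev_finite_subset)
qed

lemma finite_trans_in: "finite (trans\<inverse> `` {s})"
proof (cases "\<exists>F. good F \<and> s = symb F")
  case False
  have "(t, s) \<notin> trans" for t
    using False good_shift_by unfolding trans_def by blast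
  then have "trans\<inverse> `` {s} = {}" by auto
  then show ?thesis by simp
next
  case True
  then obtain F0 where F0: "good F0" "s = symb F0" by blast
  let ?D = "(\<lambda>x. x (-1)) ` F0"
  let ?S = "{symb F | F. good F \<and> hw F = hw F0 \<and> key F = key F0 \<and> (\<forall>x\<in>F. x 0 \<in> ?D)
    \<and> prv_mark F \<le> max (prv_mark F0) (2 ^ bwd_env F0)
    \<and> nxt_mark F \<le> nxt_mark F0 + 1 \<and> fwd_env F \<le> max (log_ceil (nxt_mark F0 + 1)) (fwd_env F0)
    \<and> bwd_env F \<le> bwd_env F0 + 1}"
  have "finite ?S"
    using fib_finite[OF good_is_fib[OF F0(1)]] by (intro finite_bounded_symbols) blast
  moreover have "trans\<inverse> `` {s} \<subseteq> ?S"
  proof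
    fix t assume "t \<in> trans\<inverse> `` {s}"
    then obtain F where F: "good F" "symb (shift_by 1 ` F) = symb F0" "t = symb F"
      using F0 by (auto simp: trans_def)
    let ?F1 = "shift_by 1 ` F"
    have G1: "good ?F1" using F(1) by simp
    have eq: "core_eq ?F1 F0" "fwd_env ?F1 = fwd_env F0" "bwd_env ?F1 = bwd_env F0"
      using symb_eq_iff[of ?F1 F0] F G1 F0 good_is_fib by blast+
    have hk: "hw F = hw F0" "key F = key F0" "prv_mark ?F1 = prv_mark F0" "nxt_mark ?F1 = nxt_mark F0" using eq(1) by (auto simp: core_eq_def)
    have rm: "recurrent_marks F" using F(1) by (rule good_recurrent_marks)
    have n1: "nxt_mark F \<le> nxt_mark F0 + 1" using nxt_shift_by_1_le[OF rm] hk by simp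
    have f1: "fwd_env F \<le> max (log_ceil (nxt_mark F0 + 1)) (fwd_env F0)"
      using fwd_env_step[OF good_tame[OF F(1)]] gap_next_le[of F] log_ceil_mono[OF n1] eq(2) by linarith
    have b1: "bwd_env F \<le> bwd_env F0 + 1"
      using bwd_env_step[OF good_tame[OF F(1)]] eq(3) by linarith
    \<comment> \<open>A block that closes at the later symbol is announced by the backward envelope
      of that very symbol, so the exponent has no additional 1.\<close>
    have p1: "prv_mark F \<le> max (prv_mark F0) (2 ^ bwd_env F0)"
    proof (cases "mark F 1")
      case True
      then have "log_ceil (prv_mark F + 1) = gap_last ?F1" using gap_last_shift_by_1[OF rm] by simp
      also have "\<dots> \<le> bwd_env F0" using bwd_env_ge[OF good_tame[OF G1], of 0] eq(3) by simp
      finally have "prv_mark F + 1 \<le> 2 ^ bwd_env F0" by (simp add: log_ceil_le_iff)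
      then show ?thesis by simp
    next
      case False
      then have "1 < int (nxt_mark F)" using nxt_eq_1_iff[OF rm] nxt_pos[OF rm] by linarith
      then show ?thesis using prv_shift_by[OF rm, of 1] hk by auto
    qed
    have "(\<lambda>x. x (-1)) ` ?F1 = ?D" using core_eq_letters[OF G1 F0(1) eq(1), of "-1"] by auto
    then have "\<forall>x\<in>F. x 0 \<in> ?D" by (auto simp: image_image)
    then show "t \<in> ?S"
      using F(1,3) n1 f1 b1 p1 hk by auto
  qed
  ultimately show ?thesis by (rule rev_finite_subset)
qed

end

section \<open>Decoding paths of the transition graph\<close>

declare image_cong_simp [cong del]

lemma envelope_unique:
  fixes f g c :: "int \<Rightarrow> nat"
  assumes f: "\<And>n. f n = max (c n) (f (n + 1) - 1)" and g: "\<And>n. g n = max (c n) (g (n + 1) - 1)"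
    and le: "\<And>n. g n \<le> f n" and recurs: "\<And>m. \<exists>n\<ge>m. f n = v"
  shows "f n = g n"
proof (rule ccontr)
  assume "f n \<noteq> g n"
  then have gt: "f n > g n" using le[of n] by simp
  \<comment> \<open>Where \<open>f\<close> exceeds \<open>g\<close> it exceeds \<open>c\<close>, so
    its maximum is the term from the next time: \<open>f\<close> rises by exactly 1 while
    \<open>g\<close> rises by at most 1, and the strict inequality persists.\<close>
  have "f (n + int k) = f n + k \<and> f (n + int k) > g (n + int k)" for k
  proof (induction k)
    case (Suc k)
    let ?m = "n + int k"
    have gc: "g ?m \<ge> c ?m" "g (?m + 1) \<le> g ?m + 1" using g[of ?m] by linarith+
    have "f ?m = f (?m + 1) - 1" using f[of ?m] Suc.IH gc by linarith
    then have "f (?m + 1) = f ?m + 1" using Suc.IH by linarith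
    then show ?case using Suc.IH gc by (simp add: add_ac)
  qed (use gt in simp)
  note grow = this
  obtain m where m: "m \<ge> n + int v + 1" "f m = v" using recurs by blast
  have "f m = f n + nat (m - n)" using grow[of "nat (m - n)"] m by simp
  then show False using m by linarith
qed

text \<open>\<open>H n\<close> is a fiber placed so that time n of the path sits at time 0. It
  realizes the edge from n to n + 1; the fibers chosen for different n may be unrelated, only their
  symbols match.\<close>

locale coded_path = coded_shift +
  fixes H :: "int \<Rightarrow> (int \<Rightarrow> nat) set"
  assumes good_H: "\<And>n. good (H n)"
    and step_H: "\<And>n. symb (H (n + 1)) = symb (shift_by 1 ` H n)"
begin

definition N :: nat where "N = hw (H 0)"

definition K :: nat where "K = key (H 0)"

text \<open>The candidate fiber is glued from windows of radius \<open>N\<close> alone; that its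
  members follow the \<open>H n\<close> over whole blocks is the content of
  \<open>G_local\<close>.\<close>

definition G :: "(int \<Rightarrow> nat) set" where
  "G = {x. \<forall>n. \<exists>\<xi>\<in>H n. \<forall>k. \<bar>k\<bar> \<le> int N \<longrightarrow> x (n + k) = \<xi> k}"

lemma fib_H: "is_fib (H n)" and marks_H: "recurrent_marks (H n)" and tame_H: "tame (H n)"
  using good_H by (auto simp: good_def)

lemma noncolliding_H: "\<xi> \<in> H n \<Longrightarrow> \<eta> \<in> H n \<Longrightarrow> \<xi> k = \<eta> k \<Longrightarrow> \<xi> = \<eta>"
  using good_H[of n] unfolding good_def noncolliding_def by blast

lemma core_H: "core_eq (H (n + 1)) (shift_by 1 ` H n)"
  and fwd_H: "fwd_env (H (n + 1)) = fwd_env (shift_by 1 ` H n)"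
  and bwd_H: "bwd_env (H (n + 1)) = bwd_env (shift_by 1 ` H n)"
  using step_H[of n] symb_eq_iff[of "H (n + 1)" "shift_by 1 ` H n"] fib_H by auto

lemma hw_key_H: "hw (H n) = N \<and> key (H n) = K"
proof (induction n rule: int_induct[of _ 0])
  case base
  show ?case by (simp add: N_def K_def)
next
  case (step1 i)
  then show ?case using core_H[of i] by (simp add: core_eq_def)
next
  case (step2 i)
  then show ?case using core_H[of "i - 1"] by (simp add: core_eq_def)
qed

lemma hw_H: "hw (H n) = N" and key_H: "key (H n) = K"
  using hw_key_H by auto

lemma N_pos: "1 \<le> N"
  using good_hw_pos[OF good_H[of 0]] by (simp add: N_def)

lemma core_H_near_fwd: "int m < int (nxt_mark (H n)) \<Longrightarrow> core_eq (H (n + int m)) (shift_by (int m) ` H n)"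
proof (induction m)
  case 0
  then show ?case by (simp add: core_eq_def)
next
  case (Suc m)
  then have IH: "core_eq (H (n + int m)) (shift_by (int m) ` H n)" by (intro Suc.IH) auto
  have "int (nxt_mark (shift_by (int m) ` H n)) = int (nxt_mark (H n)) - int m"
    using Suc.prems by (intro nxt_shift_by[OF marks_H]) auto
  then have "1 < int (nxt_mark (H (n + int m)))" using IH Suc.prems by (simp add: core_eq_def)
  then have "core_eq (shift_by 1 ` H (n + int m)) (shift_by 1 ` shift_by (int m) ` H n)"
    using core_eq_shift_by[OF IH marks_H recurrent_marks_shift_by_imp[OF marks_H], of 1] by simp
  then have "core_eq (H (n + int m + 1)) (shift_by 1 ` shift_by (int m) ` H n)"
    by (rule core_eq_trans[OF core_H])
  moreover have "n + int (Suc m) = n + int m + 1"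
    "shift_by (int (Suc m)) ` H n = shift_by 1 ` shift_by (int m) ` H n" by simp_all
  ultimately show ?case by (simp only:)
qed

lemma core_H_near_bwd: "m \<le> prv_mark (H n) \<Longrightarrow> core_eq (H (n - int m)) (shift_by (- int m) ` H n)"
proof (induction m)
  case 0
  then show ?case by (simp add: core_eq_def)
next
  case (Suc m)
  then have IH: "core_eq (H (n - int m)) (shift_by (- int m) ` H n)" by (intro Suc.IH) auto
  let ?n = "n - int m"
  have "int (prv_mark (shift_by (- int m) ` H n)) = int (prv_mark (H n)) - int m"
    using Suc.prems nxt_pos[OF marks_H[of n]] prv_shift_by[OF marks_H[of n], of "- int m"] by simp
  then have prv: "1 \<le> prv_mark (H ?n)" using IH Suc.prems by (simp add: core_eq_def)
  have range: "- int (prv_mark (H ?n)) \<le> - 1" "- 1 < int (nxt_mark (H ?n))"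
    using prv nxt_pos[OF marks_H, of ?n] by auto
  have "core_eq (shift_by (-1) ` H ?n) (shift_by (-1) ` shift_by (- int m) ` H n)"
    by (rule core_eq_shift_by[OF IH marks_H recurrent_marks_shift_by_imp[OF marks_H] range])
  moreover have "core_eq (H ?n) (shift_by 1 ` H (?n - 1))" using core_H[of "?n - 1"] by simp
  then have "core_eq (shift_by (-1) ` H ?n) (shift_by (-1) ` shift_by 1 ` H (?n - 1))"
    by (rule core_eq_shift_by[OF _ marks_H recurrent_marks_shift_by_imp[OF marks_H] range])
  moreover have "n - int (Suc m) = ?n - 1" "shift_by (-1) ` shift_by 1 ` H (?n - 1) = H (?n - 1)"
    "shift_by (- int (Suc m)) ` H n = shift_by (-1) ` shift_by (- int m) ` H n" by simp_all
  ultimately show ?case using core_eq_trans core_eq_sym by metis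
qed

text \<open>All times of a block store the same block, so the one fiber \<open>H n\<close>
  represents them up to, but excluding, the closing marker.\<close>

lemma core_H_near:
  assumes "- int (prv_mark (H n)) \<le> m" "m < int (nxt_mark (H n))"
  shows "core_eq (H (n + m)) (shift_by m ` H n)"
proof (cases "0 \<le> m")
  case True
  then have "core_eq (H (n + int (nat m))) (shift_by (int (nat m)) ` H n)"
    using assms by (intro core_H_near_fwd) simp
  then show ?thesis using True by (simp only: int_nat_eq if_True)
next
  case False
  then have "core_eq (H (n - int (nat (- m)))) (shift_by (- int (nat (- m))) ` H n)"
    using assms by (intro core_H_near_bwd) simp
  moreover have "n - int (nat (- m)) = n + m" "- int (nat (- m)) = m" using False by simp_all
  ultimately show ?thesis by (simp only:)
qed

lemma win_H_near:
  assumes "- int (prv_mark (H n)) \<le> m" "m \<le> int (nxt_mark (H n))"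
  shows "win N 0 (H (n + m)) = win N m (H n)"
proof (cases "m < int (nxt_mark (H n))")
  case True
  have "win N 0 (H (n + m)) = win N 0 (shift_by m ` H n)"
    by (rule core_eq_seg[OF core_H_near[OF assms(1) True]]) (auto simp: hw_H)
  then show ?thesis by (simp add: seg_shift_by_image add_ac)
next
  case False
  \<comment> \<open>At the closing marker the stored block changes, but the window there still lies
    in the widened old block; it is reached from the last time m - 1 of that block.\<close>
  define m' where "m' = m - 1"
  have m: "m = m' + 1" by (simp add: m'_def)
  have m': "- int (prv_mark (H n)) \<le> m'" "m' < int (nxt_mark (H n))"
    using False assms nxt_pos[OF marks_H[of n]] by (auto simp: m'_def)
  have "win N 0 (H (n + m' + 1)) = win N 0 (shift_by 1 ` H (n + m'))"
    by (rule core_eq_seg[OF core_H]) (auto simp: hw_H)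
  also have "\<dots> = seg (1 - int N) (1 + int N) ` H (n + m')" by (simp add: seg_shift_by_image add_ac)
  also have "\<dots> = seg (1 - int N) (1 + int N) ` shift_by m' ` H n"
    by (rule core_eq_seg[OF core_H_near[OF m']]) (use nxt_pos[OF marks_H] hw_H in \<open>auto simp: add_mono\<close>)
  also have "\<dots> = win N m (H n)" by (simp add: seg_shift_by_image m algebra_simps)
  finally show ?thesis by (simp add: m add_ac)
qed

lemma win_H_nearD:
  assumes m: "- int (prv_mark (H n)) \<le> m" "m \<le> int (nxt_mark (H n))" and \<xi>: "\<xi> \<in> H (n + m)"
  obtains \<eta> where "\<eta> \<in> H n" "\<And>k. \<bar>k\<bar> \<le> int N \<Longrightarrow> \<eta> (m + k) = \<xi> k"
proof -
  have "seg (- int N) (int N) ` H (n + m) = seg (- int N) (int N) ` shift_by m ` H n"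
    using win_H_near[OF m] by (simp add: seg_shift_by_image add_ac)
  then obtain \<zeta> where "\<zeta> \<in> shift_by m ` H n" "\<And>k. - int N \<le> k \<Longrightarrow> k \<le> int N \<Longrightarrow> \<zeta> k = \<xi> k"
    using seg_image_eqD[OF _ \<xi>] by metis
  then show thesis using that by (auto simp: add_ac)
qed

text \<open>Each window of \<open>x\<close> comes from some member of \<open>H n\<close>.
  Consecutive windows share a letter, so noncollision forces this member to stay the same along the
  block.\<close>

lemma G_local:
  assumes x: "x \<in> G"
  obtains \<xi> where "\<xi> \<in> H n"
    "\<And>k. - int (prv_mark (H n)) - int N \<le> k \<Longrightarrow> k \<le> int (nxt_mark (H n)) + int N \<Longrightarrow> x (n + k) = \<xi> k"
proof -
  obtain \<xi> where \<xi>: "\<xi> \<in> H n" "\<And>k. \<bar>k\<bar> \<le> int N \<Longrightarrow> x (n + k) = \<xi> k"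
    using x unfolding G_def by blast
  \<comment> \<open>The offset j is -1 when moving forward and 1 when moving backward: it points at
    the time already matched.\<close>
  have step: "\<forall>k. \<bar>k\<bar> \<le> int N \<longrightarrow> x (n + m' + k) = \<xi> (m' + k)"
    if m': "- int (prv_mark (H n)) \<le> m'" "m' \<le> int (nxt_mark (H n))" and j: "\<bar>j\<bar> \<le> 1" and
      eq: "x (n + m' + j) = \<xi> (m' + j)" for m' j
  proof -
    obtain \<zeta> where \<zeta>: "\<zeta> \<in> H (n + m')" "\<And>k. \<bar>k\<bar> \<le> int N \<Longrightarrow> x (n + m' + k) = \<zeta> k"
      using x unfolding G_def by blast
    obtain \<eta> where \<eta>: "\<eta> \<in> H n" "\<And>k. \<bar>k\<bar> \<le> int N \<Longrightarrow> \<eta> (m' + k) = \<zeta> k"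
      using win_H_nearD[OF m' \<zeta>(1)] by blast
    have "\<eta> (m' + j) = \<xi> (m' + j)" using \<zeta>(2)[of j] \<eta>(2)[of j] eq j N_pos by simp
    then have "\<eta> = \<xi>" using noncolliding_H \<eta>(1) \<xi>(1) by blast
    then show ?thesis using \<zeta>(2) \<eta>(2) by simp
  qed
  have fwd: "int i \<le> int (nxt_mark (H n)) \<Longrightarrow> \<forall>k. \<bar>k\<bar> \<le> int N \<longrightarrow> x (n + int i + k) = \<xi> (int i + k)" for i
  proof (induction i)
    case (Suc i)
    then have "\<forall>k. \<bar>k\<bar> \<le> int N \<longrightarrow> x (n + int i + k) = \<xi> (int i + k)" by simp
    then have "x (n + int i + 0) = \<xi> (int i + 0)" by (metis abs_zero of_nat_0_le_iff)
    then have "x (n + int (Suc i) + (- 1)) = \<xi> (int (Suc i) + (- 1))" by simp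
    then show ?case using Suc.prems by (intro step[of _ "-1"]) auto
  qed (use \<xi>(2) in simp)
  have bwd: "i \<le> prv_mark (H n) \<Longrightarrow> \<forall>k. \<bar>k\<bar> \<le> int N \<longrightarrow> x (n + (- int i) + k) = \<xi> (- int i + k)" for i
  proof (induction i)
    case (Suc i)
    then have "\<forall>k. \<bar>k\<bar> \<le> int N \<longrightarrow> x (n + (- int i) + k) = \<xi> (- int i + k)" by simp
    then have "x (n + (- int i) + 0) = \<xi> (- int i + 0)" by (metis abs_zero of_nat_0_le_iff)
    then have "x (n + (- int (Suc i)) + 1) = \<xi> (- int (Suc i) + 1)" by simp
    then show ?case using Suc.prems by (intro step[of _ 1]) auto
  qed (use \<xi>(2) in simp)
  show thesis
  proof (rule that[OF \<xi>(1)])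
    fix k assume k: "- int (prv_mark (H n)) - int N \<le> k" "k \<le> int (nxt_mark (H n)) + int N"
    consider "0 \<le> k" "k \<le> int (nxt_mark (H n))" | "k > int (nxt_mark (H n))"
      | "k < 0" "- int (prv_mark (H n)) \<le> k" | "k < - int (prv_mark (H n))" by linarith
    then show "x (n + k) = \<xi> k"
    proof cases
      case 1
      then show ?thesis using fwd[of "nat k", THEN spec, of 0] by simp
    next
      case 2
      then show ?thesis using fwd[of "nxt_mark (H n)", THEN spec, of "k - int (nxt_mark (H n))"] k by simp
    next
      case 3
      then show ?thesis using bwd[of "nat (- k)", THEN spec, of 0] by simp
    next
      case 4
      then show ?thesis using bwd[of "prv_mark (H n)", THEN spec, of "k + int (prv_mark (H n))"] k by simp
    qed
  qed
qed

text \<open>Consecutive symbols agree on windows of radius \<open>N\<close>, so a member can be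
  continued one step at a time in both directions, possibly changing fibers.\<close>

lemma G_extend:
  assumes \<xi>: "\<xi> \<in> H n"
  obtains x where "x \<in> G"
    "\<And>k. - int (prv_mark (H n)) - int N \<le> k \<Longrightarrow> k \<le> int (nxt_mark (H n)) + int N \<Longrightarrow> x (n + k) = \<xi> k"
proof -
  have win1: "seg (- int N) (int N) ` H (m + 1) = seg (- int N) (int N) ` shift_by 1 ` H m" for m
    by (rule core_eq_seg[OF core_H]) (auto simp: hw_H)
  obtain w where w: "w n = \<xi>" "\<And>m. w m \<in> H m"
    "\<And>m. \<forall>k. - int N \<le> k \<and> k \<le> int N \<longrightarrow> w (m + 1) k = w m (k + 1)"
  proof (rule int_bidirectional_choice[where P = "\<lambda>m \<xi>. \<xi> \<in> H m" and n = n and a = \<xi>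
        and Q = "\<lambda>m \<xi> \<eta>. \<forall>k. - int N \<le> k \<and> k \<le> int N \<longrightarrow> \<eta> k = \<xi> (k + 1)"])
    fix m \<eta> assume "\<eta> \<in> H m"
    then have "shift_by 1 \<eta> \<in> shift_by 1 ` H m" by blast
    then obtain \<zeta> where "\<zeta> \<in> H (m + 1)" "\<And>k. - int N \<le> k \<Longrightarrow> k \<le> int N \<Longrightarrow> \<zeta> k = shift_by 1 \<eta> k"
      using seg_image_eqD[OF win1[symmetric, of m]] by metis
    then show "\<exists>\<zeta>. \<zeta> \<in> H (m + 1) \<and> (\<forall>k. - int N \<le> k \<and> k \<le> int N \<longrightarrow> \<zeta> k = \<eta> (k + 1))" by auto
  next
    fix m \<eta> assume "\<eta> \<in> H (m + 1)"
    then obtain \<zeta> where "\<zeta> \<in> shift_by 1 ` H m" "\<And>k. - int N \<le> k \<Longrightarrow> k \<le> int N \<Longrightarrow> \<zeta> k = \<eta> k"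
      using seg_image_eqD[OF win1[of m]] by metis
    then show "\<exists>\<zeta>. \<zeta> \<in> H m \<and> (\<forall>k. - int N \<le> k \<and> k \<le> int N \<longrightarrow> \<eta> k = \<zeta> (k + 1))" by auto
  qed (use \<xi> in blast)+
  \<comment> \<open>Reading the central letters glues the chosen members; the overlaps show that
    \<open>x\<close> agrees with \<open>w m\<close> on the whole window around m.\<close>
  define x where "x m = w m 0" for m
  have pos: "int i \<le> int N \<Longrightarrow> x (m + int i) = w m (int i)" for m i
  proof (induction i arbitrary: m)
    case (Suc i)
    have "x (m + 1 + int i) = w (m + 1) (int i)" using Suc by simp
    also have "\<dots> = w m (int i + 1)" using w(3)[of m] Suc.prems by simp
    finally show ?case by (simp add: add_ac)
  qed (simp add: x_def)
  have neg: "int i \<le> int N \<Longrightarrow> x (m - int i) = w m (- int i)" for m i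
  proof (induction i arbitrary: m)
    case (Suc i)
    have "x (m - 1 - int i) = w (m - 1) (- int i)" using Suc by simp
    also have "\<dots> = w m (- int i - 1)" using w(3)[of "m - 1", THEN spec, of "- int i - 1"] Suc.prems by simp
    finally have "x (m - 1 - int i) = w m (- int i - 1)" .
    moreover have "m - 1 - int i = m - int (Suc i)" "- int i - 1 = - int (Suc i)" by simp_all
    ultimately show ?case by (simp only:)
  qed (simp add: x_def)
  have x: "x (m + k) = w m k" if "\<bar>k\<bar> \<le> int N" for m k
    using pos[of "nat k" m] neg[of "nat (- k)" m] that by (cases "0 \<le> k") auto
  have xG: "x \<in> G" unfolding G_def using x w(2) by blast
  obtain \<eta> where \<eta>: "\<eta> \<in> H n"
    "\<And>k. - int (prv_mark (H n)) - int N \<le> k \<Longrightarrow> k \<le> int (nxt_mark (H n)) + int N \<Longrightarrow> x (n + k) = \<eta> k"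
    using G_local[OF xG] by blast
  \<comment> \<open>By \<open>G_local\<close> the path follows some member over the whole block; a
    common letter at time 0 identifies it with \<open>\<xi>\<close>.\<close>
  have "\<eta> 0 = \<xi> 0" using x[of 0 n] \<eta>(2)[of 0] w(1) by simp
  then have "\<eta> = \<xi>" using noncolliding_H \<eta>(1) \<xi> by blast
  then show thesis using that xG \<eta>(2) by blast
qed

section \<open>The glued family is a full fiber\<close>

lemma G_local_0:
  assumes "x \<in> G"
  obtains \<xi> where "\<xi> \<in> H n" "\<And>k. \<bar>k\<bar> \<le> 1 \<Longrightarrow> x (n + k) = \<xi> k"
proof -
  obtain \<xi> where "\<xi> \<in> H n" "\<And>k. \<bar>k\<bar> \<le> int N \<Longrightarrow> x (n + k) = \<xi> k"
    using assms unfolding G_def by blast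
  then show thesis using that N_pos by simp
qed

lemma G_noncolliding:
  assumes x: "x \<in> G" and y: "y \<in> G" and eq: "x n = y n"
  shows "x = y"
proof -
  have step: "x (m + j) = y (m + j)" if "x m = y m" "\<bar>j\<bar> \<le> 1" for m j
  proof -
    obtain \<xi> \<eta> where \<xi>: "\<xi> \<in> H m" "\<And>k. \<bar>k\<bar> \<le> 1 \<Longrightarrow> x (m + k) = \<xi> k"
      and \<eta>: "\<eta> \<in> H m" "\<And>k. \<bar>k\<bar> \<le> 1 \<Longrightarrow> y (m + k) = \<eta> k"
      using G_local_0[OF x, of m] G_local_0[OF y, of m] by metis
    have "\<xi> 0 = \<eta> 0" using \<xi>(2)[of 0] \<eta>(2)[of 0] that by simp
    then have "\<xi> = \<eta>" using noncolliding_H \<xi>(1) \<eta>(1) by blast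
    then show ?thesis using \<xi>(2) \<eta>(2) that by simp
  qed
  have "x m = y m" for m
    by (induction m rule: int_induct[of _ n]) (use eq step[of _ 1] step[of _ "-1"] in auto)
  then show ?thesis by blast
qed

lemma G_nonempty: "G \<noteq> {}"
  using G_extend fib_nonempty[OF fib_H[of 0]] by (metis empty_iff equals0I)

lemma G_path: "x \<in> G \<Longrightarrow> x \<in> edge_paths E"
  unfolding edge_paths_def
proof (intro CollectI allI)
  fix n assume "x \<in> G"
  then obtain \<xi> where \<xi>: "\<xi> \<in> H n" "\<And>k. \<bar>k\<bar> \<le> 1 \<Longrightarrow> x (n + k) = \<xi> k" using G_local_0 by metis
  have "(\<xi> 0, \<xi> (0 + 1)) \<in> E" using fib_path[OF fib_H \<xi>(1)] unfolding edge_paths_def by blast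
  then show "(x n, x (n + 1)) \<in> E" using \<xi>(2)[of 0] \<xi>(2)[of 1] by simp
qed

lemma G_related: "x \<in> G \<Longrightarrow> y \<in> G \<Longrightarrow> (x n, y n) \<in> R"
proof -
  assume "x \<in> G" "y \<in> G"
  then obtain \<xi> \<eta> where "\<xi> \<in> H n" "\<And>k. \<bar>k\<bar> \<le> 1 \<Longrightarrow> x (n + k) = \<xi> k"
      and "\<eta> \<in> H n" "\<And>k. \<bar>k\<bar> \<le> 1 \<Longrightarrow> y (n + k) = \<eta> k"
    using G_local_0[of x n] G_local_0[of y n] by metis
  then show ?thesis using fib_related[OF fib_H, of \<xi> n \<eta> 0] by (metis abs_zero add.right_neutral zero_le_one)
qed

definition marked :: "int \<Rightarrow> bool" where "marked n \<longleftrightarrow> mark (H n) 0"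

lemma mark_H_iff: "mark (H n) m \<longleftrightarrow> magic N (win N m (H n)) \<and> enc (win N m (H n)) = K"
  unfolding mark_def by (simp add: hw_H key_H)

lemma marked_near:
  assumes "- int (prv_mark (H n)) \<le> m" "m \<le> int (nxt_mark (H n))"
  shows "marked (n + m) \<longleftrightarrow> mark (H n) m"
  by (simp only: marked_def mark_H_iff win_H_near[OF assms])

lemma marked_prv: "marked (n - int (prv_mark (H n)))"
  using marked_near[of n "- int (prv_mark (H n))"] mark_prv[OF marks_H[of n]] by simp

lemma marked_nxt: "marked (n + int (nxt_mark (H n)))"
  using marked_near[of n "int (nxt_mark (H n))"] mark_nxt[OF marks_H[of n]] by simp

lemma marked_future: "\<exists>n\<ge>m. marked n"
  using marked_nxt[of m] by (intro exI[of _ "m + int (nxt_mark (H m))"]) simp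

lemma marked_past: "\<exists>n\<le>m. marked n"
  using marked_prv[of m] by (intro exI[of _ "m - int (prv_mark (H m))"]) simp

text \<open>All marked windows have code \<open>K\<close>, hence are one and the same finite set of
  words. At marked times \<open>x\<close> takes its letters from the finite set of their middle
  letters.\<close>

lemma G_Reg:
  assumes x: "x \<in> G"
  shows "x \<in> Reg"
proof -
  obtain n0 where n0: "marked n0" using marked_future by blast
  define D where "D = (\<lambda>w. w ! N) ` win N 0 (H n0)"
  have "finite D" unfolding D_def using fib_finite[OF fib_H] by blast
  have "x n \<in> D" if "marked n" for n
  proof -
    have "win N 0 (H n) = win N 0 (H n0)"
      using that n0 fib_finite[OF fib_H] unfolding marked_def mark_H_iff by (intro enc_inj) auto
    moreover obtain \<xi> where \<xi>: "\<xi> \<in> H n" "\<And>k. \<bar>k\<bar> \<le> 1 \<Longrightarrow> x (n + k) = \<xi> k"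
      using G_local_0[OF x, of n] by blast
    moreover have "seg (0 - int N) (0 + int N) \<xi> ! N = \<xi> 0"
      using seg_nth[of "- int N" 0 "int N" \<xi>] by simp
    moreover have "x n = \<xi> 0" using \<xi>(2)[of 0] by simp
    ultimately show ?thesis unfolding D_def by (metis image_eqI)
  qed
  then have "\<exists>n\<ge>m. x n \<in> D" "\<exists>n\<le>m. x n \<in> D" for m
    using marked_future marked_past by blast+
  then show ?thesis unfolding Reg_iff
    using G_path[OF x] finite_set_recurs[OF \<open>finite D\<close>] finite_set_recurs_past[OF \<open>finite D\<close>] by blast
qed

text \<open>A path related to \<open>G\<close> takes values in \<open>G\<close> at both ends of a block, because the marker is magic;
  spliced into the full fiber from which the block was read off, it must follow one of its members.\<close>

lemma related_path_follows_block:
  assumes x: "x \<in> Reg" "\<And>\<gamma> n. \<gamma> \<in> G \<Longrightarrow> (x n, \<gamma> n) \<in> R" and t: "marked t"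
  obtains \<gamma> where "\<gamma> \<in> G" "\<And>k. 0 \<le> k \<Longrightarrow> k \<le> int (nxt_mark (H t)) \<Longrightarrow> x (t + k) = \<gamma> (t + k)"
proof -
  let ?J = "int (nxt_mark (H t))"
  have rel: "(x (t + k), \<xi> k) \<in> R" if \<xi>: "\<xi> \<in> H t" and k: "- int N \<le> k" "k \<le> ?J + int N" for \<xi> k
  proof -
    obtain \<gamma> where "\<gamma> \<in> G"
      "\<And>k. - int (prv_mark (H t)) - int N \<le> k \<Longrightarrow> k \<le> ?J + int N \<Longrightarrow> \<gamma> (t + k) = \<xi> k"
      using G_extend[OF \<xi>] by blast
    then show ?thesis using x(2)[of \<gamma> "t + k"] k by simp
  qed
  have end_value: "\<exists>\<xi>\<in>H t. x (t + m) = \<xi> m" if m: "0 \<le> m" "m \<le> ?J" "mark (H t) m" for m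
  proof -
    have "magic N (win N m (H t))" using m(3) unfolding mark_H_iff by blast
    moreover have "(x (t + m + k), x (t + m + (k + 1))) \<in> E" for k
      using Reg_path[OF x(1)] unfolding edge_paths_def by (simp add: add.assoc[symmetric])
    moreover have "(x (t + m + k), \<xi> (m + k)) \<in> R" if "\<xi> \<in> H t" "- int N \<le> k" "k \<le> int N" for \<xi> k
      using rel[OF that(1), of "m + k"] that m by (simp add: add.assoc)
    ultimately have "\<exists>\<xi>\<in>H t. x (t + m + 0) = \<xi> m"
      unfolding magic_win_iff by (elim conjE allE[of _ "\<lambda>k. x (t + m + k)"]) blast
    then show ?thesis by simp
  qed
  obtain \<xi>1 where \<xi>1: "\<xi>1 \<in> H t" "x (t + 0) = \<xi>1 0" using end_value[of 0] t by (auto simp: marked_def)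
  obtain \<xi>2 where \<xi>2: "\<xi>2 \<in> H t" "x (t + ?J) = \<xi>2 ?J"
    using end_value[of ?J] mark_nxt[OF marks_H[of t]] by auto
  define x' where "x' k = (if k < 0 then \<xi>1 k else if k \<le> ?J then x (t + k) else \<xi>2 k)" for k
  have "x' \<in> H t"
  proof (rule fib_closed[OF fib_H \<xi>1(1)])
    show "x' \<in> edge_paths E" unfolding edge_paths_def
    proof (intro CollectI allI)
      fix k
      have e: "(\<xi>1 k, \<xi>1 (k + 1)) \<in> E" "(\<xi>2 k, \<xi>2 (k + 1)) \<in> E"
        using fib_path[OF fib_H \<xi>1(1)] fib_path[OF fib_H \<xi>2(1)] by (auto simp: edge_paths_def)
      have ex: "(x (t + k), x (t + (k + 1))) \<in> E"
        using Reg_path[OF x(1)] unfolding edge_paths_def by (simp add: add.assoc[symmetric])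
      consider "k < - 1" | "k = - 1" | "0 \<le> k" "k < ?J" | "k = ?J" | "k > ?J" by linarith
      then show "(x' k, x' (k + 1)) \<in> E"
      proof cases
        case 2
        then show ?thesis using e \<xi>1(2) by (simp add: x'_def)
      next
        case 4
        then show ?thesis using e \<xi>2(2) by (simp add: x'_def)
      qed (use e ex in \<open>auto simp: x'_def\<close>)
    qed
    fix k show "(x' k, \<xi>1 k) \<in> R"
      using rel[OF \<xi>1(1), of k] fib_related[OF fib_H \<xi>1(1) \<xi>1(1)] fib_related[OF fib_H \<xi>2(1) \<xi>1(1)]
      by (auto simp: x'_def)
  qed
  then obtain \<gamma> where \<gamma>: "\<gamma> \<in> G"
    "\<And>k. - int (prv_mark (H t)) - int N \<le> k \<Longrightarrow> k \<le> ?J + int N \<Longrightarrow> \<gamma> (t + k) = x' k"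
    using G_extend by blast
  show thesis
  proof (rule that[OF \<gamma>(1)])
    fix k assume k: "0 \<le> k" "k \<le> ?J"
    have "\<gamma> (t + k) = x' k" using k by (intro \<gamma>(2)) auto
    then show "x (t + k) = \<gamma> (t + k)" using k by (simp add: x'_def)
  qed
qed

text \<open>Any two consecutive times lie in a closed block, where \<open>x\<close> follows a member
  of \<open>G\<close>. The members used at n and n + 1 share the letter at n + 1, so they are
  equal.\<close>

lemma G_maximal:
  assumes \<gamma>0: "\<gamma>0 \<in> G" and x: "x \<in> edge_paths E" "\<And>n. (x n, \<gamma>0 n) \<in> R"
  shows "x \<in> G"
proof -
  have xReg: "x \<in> Reg" using Reg_related[OF x(1) G_Reg[OF \<gamma>0] x(2)] .
  have rel: "(x n, \<gamma> n) \<in> R" if "\<gamma> \<in> G" for \<gamma> n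
    using R_trans[of x \<gamma>0 \<gamma>] xReg G_Reg \<gamma>0 that x(2) G_related by (simp add: Reg_def)
  have "\<exists>\<gamma>\<in>G. x n = \<gamma> n \<and> x (n + 1) = \<gamma> (n + 1)" for n
  proof -
    \<comment> \<open>The block containing n starts at t, and its closing marker lies at n + 1 or
      later, so both times are covered.\<close>
    define t where "t = n - int (prv_mark (H n))"
    have "core_eq (H (n + (- int (prv_mark (H n))))) (shift_by (- int (prv_mark (H n))) ` H n)"
      using nxt_pos[OF marks_H[of n]] by (intro core_H_near) auto
    then have "nxt_mark (H t) = nxt_mark (shift_by (- int (prv_mark (H n))) ` H n)"
      by (simp add: t_def core_eq_def)
    also have "int \<dots> = int (nxt_mark (H n)) + int (prv_mark (H n))"
      using nxt_shift_by[OF marks_H[of n], of "- int (prv_mark (H n))"] nxt_pos[OF marks_H[of n]] by simp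
    finally have J: "int (nxt_mark (H t)) = int (nxt_mark (H n)) + int (prv_mark (H n))" .
    obtain \<gamma> where "\<gamma> \<in> G" "\<And>k. 0 \<le> k \<Longrightarrow> k \<le> int (nxt_mark (H t)) \<Longrightarrow> x (t + k) = \<gamma> (t + k)"
      using related_path_follows_block[of x t] xReg rel marked_prv[of n] unfolding t_def by blast
    note \<gamma> = this
    have "0 \<le> n - t" "n + 1 - t \<le> int (nxt_mark (H t))"
      using nxt_pos[OF marks_H[of n]] unfolding J by (simp_all add: t_def)
    then show ?thesis using \<gamma>(1) \<gamma>(2)[of "n - t"] \<gamma>(2)[of "n + 1 - t"] by (intro bexI[of _ \<gamma>]) auto
  qed
  then obtain \<gamma> where \<gamma>: "\<And>n. \<gamma> n \<in> G" "\<And>n. x n = \<gamma> n n" "\<And>n. x (n + 1) = \<gamma> n (n + 1)" by metis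
  have eq: "\<gamma> (n + 1) = \<gamma> n" for n
    using G_noncolliding[OF \<gamma>(1) \<gamma>(1), of "n + 1" "n + 1" n] \<gamma>(2)[of "n + 1"] \<gamma>(3)[of n] by simp
  have const: "\<gamma> n = \<gamma> 0" for n
  proof (induction n rule: int_induct[of _ 0])
    case (step2 i)
    then show ?case using eq[of "i - 1"] by simp
  qed (simp_all add: eq)
  have "x n = \<gamma> 0 n" for n using \<gamma>(2)[of n] unfolding const[of n] .
  then have "x = \<gamma> 0" by blast
  then show ?thesis using \<gamma>(1) by simp
qed

lemma G_fib: "is_fib G"
proof -
  obtain \<gamma> where \<gamma>: "\<gamma> \<in> G" using G_nonempty by blast
  have "G = cls \<gamma>"
    using G_path G_related[OF _ \<gamma>] G_maximal[OF \<gamma>] by (auto simp: cls_def)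
  then show ?thesis using G_Reg[OF \<gamma>] unfolding is_fib_def by blast
qed

section \<open>Markers, blocks and envelopes of the glued fiber\<close>

lemma seg_G:
  assumes "- int (prv_mark (H n)) - int N \<le> a" "b \<le> int (nxt_mark (H n)) + int N"
  shows "seg a b ` shift_by n ` G = seg a b ` H n"
proof (intro equalityI subsetI)
  fix w assume "w \<in> seg a b ` shift_by n ` G"
  then obtain x where x: "x \<in> G" "w = seg a b (shift_by n x)" by blast
  then obtain \<xi> where \<xi>: "\<xi> \<in> H n"
    "\<And>k. - int (prv_mark (H n)) - int N \<le> k \<Longrightarrow> k \<le> int (nxt_mark (H n)) + int N \<Longrightarrow> x (n + k) = \<xi> k"
    using G_local by metis
  then have "seg a b (shift_by n x) = seg a b \<xi>" using assms by (auto simp: seg_eq_iff add.commute)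
  then show "w \<in> seg a b ` H n" using x \<xi> by auto
next
  fix w assume "w \<in> seg a b ` H n"
  then obtain \<xi> where \<xi>: "\<xi> \<in> H n" "w = seg a b \<xi>" by blast
  then obtain x where x: "x \<in> G"
    "\<And>k. - int (prv_mark (H n)) - int N \<le> k \<Longrightarrow> k \<le> int (nxt_mark (H n)) + int N \<Longrightarrow> x (n + k) = \<xi> k"
    using G_extend by metis
  then have "seg a b (shift_by n x) = seg a b \<xi>" using assms by (auto simp: seg_eq_iff add.commute)
  then show "w \<in> seg a b ` shift_by n ` G" using x \<xi> by (metis image_eqI)
qed

lemma win_G: "N' \<le> N \<Longrightarrow> win N' n G = win N' 0 (H n)"
  using seg_G[of n "- int N'" "int N'"] by (simp add: seg_shift_by_image add_ac)

text \<open>Windows of \<open>G\<close> of half-width at most \<open>N\<close> are central windows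
  of the fibers \<open>H n\<close>, for all of which \<open>N\<close> is least; so minimality
  transfers in both directions.\<close>

lemma hw_G: "hw G = N"
proof (rule antisym)
  obtain n where "marked n" using marked_future by blast
  then have "magic N (win N n G)" using win_G[of N n] unfolding marked_def mark_H_iff by simp
  then show le: "hw G \<le> N" by (rule hw_le)
  obtain n where "magic (hw G) (win (hw G) n G)"
    using mark_exists[OF G_fib] unfolding mark_def by blast
  then have "magic (hw G) (win (hw G) 0 (H n))" using win_G[OF le] by simp
  then show "N \<le> hw G" using hw_le hw_H by metis
qed

lemma key_G: "key G = K"
proof (rule antisym)
  obtain n where "marked n" using marked_future by blast
  then have "magic N (win N n G)" "enc (win N n G) = K"
    using win_G[of N n] unfolding marked_def mark_H_iff by simp_all
  then show "key G \<le> K" using key_le[of G n] hw_G by simp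
  obtain n where "magic N (win N n G)" "enc (win N n G) = key G"
    using mark_exists[OF G_fib] hw_G unfolding mark_def by auto
  then have "magic N (win N 0 (H n))" "enc (win N 0 (H n)) = key G" using win_G[of N n] by simp_all
  then show "K \<le> key G" using key_le[of "H n" 0] hw_H key_H by simp
qed

lemma mark_G: "mark G n \<longleftrightarrow> marked n"
  unfolding mark_def hw_G key_G win_G[OF order_refl] marked_def hw_H by (simp add: key_H)

lemma marks_G: "recurrent_marks G"
  unfolding recurrent_marks_def mark_G using marked_future marked_past by blast

lemma core_G: "core_eq (shift_by n ` G) (H n)"
proof -
  have near: "mark (shift_by n ` G) m \<longleftrightarrow> mark (H n) m"
    if "- int (prv_mark (H n)) \<le> m" "m \<le> int (nxt_mark (H n))" for m
    using marked_near[OF that] by (simp add: mark_G add.commute)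
  have p: "prv_mark (shift_by n ` G) = prv_mark (H n)"
  proof (rule prv_eqI)
    show "mark (shift_by n ` G) (- int (prv_mark (H n)))"
      using near[of "- int (prv_mark (H n))"] mark_prv[OF marks_H] by simp
    show "\<not> mark (shift_by n ` G) m" if "- int (prv_mark (H n)) < m" "m \<le> 0" for m
      using near[of m] not_mark_after_prv[OF marks_H] that by simp
  qed
  have q: "nxt_mark (shift_by n ` G) = nxt_mark (H n)"
  proof (rule nxt_eqI)
    show "mark (shift_by n ` G) (int (nxt_mark (H n)))"
      using near[of "int (nxt_mark (H n))"] mark_nxt[OF marks_H] by simp
    show "\<not> mark (shift_by n ` G) m" if "1 \<le> m" "m < int (nxt_mark (H n))" for m
      using near[of m] not_mark_before_nxt[OF marks_H] that by simp
  qed (rule nxt_pos[OF marks_H])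
  have "blk (shift_by n ` G) = blk (H n)"
    unfolding blk_def p q hw_shift_by hw_G hw_H by (rule seg_G) auto
  then show ?thesis using p q by (simp add: core_eq_def hw_G key_G hw_H key_H)
qed

lemma gap_next_G: "gap_next (shift_by n ` G) = gap_next (H n)"
  using core_G[of n] mark_G[of n] by (simp add: gap_next_def core_eq_def marked_def)

lemma gap_last_G: "gap_last (shift_by (n + 1) ` G) = gap_last (shift_by 1 ` H n)"
proof -
  have "mark (shift_by n ` G) 1 \<longleftrightarrow> mark (H n) 1"
    using marked_near[of n 1] nxt_pos[OF marks_H[of n]] by (simp add: mark_G add.commute)
  moreover have "prv_mark (shift_by n ` G) = prv_mark (H n)" using core_G[of n] by (simp add: core_eq_def)
  ultimately show ?thesis
    using gap_last_shift_by_1[OF recurrent_marks_shift_by_imp[OF marks_G, of n]] gap_last_shift_by_1[OF marks_H[of n]]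
    by (simp add: add.commute)
qed

lemma fwd_step_H: "fwd_env (H n) = max (gap_next (shift_by n ` G)) (fwd_env (H (n + 1)) - 1)"
  using fwd_env_step[OF tame_H[of n]] by (simp add: gap_next_G fwd_H)

lemma bwd_step_H: "bwd_env (H (n + 1)) = max (gap_last (shift_by (n + 1) ` G)) (bwd_env (H n) - 1)"
  using bwd_env_step[OF tame_H[of n]] by (simp add: gap_last_G bwd_H)

text \<open>Iterating the local rule shows that the recorded envelopes majorize the gaps of
  \<open>G\<close>. This makes \<open>G\<close> tame and gives one half of the comparison with its
  true envelope.\<close>

lemma gap_next_le_fwd_H: "gap_next (shift_by (n + int k) ` G) \<le> fwd_env (H n) + k"
proof (induction k arbitrary: n)
  case 0
  have "gap_next (shift_by n ` G) \<le> fwd_env (H n)" by (subst fwd_step_H) (rule max.cobounded1)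
  then show ?case by (simp only: of_nat_0 add_0_right)
next
  case (Suc k)
  have "n + int (Suc k) = n + 1 + int k" by simp
  then have "gap_next (shift_by (n + int (Suc k)) ` G) \<le> fwd_env (H (n + 1)) + k"
    using Suc.IH[of "n + 1"] by (simp only:)
  also have "\<dots> \<le> fwd_env (H n) + Suc k" using fwd_step_H[of n] by simp
  finally show ?case .
qed

lemma gap_last_le_bwd_H: "gap_last (shift_by (n - int k) ` G) \<le> bwd_env (H n) + k"
proof (induction k arbitrary: n)
  case 0
  have "gap_last (shift_by (n - 1 + 1) ` G) \<le> bwd_env (H (n - 1 + 1))"
    by (subst bwd_step_H) (rule max.cobounded1)
  then show ?case by (simp only: of_nat_0 add_0_right diff_0_right diff_add_cancel)
next
  case (Suc k)
  have "n - int (Suc k) = n - 1 - int k" by simp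
  then have "gap_last (shift_by (n - int (Suc k)) ` G) \<le> bwd_env (H (n - 1)) + k"
    using Suc.IH[of "n - 1"] by (simp only:)
  also have "\<dots> \<le> bwd_env (H n) + Suc k" using bwd_step_H[of "n - 1"] by simp
  finally show ?case .
qed

lemma good_G: "good G"
  unfolding good_def
proof (intro conjI G_fib marks_G)
  show "noncolliding G" unfolding noncolliding_def using G_noncolliding by blast
  show "tame G" unfolding tame_def using gap_next_le_fwd_H gap_last_le_bwd_H by blast
qed

text \<open>The cores agree by \<open>core_G\<close>. Recorded and true envelopes obey the same
  recursion with the recorded ones at least as large, and a recurring symbol supplies the recurring
  value that forces equality.\<close>

lemma symb_G:
  assumes recurs: "\<exists>v. \<forall>m. \<exists>n\<ge>m. symb (H n) = v" "\<exists>v. \<forall>m. \<exists>n\<le>m. symb (H n) = v"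
  shows "symb (shift_by n ` G) = symb (H n)"
proof -
  have tame_G: "tame (shift_by n ` G)" for n using good_G tame_shift_by_imp by (auto simp: good_def)
  obtain v where v: "\<And>m. \<exists>n\<ge>m. symb (H n) = v" using recurs(1) by blast
  obtain n0 where n0: "symb (H n0) = v" using v by blast
  have shift1: "shift_by 1 ` shift_by n ` G = shift_by (n + 1) ` G" for n by (simp add: add.commute)
  have f: "fwd_env (H n) = fwd_env (shift_by n ` G)" for n
  proof (rule envelope_unique[where c = "\<lambda>n. gap_next (shift_by n ` G)" and v = "fwd_env (H n0)"])
    fix n
    show "fwd_env (H n) = max (gap_next (shift_by n ` G)) (fwd_env (H (n + 1)) - 1)"
      by (rule fwd_step_H)
    show "fwd_env (shift_by n ` G) = max (gap_next (shift_by n ` G)) (fwd_env (shift_by (n + 1) ` G) - 1)"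
      using fwd_env_step[OF tame_G[of n]] unfolding shift1 .
    show "fwd_env (shift_by n ` G) \<le> fwd_env (H n)"
    proof (rule fwd_env_le)
      fix k
      have "shift_by (int k) ` shift_by n ` G = shift_by (n + int k) ` G" by (simp add: add.commute)
      then show "gap_next (shift_by (int k) ` shift_by n ` G) \<le> fwd_env (H n) + k"
        using gap_next_le_fwd_H[of n k] by (simp only:)
    qed
    fix m
    obtain l where "l \<ge> m" "symb (H l) = v" using v by blast
    then show "\<exists>n\<ge>m. fwd_env (H n) = fwd_env (H n0)"
      using n0 symb_eq_iff[OF fib_H fib_H, of l n0] by (intro exI[of _ l]) simp
  qed
  obtain u where u: "\<And>m. \<exists>n\<le>m. symb (H n) = u" using recurs(2) by blast
  obtain n1 where n1: "symb (H n1) = u" using u by blast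
  \<comment> \<open>Negating times brings the backward recursion into the form of
    \<open>envelope_unique\<close>; recurrence in the past enters here.\<close>
  have b: "bwd_env (H (- n)) = bwd_env (shift_by (- n) ` G)" for n
  proof (rule envelope_unique[where f = "\<lambda>n. bwd_env (H (- n))" and g = "\<lambda>n. bwd_env (shift_by (- n) ` G)"
        and c = "\<lambda>n. gap_last (shift_by (- n) ` G)" and v = "bwd_env (H n1)"])
    fix n :: int
    have e: "- n = - (n + 1) + 1" by simp
    show "bwd_env (H (- n)) = max (gap_last (shift_by (- n) ` G)) (bwd_env (H (- (n + 1))) - 1)"
      using bwd_step_H[of "- (n + 1)"] unfolding e[symmetric] .
    show "bwd_env (shift_by (- n) ` G) = max (gap_last (shift_by (- n) ` G)) (bwd_env (shift_by (- (n + 1)) ` G) - 1)"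
      using bwd_env_step[OF tame_G[of "- (n + 1)"]] unfolding shift1 e[symmetric] .
    show "bwd_env (shift_by (- n) ` G) \<le> bwd_env (H (- n))"
    proof (rule bwd_env_le)
      fix k
      have "- int k + - n = - n - int k" by simp
      then have "shift_by (- int k) ` shift_by (- n) ` G = shift_by (- n - int k) ` G"
        by (simp only: shift_by_image_add)
      then show "gap_last (shift_by (- int k) ` shift_by (- n) ` G) \<le> bwd_env (H (- n)) + k"
        using gap_last_le_bwd_H[of "- n" k] by (simp only:)
    qed
    fix m
    obtain l where "l \<le> - m" "symb (H l) = u" using u by blast
    then show "\<exists>n\<ge>m. bwd_env (H (- n)) = bwd_env (H n1)"
      using n1 symb_eq_iff[OF fib_H fib_H, of l n1] by (intro exI[of _ "- l"]) simp
  qed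
  show ?thesis
    using core_G[of n] f[of n] b[of "- n"] symb_eq_iff[OF _ fib_H, of "shift_by n ` G" n] G_fib by simp
qed

end

section \<open>The decoding map and its 1-Lipschitz lift\<close>

context coded_shift
begin

definition dec :: "(int \<Rightarrow> nat) \<Rightarrow> (int \<Rightarrow> nat) set" where
  "dec z = {x. \<forall>n. \<exists>F. good F \<and> symb F = z n \<and> (\<exists>\<xi>\<in>F. \<forall>k. \<bar>k\<bar> \<le> int (hw F) \<longrightarrow> x (n + k) = \<xi> k)}"

lemma trans_path_realization:
  assumes "z \<in> edge_paths trans"
  obtains H where "coded_path E R H" "\<And>n. z n = symb (H n)" "coded_path.G E R H = dec z"
proof -
  have "\<forall>n. \<exists>F. good F \<and> z n = symb F \<and> z (n + 1) = symb (shift_by 1 ` F)"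
    using assms unfolding edge_paths_def trans_def by blast
  then obtain H where H: "\<And>n. good (H n)" "\<And>n. z n = symb (H n)" "\<And>n. z (n + 1) = symb (shift_by 1 ` H n)"
    by metis
  then have path: "coded_path E R H" by unfold_locales (simp_all flip: H(2,3))
  interpret coded_path E R H by (rule path)
  \<comment> \<open>Windows of radius \<open>N\<close> are determined by the symbol, so every good
    fiber with symbol \<open>z n\<close> imposes the same condition as \<open>H n\<close>.\<close>
  have same: "(\<exists>F. good F \<and> symb F = z n \<and> (\<exists>\<xi>\<in>F. \<forall>k. \<bar>k\<bar> \<le> int (hw F) \<longrightarrow> x (n + k) = \<xi> k))
      \<longleftrightarrow> (\<exists>\<xi>\<in>H n. \<forall>k. \<bar>k\<bar> \<le> int N \<longrightarrow> x (n + k) = \<xi> k)" for x n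
  proof
    assume "\<exists>F. good F \<and> symb F = z n \<and> (\<exists>\<xi>\<in>F. \<forall>k. \<bar>k\<bar> \<le> int (hw F) \<longrightarrow> x (n + k) = \<xi> k)"
    then obtain F \<xi> where F: "good F" "symb F = symb (H n)" "\<xi> \<in> F" "\<And>k. \<bar>k\<bar> \<le> int (hw F) \<Longrightarrow> x (n + k) = \<xi> k"
      using H(2) by auto
    then have c: "core_eq F (H n)" using symb_eq_iff good_is_fib fib_H by blast
    then have hwF: "hw F = N" using hw_H by (simp add: core_eq_def)
    have "seg (- int N) (int N) ` F = seg (- int N) (int N) ` H n"
      by (rule core_eq_seg[OF c]) (auto simp: hwF)
    then obtain \<eta> where "\<eta> \<in> H n" "\<And>k. - int N \<le> k \<Longrightarrow> k \<le> int N \<Longrightarrow> \<eta> k = \<xi> k"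
      using seg_image_eqD[OF _ F(3)] by metis
    then show "\<exists>\<xi>\<in>H n. \<forall>k. \<bar>k\<bar> \<le> int N \<longrightarrow> x (n + k) = \<xi> k" using F(4) hwF by (intro bexI[of _ \<eta>]) auto
  next
    assume "\<exists>\<xi>\<in>H n. \<forall>k. \<bar>k\<bar> \<le> int N \<longrightarrow> x (n + k) = \<xi> k"
    then show "\<exists>F. good F \<and> symb F = z n \<and> (\<exists>\<xi>\<in>F. \<forall>k. \<bar>k\<bar> \<le> int (hw F) \<longrightarrow> x (n + k) = \<xi> k)"
      using H(1,2) hw_H by (intro exI[of _ "H n"]) auto
  qed
  have "coded_path.G E R H = dec z" unfolding G_def dec_def same ..
  then show thesis using that path H(2) by blast
qed

lemma dec_fib: "z \<in> edge_paths trans \<Longrightarrow> is_fib (dec z)"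
  using trans_path_realization coded_path.G_fib by metis

lemma dec_regular:
  assumes "z \<in> regular_part UNIV (edge_paths trans)"
  shows "good (dec z)" and "symb (shift_by n ` dec z) = z n"
proof -
  have z: "z \<in> edge_paths trans" "\<exists>u. \<forall>m. \<exists>n\<le>m. z n = u" "\<exists>v. \<forall>m. \<exists>n\<ge>m. z n = v"
    using assms unfolding regular_part_iff by auto
  then obtain H where H: "coded_path E R H" "\<And>n. z n = symb (H n)" "coded_path.G E R H = dec z"
    using trans_path_realization by blast
  show "good (dec z)" using coded_path.good_G[OF H(1)] H(3) by simp
  show "symb (shift_by n ` dec z) = z n" using coded_path.symb_G[OF H(1)] z(2,3) H(2,3) by simp
qed

lemma dec_shift_by: "dec (shift_by j z) = shift_by j ` dec z"
proof -
  have sub: "shift_by j ` dec z \<subseteq> dec (shift_by j z)" for j z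
  proof (intro image_subsetI, unfold dec_def, intro CollectI allI)
    fix x n
    assume "x \<in> {x. \<forall>n. \<exists>F. good F \<and> symb F = z n \<and> (\<exists>\<xi>\<in>F. \<forall>k. \<bar>k\<bar> \<le> int (hw F) \<longrightarrow> x (n + k) = \<xi> k)}"
    then have "\<exists>F. good F \<and> symb F = z (n + j) \<and> (\<exists>\<xi>\<in>F. \<forall>k. \<bar>k\<bar> \<le> int (hw F) \<longrightarrow> x (n + j + k) = \<xi> k)"
      by blast
    moreover have "n + j + k = n + k + j" for k by simp
    ultimately show "\<exists>F. good F \<and> symb F = shift_by j z n \<and> (\<exists>\<xi>\<in>F. \<forall>k. \<bar>k\<bar> \<le> int (hw F) \<longrightarrow> shift_by j x (n + k) = \<xi> k)"
      by (simp only: shift_by_apply)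
  qed
  have "x \<in> shift_by j ` dec z" if "x \<in> dec (shift_by j z)" for x
  proof -
    have "shift_by (- j) x \<in> dec z" using sub[of "- j" "shift_by j z"] that by auto
    then show ?thesis by (intro image_eqI[of _ _ "shift_by (- j) x"]) auto
  qed
  then show ?thesis using sub by blast
qed

lemma code_path: "good F \<Longrightarrow> (\<lambda>n. symb (shift_by n ` F)) \<in> edge_paths trans"
  unfolding edge_paths_def trans_def
proof (intro CollectI allI)
  fix n assume "good F"
  moreover have "shift_by (n + 1) ` F = shift_by 1 ` shift_by n ` F"
    by (simp only: shift_by_image_add add.commute)
  ultimately show "\<exists>F'. (symb (shift_by n ` F), symb (shift_by (n + 1) ` F)) = (symb F', symb (shift_by 1 ` F')) \<and> good F'"
    by (intro exI[of _ "shift_by n ` F"] conjI) (simp_all only: good_shift_by)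
qed

text \<open>Both sides are full fibers, so one common member is enough.\<close>

lemma dec_code:
  assumes "good F"
  shows "dec (\<lambda>n. symb (shift_by n ` F)) = F"
proof -
  obtain x where x: "x \<in> F" using fib_nonempty good_is_fib[OF assms] by blast
  have "x \<in> dec (\<lambda>n. symb (shift_by n ` F))"
    unfolding dec_def
  proof (intro CollectI allI)
    fix n
    show "\<exists>F'. good F' \<and> symb F' = symb (shift_by n ` F) \<and> (\<exists>\<xi>\<in>F'. \<forall>k. \<bar>k\<bar> \<le> int (hw F') \<longrightarrow> x (n + k) = \<xi> k)"
    proof (intro exI[of _ "shift_by n ` F"] conjI bexI[of _ "shift_by n x"] allI impI)
      show "x (n + k) = shift_by n x k" for k by (simp only: shift_by_apply add.commute)
    qed (use assms x in \<open>simp_all only: good_shift_by shift_by_mem_image_iff\<close>)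
  qed
  then have "dec (\<lambda>n. symb (shift_by n ` F)) = cls x"
    by (rule fib_eq_cls[OF dec_fib[OF code_path[OF assms]]])
  also have "\<dots> = F" using fib_eq_cls[OF good_is_fib[OF assms] x] by (rule sym)
  finally show ?thesis .
qed

text \<open>\<open>least_lift\<close> does not commute with the shift, as the member of the fiber with least letter
  depends on the time, but a shift keeps it in the same fiber.\<close>

definition least_lift :: "(int \<Rightarrow> nat) \<Rightarrow> int \<Rightarrow> nat" where
  "least_lift z = (SOME x. x \<in> dec z \<and> x 0 = Min ((\<lambda>x. x 0) ` dec z))"

lemma
  assumes "z \<in> edge_paths trans"
  shows least_lift_mem: "least_lift z \<in> dec z"
    and least_lift_0: "least_lift z 0 = Min ((\<lambda>x. x 0) ` dec z)"
proof -
  have "Min ((\<lambda>x. x 0) ` dec z) \<in> (\<lambda>x. x 0) ` dec z"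
    using dec_fib[OF assms] fib_finite fib_nonempty by (intro Min_in) auto
  then have "\<exists>x. x \<in> dec z \<and> x 0 = Min ((\<lambda>x. x 0) ` dec z)" by auto
  then have "least_lift z \<in> dec z \<and> least_lift z 0 = Min ((\<lambda>x. x 0) ` dec z)"
    unfolding least_lift_def by (rule someI_ex)
  then show "least_lift z \<in> dec z" "least_lift z 0 = Min ((\<lambda>x. x 0) ` dec z)" by auto
qed

text \<open>Equal symbols show the same words around time n, and by noncollision the letter at n
  singles out one of them. Each agreeing symbol thus carries equality of letters one step
  further.\<close>

lemma dec_letter_step:
  assumes z: "z \<in> edge_paths trans" "z' \<in> edge_paths trans" and eq: "z n = z' n"
    and x: "x \<in> dec z" "x' \<in> dec z'" "x n = x' n" and j: "\<bar>j\<bar> \<le> 1"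
  shows "x (n + j) = x' (n + j)"
proof -
  obtain H where H: "coded_path E R H" "\<And>n. z n = symb (H n)" "coded_path.G E R H = dec z"
    using trans_path_realization[OF z(1)] by blast
  obtain H' where H': "coded_path E R H'" "\<And>n. z' n = symb (H' n)" "coded_path.G E R H' = dec z'"
    using trans_path_realization[OF z(2)] by blast
  interpret P: coded_path E R H by (rule H(1))
  interpret P': coded_path E R H' by (rule H'(1))
  obtain \<xi> where \<xi>: "\<xi> \<in> H n" "\<And>k. \<bar>k\<bar> \<le> 1 \<Longrightarrow> x (n + k) = \<xi> k"
    using P.G_local_0 x(1) H(3) by metis
  obtain \<xi>' where \<xi>': "\<xi>' \<in> H' n" "\<And>k. \<bar>k\<bar> \<le> 1 \<Longrightarrow> x' (n + k) = \<xi>' k"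
    using P'.G_local_0 x(2) H'(3) by metis
  have "core_eq (H' n) (H n)" using eq H(2) H'(2) symb_eq_iff[OF P'.fib_H P.fib_H] by metis
  then have "seg (-1) 1 ` H' n = seg (-1) 1 ` H n"
    by (rule core_eq_seg) (use P'.hw_H P'.N_pos in auto)
  then obtain \<zeta> where \<zeta>: "\<zeta> \<in> H n" "\<And>k. - 1 \<le> k \<Longrightarrow> k \<le> 1 \<Longrightarrow> \<zeta> k = \<xi>' k"
    using seg_image_eqD[OF _ \<xi>'(1)] by metis
  have "\<zeta> 0 = \<xi> 0" using \<zeta>(2)[of 0] \<xi>(2)[of 0] \<xi>'(2)[of 0] x(3) by simp
  then have "\<zeta> = \<xi>" using P.noncolliding_H \<zeta>(1) \<xi>(1) by blast
  then show ?thesis using \<zeta>(2)[of j] \<xi>(2)[of j] \<xi>'(2)[of j] j by auto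
qed

text \<open>Every letter shown at time 0 by the symbol belongs to a member of the decoded fiber
  (\<open>G_extend\<close>), so the least letter depends on the symbol at time 0 only.\<close>

lemma dec_letters_0:
  assumes z: "z \<in> edge_paths trans" "z' \<in> edge_paths trans" and eq: "z 0 = z' 0"
  shows "(\<lambda>x. x 0) ` dec z \<subseteq> (\<lambda>x. x 0) ` dec z'"
proof
  fix a assume "a \<in> (\<lambda>x. x 0) ` dec z"
  then obtain x where x: "x \<in> dec z" "a = x 0" by blast
  obtain H where H: "coded_path E R H" "\<And>n. z n = symb (H n)" "coded_path.G E R H = dec z"
    using trans_path_realization[OF z(1)] by blast
  obtain H' where H': "coded_path E R H'" "\<And>n. z' n = symb (H' n)" "coded_path.G E R H' = dec z'"
    using trans_path_realization[OF z(2)] by blast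
  interpret P: coded_path E R H by (rule H(1))
  interpret P': coded_path E R H' by (rule H'(1))
  have "\<exists>\<xi>\<in>H 0. \<forall>k. \<bar>k\<bar> \<le> 1 \<longrightarrow> x (0 + k) = \<xi> k"
    using P.G_local_0[of x 0] x(1) H(3) by metis
  then obtain \<xi> where \<xi>: "\<xi> \<in> H 0" "x 0 = \<xi> 0" by force
  have "core_eq (H 0) (H' 0)" using eq H(2) H'(2) symb_eq_iff[OF P.fib_H P'.fib_H] by metis
  then have "(\<lambda>x. x 0) ` H 0 = (\<lambda>x. x 0) ` H' 0"
    using core_eq_letters[OF P.good_H P'.good_H] by simp
  then have "\<xi> 0 \<in> (\<lambda>x. x 0) ` H' 0" using \<xi>(1) by blast
  then obtain \<xi>' where \<xi>': "\<xi>' \<in> H' 0" "\<xi>' 0 = x 0" using \<xi>(2) by auto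
  obtain x' where x': "x' \<in> P'.G" "\<And>k. - int (prv_mark (H' 0)) - int P'.N \<le> k \<Longrightarrow>
      k \<le> int (nxt_mark (H' 0)) + int P'.N \<Longrightarrow> x' (0 + k) = \<xi>' k"
    using P'.G_extend[OF \<xi>'(1)] by blast
  have "x' 0 = \<xi>' 0" using x'(2)[of 0] by simp
  then show "a \<in> (\<lambda>x. x 0) ` dec z'" using x' x(2) \<xi>'(2) H'(3) by (auto intro!: image_eqI[of _ _ x'])
qed

lemma least_lift_agree:
  assumes z: "z \<in> edge_paths trans" "z' \<in> edge_paths trans" and agree: "agree_upto n z z'"
  shows "agree_upto n (least_lift z) (least_lift z')"
proof -
  have eq: "z k = z' k" if "\<bar>k\<bar> \<le> int n" for k using agree that by (simp add: agree_upto_def)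
  have "(\<lambda>x. x 0) ` dec z = (\<lambda>x. x 0) ` dec z'"
    using dec_letters_0 z eq[of 0] by (simp add: equalityI)
  then have start: "least_lift z 0 = least_lift z' 0" using least_lift_0 z by simp
  note step = dec_letter_step[OF z _ least_lift_mem[OF z(1)] least_lift_mem[OF z(2)]]
  have pos: "i \<le> n \<Longrightarrow> least_lift z (int i) = least_lift z' (int i)" for i
  proof (induction i)
    case (Suc i)
    then show ?case using step[of "int i" 1] eq[of "int i"] by (simp add: add.commute)
  qed (use start in simp)
  have neg: "i \<le> n \<Longrightarrow> least_lift z (- int i) = least_lift z' (- int i)" for i
  proof (induction i)
    case (Suc i)
    have e: "- int (Suc i) = - int i + - 1" by simp
    have "least_lift z (- int i) = least_lift z' (- int i)" "z (- int i) = z' (- int i)"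
      using Suc eq[of "- int i"] by simp_all
    then show ?case unfolding e by (intro step) simp_all
  qed (use start in simp)
  show ?thesis unfolding agree_upto_def
  proof (intro allI impI)
    fix k assume "\<bar>k\<bar> \<le> int n"
    then show "least_lift z k = least_lift z' k"
      using pos[of "nat k"] neg[of "nat (- k)"] by (cases "0 \<le> k") auto
  qed
qed

end

section \<open>Measurability and recurrence\<close>

text \<open>\<open>Q n y\<close> stands for an event observed at time n along the orbit of
  \<open>y\<close>; equivariance turns time translation into the action of \<open>T\<close>.\<close>

locale equivariant_family = prob_space +
  fixes T :: "'a \<Rightarrow> 'a" and Q :: "int \<Rightarrow> 'a \<Rightarrow> bool"
  assumes T_measurable: "T \<in> measurable M M" and T_invariant: "distr M M T = M"
    and Q_sets: "\<And>n. {y \<in> space M. Q n y} \<in> events"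
    and Q_equivariant: "\<And>n y. y \<in> space M \<Longrightarrow> Q (n + 1) y \<longleftrightarrow> Q n (T y)"
begin

lemma prob_step: "prob {y \<in> space M. Q (n + 1) y} = prob {y \<in> space M. Q n y}"
proof -
  have "prob {y \<in> space M. Q n y} = measure (distr M M T) {y \<in> space M. Q n y}"
    by (simp add: T_invariant)
  also have "\<dots> = prob (T -` {y \<in> space M. Q n y} \<inter> space M)"
    using T_measurable Q_sets by (rule measure_distr)
  also have "T -` {y \<in> space M. Q n y} \<inter> space M = {y \<in> space M. Q (n + 1) y}"
    using measurable_space[OF T_measurable] Q_equivariant by auto
  finally show ?thesis by simp
qed

lemma prob_const: "prob {y \<in> space M. Q n y} = prob {y \<in> space M. Q 0 y}"
proof (induction n rule: int_induct[of _ 0])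
  case (step1 i)
  then show ?case using prob_step[of i] by simp
next
  case (step2 i)
  then show ?case using prob_step[of "i - 1"] by simp
qed simp

text \<open>Invariance gives the k mutually exclusive events equal probabilities, with sum at most
  1.\<close>

lemma prob_le_of_disjoint:
  assumes disj: "\<And>i j y. i < k \<Longrightarrow> j < k \<Longrightarrow> i \<noteq> j \<Longrightarrow> \<not> (Q (int i) y \<and> Q (int j) y)"
  shows "real k * prob {y \<in> space M. Q n y} \<le> 1"
proof -
  let ?A = "\<lambda>i. {y \<in> space M. Q (int i) y}"
  have "prob (\<Union>i\<in>{..<k}. ?A i) = (\<Sum>i\<in>{..<k}. prob (?A i))"
    by (rule finite_measure_finite_Union) (use disj Q_sets in \<open>auto simp: disjoint_family_on_def\<close>)
  also have "\<dots> = real k * prob {y \<in> space M. Q n y}"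
    by (simp add: prob_const[of "int _"] prob_const[of n])
  finally show ?thesis using prob_le_1[of "\<Union>i\<in>{..<k}. ?A i"] by simp
qed

lemma AE_not_of_disjoint:
  assumes disj: "\<And>i j y. i \<noteq> j \<Longrightarrow> \<not> (Q i y \<and> Q j y)"
  shows "AE y in M. \<forall>n. \<not> Q n y"
proof -
  have "prob {y \<in> space M. Q n y} = 0" for n
  proof (rule ccontr)
    assume "prob {y \<in> space M. Q n y} \<noteq> 0"
    then have pos: "0 < prob {y \<in> space M. Q n y}" by (simp add: zero_less_measure_iff)
    then obtain k where "1 < real k * prob {y \<in> space M. Q n y}"
      using reals_Archimedean3 by blast
    moreover have "real k * prob {y \<in> space M. Q n y} \<le> 1"
      by (intro prob_le_of_disjoint disj) simp
    ultimately show False by linarith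
  qed
  then have "AE y in M. \<not> Q n y" for n
    using Q_sets by (intro AE_I[of _ _ "{y \<in> space M. Q n y}"]) (simp_all add: emeasure_eq_measure)
  then show ?thesis by (simp add: AE_all_countable)
qed

text \<open>Poincare recurrence: being the last occurrence excludes itself at two different times,
  so this event is null; the same holds for first occurrences.\<close>

lemma
  shows recurrence_future: "AE y in M. \<forall>n. Q n y \<longrightarrow> (\<exists>m>n. Q m y)"
    and recurrence_past: "AE y in M. \<forall>n. Q n y \<longrightarrow> (\<exists>m<n. Q m y)"
proof -
  have [measurable]: "Measurable.pred M (Q n)" for n using Q_sets by (simp add: pred_def)
  interpret F: equivariant_family M T "\<lambda>n y. Q n y \<and> (\<forall>k. \<not> Q (n + 1 + int k) y)"
  proof unfold_locales
    show "{y \<in> space M. Q n y \<and> (\<forall>k. \<not> Q (n + 1 + int k) y)} \<in> events" for n by measurable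
    fix n y assume y: "y \<in> space M"
    have "Q (n + 1 + 1 + int k) y = Q (n + 1 + int k) (T y)" for k
      using Q_equivariant[OF y, of "n + 1 + int k"] by (simp add: add_ac)
    then show "(Q (n + 1) y \<and> (\<forall>k. \<not> Q (n + 1 + 1 + int k) y)) = (Q n (T y) \<and> (\<forall>k. \<not> Q (n + 1 + int k) (T y)))"
      using Q_equivariant[OF y, of n] by simp
  qed (use T_measurable T_invariant in auto)
  have "AE y in M. \<forall>n. \<not> (Q n y \<and> (\<forall>k. \<not> Q (n + 1 + int k) y))"
  proof (rule F.AE_not_of_disjoint)
    have less: "\<not> ((\<forall>k. \<not> Q (i + 1 + int k) y) \<and> Q j y)" if "i < j" for i j y
    proof -
      have "j = i + 1 + int (nat (j - i - 1))" using that by simp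
      then show ?thesis by metis
    qed
    show "\<not> ((Q i y \<and> (\<forall>k. \<not> Q (i + 1 + int k) y)) \<and> Q j y \<and> (\<forall>k. \<not> Q (j + 1 + int k) y))"
      if "i \<noteq> j" for i j y
    proof (cases "i < j")
      case True
      then show ?thesis using less[of i j y] by blast
    next
      case False
      then show ?thesis using less[of j i y] that by fastforce
    qed
  qed
  then show "AE y in M. \<forall>n. Q n y \<longrightarrow> (\<exists>m>n. Q m y)"
  proof (eventually_elim, intro allI impI)
    fix y n assume *: "\<forall>n. \<not> (Q n y \<and> (\<forall>k. \<not> Q (n + 1 + int k) y))" "Q n y"
    then obtain k where "Q (n + 1 + int k) y" by blast
    then show "\<exists>m>n. Q m y" by (intro exI[of _ "n + 1 + int k"]) simp
  qed
  interpret B: equivariant_family M T "\<lambda>n y. Q n y \<and> (\<forall>k. \<not> Q (n - 1 - int k) y)"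
  proof unfold_locales
    show "{y \<in> space M. Q n y \<and> (\<forall>k. \<not> Q (n - 1 - int k) y)} \<in> events" for n by measurable
    fix n y assume y: "y \<in> space M"
    have "Q (n + 1 - 1 - int k) y = Q (n - 1 - int k) (T y)" for k
      using Q_equivariant[OF y, of "n - 1 - int k"] by (simp add: algebra_simps)
    then show "(Q (n + 1) y \<and> (\<forall>k. \<not> Q (n + 1 - 1 - int k) y)) = (Q n (T y) \<and> (\<forall>k. \<not> Q (n - 1 - int k) (T y)))"
      using Q_equivariant[OF y, of n] by (simp only:)
  qed (use T_measurable T_invariant in auto)
  have "AE y in M. \<forall>n. \<not> (Q n y \<and> (\<forall>k. \<not> Q (n - 1 - int k) y))"
  proof (rule B.AE_not_of_disjoint)
    have less: "\<not> (Q i y \<and> (\<forall>k. \<not> Q (j - 1 - int k) y))" if "i < j" for i j y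
    proof -
      have "i = j - 1 - int (nat (j - i - 1))" using that by simp
      then show ?thesis by metis
    qed
    show "\<not> ((Q i y \<and> (\<forall>k. \<not> Q (i - 1 - int k) y)) \<and> Q j y \<and> (\<forall>k. \<not> Q (j - 1 - int k) y))"
      if "i \<noteq> j" for i j y
    proof (cases "i < j")
      case True
      then show ?thesis using less[of i j y] by blast
    next
      case False
      then show ?thesis using less[of j i y] that by fastforce
    qed
  qed
  then show "AE y in M. \<forall>n. Q n y \<longrightarrow> (\<exists>m<n. Q m y)"
  proof (eventually_elim, intro allI impI)
    fix y n assume *: "\<forall>n. \<not> (Q n y \<and> (\<forall>k. \<not> Q (n - 1 - int k) y))" "Q n y"
    then obtain k where "Q (n - 1 - int k) y" by blast
    then show "\<exists>m<n. Q m y" by (intro exI[of _ "n - 1 - int k"]) simp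
  qed
qed

end

lemma int_unbounded_above:
  assumes "P n0" "\<And>n::int. P n \<Longrightarrow> \<exists>m>n. P m"
  shows "\<exists>n\<ge>m. P n"
proof -
  have "\<exists>n\<ge>n0 + int k. P n" for k
  proof (induction k)
    case (Suc k)
    then obtain n where "n \<ge> n0 + int k" "P n" by blast
    moreover from assms(2)[OF this(2)] obtain m where "m > n" "P m" by blast
    ultimately show ?case by (intro exI[of _ m]) auto
  qed (use assms(1) in auto)
  from this[of "nat (m - n0)"] obtain n where "n \<ge> n0 + int (nat (m - n0))" "P n" by blast
  then show ?thesis by (intro exI[of _ n] conjI) linarith+
qed

lemma int_unbounded_below:
  assumes "P n0" "\<And>n::int. P n \<Longrightarrow> \<exists>m<n. P m"
  shows "\<exists>n\<le>m. P n"
proof -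
  have "\<exists>n\<ge>- m. P (- n)"
  proof (rule int_unbounded_above[of _ "- n0"])
    fix n assume "P (- n)"
    then obtain l where "l < - n" "P l" using assms(2) by blast
    then show "\<exists>m>n. P (- m)" by (intro exI[of _ "- l"]) auto
  qed (use assms(1) in simp)
  then obtain n where "n \<ge> - m" "P (- n)" by blast
  then show ?thesis by (intro exI[of _ "- n"]) auto
qed

text \<open>In the constant, |n| accounts for the change of base time and the sum for the finitely
  many times before \<open>k0\<close>.\<close>

lemma linear_tail_bound:
  fixes c :: "int \<Rightarrow> nat"
  assumes "\<And>k. k \<ge> k0 \<Longrightarrow> c (int k) \<le> k"
  shows "\<exists>v. \<forall>k. c (n + int k) \<le> v + k"
proof (intro exI allI)
  fix k
  show "c (n + int k) \<le> nat \<bar>n\<bar> + (\<Sum>m\<in>{n..int k0}. c m) + k"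
  proof (cases "int k0 \<le> n + int k")
    case True
    then have "c (int (nat (n + int k))) \<le> nat (n + int k)" by (intro assms) simp
    then have "c (n + int k) \<le> nat (n + int k)" using True by simp
    also have "\<dots> \<le> nat \<bar>n\<bar> + k" by linarith
    finally show ?thesis by linarith
  next
    case False
    then have "c (n + int k) \<le> (\<Sum>m\<in>{n..int k0}. c m)" by (intro member_le_sum[of _ _ c]) simp_all
    then show ?thesis by linarith
  qed
qed

section \<open>Borel measurability of fiber data\<close>

lemma open_finite_window:
  fixes P :: "(int \<Rightarrow> nat) \<Rightarrow> bool"
  assumes "\<And>x. P x \<Longrightarrow> \<exists>k. \<forall>y. agree_upto k x y \<longrightarrow> P y"
  shows "open {x. P x}"
proof (subst open_subopen, intro ballI)
  fix x assume "x \<in> {x. P x}"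
  then obtain k where k: "\<forall>y. agree_upto k x y \<longrightarrow> P y" using assms by blast
  have "open {y. \<forall>i\<in>{- int k..int k}. y (id i) \<in> {x i}}"
    by (rule product_topology_basis') (auto intro: Topological_Spaces.open_discrete)
  moreover have "y \<in> {x. P x}" if "y \<in> {y. \<forall>i\<in>{- int k..int k}. y (id i) \<in> {x i}}" for y
  proof -
    have "agree_upto k x y" using that by (auto simp: agree_upto_def abs_le_iff)
    then show ?thesis using k by simp
  qed
  ultimately show "\<exists>S. open S \<and> x \<in> S \<and> S \<subseteq> {x. P x}"
    by (intro exI[of _ "{y. \<forall>i\<in>{- int k..int k}. y (id i) \<in> {x i}}"]) auto
qed

lemma sequence_coordinate_measurable:
  "(\<lambda>x::int \<Rightarrow> nat. x n) \<in> measurable borel (count_space UNIV)"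
  unfolding measurable_count_space_eq2_countable
proof (intro conjI ballI)
  fix a
  have "open {x::int \<Rightarrow> nat. x n = a}"
    by (rule open_finite_window) (auto simp: agree_upto_def intro!: exI[of _ "nat \<bar>n\<bar>"])
  then show "(\<lambda>x. x n) -` {a} \<inter> space borel \<in> sets borel" by (auto simp: vimage_def)
qed auto

lemma (in coded_shift) Reg_sets: "Reg \<in> sets borel"
proof -
  note [measurable] = sequence_coordinate_measurable
  have "{x \<in> space (borel :: (int \<Rightarrow> nat) measure). (\<forall>n. (x n, x (n + 1)) \<in> E) \<and>
      (\<exists>u. \<forall>m. \<exists>n. n \<le> m \<and> x n = u) \<and> (\<exists>v. \<forall>m. \<exists>n. m \<le> n \<and> x n = v)} \<in> sets borel"
    by measurable
  moreover have "Reg = {x \<in> space (borel :: (int \<Rightarrow> nat) measure). (\<forall>n. (x n, x (n + 1)) \<in> E) \<and>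
      (\<exists>u. \<forall>m. \<exists>n. n \<le> m \<and> x n = u) \<and> (\<exists>v. \<forall>m. \<exists>n. m \<le> n \<and> x n = v)}"
    by (simp add: set_eq_iff Reg_iff edge_paths_def)
  ultimately show ?thesis by simp
qed

text \<open>\<open>U\<close> is a countable separating family; membership in its sets codes the
  points of \<open>Y\<close> by 0-1 sequences.\<close>

locale coded_factor = coded_shift +
  fixes Y :: "'y measure" and T :: "'y \<Rightarrow> 'y" and p :: "(int \<Rightarrow> nat) \<Rightarrow> 'y" and U :: "nat \<Rightarrow> 'y set"
  assumes p_space: "\<And>x. x \<in> Reg \<Longrightarrow> p x \<in> space Y"
    and p_shift: "\<And>x. x \<in> Reg \<Longrightarrow> p (shift_by 1 x) = T (p x)"
    and p_eq: "\<And>x y. x \<in> Reg \<Longrightarrow> y \<in> Reg \<Longrightarrow> p x = p y \<longleftrightarrow> (\<forall>n. (x n, y n) \<in> R)"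
    and p_measurable: "p \<in> measurable (restrict_space borel Reg) Y"
    and T_inj: "inj_on T (space Y)" and T_measurable: "T \<in> measurable Y Y"
    and U_sets: "\<And>n. U n \<in> sets Y"
    and U_separating: "\<And>y y'. y \<in> space Y \<Longrightarrow> y' \<in> space Y \<Longrightarrow> (\<And>n. y \<in> U n \<longleftrightarrow> y' \<in> U n) \<Longrightarrow> y = y'"
begin

definition fib :: "'y \<Rightarrow> (int \<Rightarrow> nat) set" where
  "fib y = {x \<in> Reg. p x = y}"

definition Yr :: "'y set" where "Yr = p ` Reg"

lemma fib_p: "x \<in> Reg \<Longrightarrow> fib (p x) = cls x"
proof (intro equalityI subsetI)
  fix y assume x: "x \<in> Reg"
  show "y \<in> cls x" if "y \<in> fib (p x)"
    using that p_eq[of y x] x Reg_path by (simp add: fib_def cls_def)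
  show "y \<in> fib (p x)" if "y \<in> cls x"
    using that cls_Reg[OF x that] p_eq[of y x] x by (simp add: fib_def cls_def)
qed

lemma is_fib_fib: "y \<in> Yr \<Longrightarrow> is_fib (fib y)"
  unfolding Yr_def by (auto simp: fib_p is_fib_cls)

lemma p_mem_fib: "x \<in> F \<Longrightarrow> is_fib F \<Longrightarrow> fib (p x) = F"
proof -
  assume x: "x \<in> F" and F: "is_fib F"
  have "fib (p x) = cls x" by (rule fib_p[OF fib_Reg[OF F x]])
  also have "\<dots> = F" using fib_eq_cls[OF F x] by (rule sym)
  finally show ?thesis .
qed

lemma Yr_space: "Yr \<subseteq> space Y"
  unfolding Yr_def using p_space by blast

lemma T_Yr_iff: "y \<in> space Y \<Longrightarrow> T y \<in> Yr \<longleftrightarrow> y \<in> Yr"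
  and fib_T: "y \<in> Yr \<Longrightarrow> fib (T y) = shift_by 1 ` fib y"
proof -
  show "T y \<in> Yr \<longleftrightarrow> y \<in> Yr" if y: "y \<in> space Y"
  proof
    assume "T y \<in> Yr"
    then obtain x where x: "x \<in> Reg" "T y = p x" unfolding Yr_def by blast
    have x': "shift_by (-1) x \<in> Reg" using x(1) by simp
    then have "T (p (shift_by (-1) x)) = p x" using p_shift[OF x'] by simp
    then have "y = p (shift_by (-1) x)" using x(2) by (intro inj_onD[OF T_inj _ y p_space[OF x']]) simp
    then show "y \<in> Yr" using x' unfolding Yr_def by blast
  next
    assume "y \<in> Yr"
    then obtain x where x: "x \<in> Reg" "y = p x" unfolding Yr_def by blast
    then have "T y = p (shift_by 1 x)" "shift_by 1 x \<in> Reg" using p_shift by auto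
    then show "T y \<in> Yr" unfolding Yr_def by blast
  qed
  show "fib (T y) = shift_by 1 ` fib y" if y: "y \<in> Yr"
  proof -
    obtain x where x: "x \<in> Reg" "y = p x" using y unfolding Yr_def by blast
    have "fib (T y) = cls (shift_by 1 x)" using fib_p[of "shift_by 1 x"] p_shift x by simp
    also have "\<dots> = shift_by 1 ` fib y" using fib_p[OF x(1)] x(2) cls_shift_by by simp
    finally show ?thesis .
  qed
qed

text \<open>Compactness trades the existence of an infinite path for countably many conditions on
  finite windows. Each is open in \<open>x\<close>, so their intersection is Borel and not merely
  analytic.\<close>

lemma seg_mem_cls_iff:
  "w \<in> seg a b ` cls x \<longleftrightarrow> (\<forall>k. \<exists>s. (\<forall>m. \<bar>m\<bar> < int k \<longrightarrow> (s m, s (m + 1)) \<in> E) \<and>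
     (\<forall>m. \<bar>m\<bar> \<le> int k \<longrightarrow> (s m, x m) \<in> R) \<and> seg a b s = w)"
proof
  assume "w \<in> seg a b ` cls x"
  then obtain s where "s \<in> edge_paths E" "\<And>n. (s n, x n) \<in> R" "seg a b s = w" by (auto simp: cls_def)
  then show "\<forall>k. \<exists>s. (\<forall>m. \<bar>m\<bar> < int k \<longrightarrow> (s m, s (m + 1)) \<in> E) \<and>
     (\<forall>m. \<bar>m\<bar> \<le> int k \<longrightarrow> (s m, x m) \<in> R) \<and> seg a b s = w" by (auto simp: edge_paths_def)
next
  assume "\<forall>k. \<exists>s. (\<forall>m. \<bar>m\<bar> < int k \<longrightarrow> (s m, s (m + 1)) \<in> E) \<and>
     (\<forall>m. \<bar>m\<bar> \<le> int k \<longrightarrow> (s m, x m) \<in> R) \<and> seg a b s = w"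
  then obtain s where s: "\<And>k m. \<bar>m\<bar> < int k \<Longrightarrow> (s k m, s k (m + 1)) \<in> E"
     "\<And>k m. \<bar>m\<bar> \<le> int k \<Longrightarrow> (s k m, x m) \<in> R" "\<And>k. seg a b (s k) = w" by metis
  obtain l r where l: "l \<in> cls x" "\<And>n. \<forall>\<^sub>F k in sequentially. s (r k) n = l n"
    using related_words_limit[of s x] s(1,2) by metis
  have "\<forall>\<^sub>F k in sequentially. \<forall>n\<in>{a..b}. s (r k) n = l n"
    using l(2) by (intro eventually_ball_finite) auto
  then obtain k where "\<forall>n\<in>{a..b}. s (r k) n = l n" by (auto dest: eventually_happens)
  then have "seg a b l = seg a b (s (r k))" by (auto simp: seg_eq_iff)
  then show "w \<in> seg a b ` cls x" using l(1) s(3) by auto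
qed

lemma seg_mem_cls_sets: "{x \<in> Reg. w \<in> seg a b ` cls x} \<in> sets borel"
proof -
  define A where "A k = {x. \<exists>s. (\<forall>m. \<bar>m\<bar> < int k \<longrightarrow> (s m, s (m + 1)) \<in> E) \<and>
     (\<forall>m. \<bar>m\<bar> \<le> int k \<longrightarrow> (s m, x m) \<in> R) \<and> seg a b s = w}" for k
  have "open (A k)" for k
    unfolding A_def
  proof (rule open_finite_window)
    fix x assume *: "\<exists>s. (\<forall>m. \<bar>m\<bar> < int k \<longrightarrow> (s m, s (m + 1)) \<in> E) \<and>
     (\<forall>m. \<bar>m\<bar> \<le> int k \<longrightarrow> (s m, x m) \<in> R) \<and> seg a b s = w"
    show "\<exists>k'. \<forall>y. agree_upto k' x y \<longrightarrow> (\<exists>s. (\<forall>m. \<bar>m\<bar> < int k \<longrightarrow> (s m, s (m + 1)) \<in> E) \<and>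
     (\<forall>m. \<bar>m\<bar> \<le> int k \<longrightarrow> (s m, y m) \<in> R) \<and> seg a b s = w)"
      using * by (intro exI[of _ k]) (auto simp: agree_upto_def)
  qed
  then have "Reg \<inter> (\<Inter>k. A k) \<in> sets borel"
    using Reg_sets by (intro sets.Int sets.countable_INT) auto
  also have "Reg \<inter> (\<Inter>k. A k) = {x \<in> Reg. w \<in> seg a b ` cls x}"
    unfolding A_def seg_mem_cls_iff by auto
  finally show ?thesis .
qed

end

locale coded_factor_measurable = coded_factor +
  assumes Yr_sets: "Yr \<in> sets Y"
begin

text \<open>The occurrence of \<open>w\<close> depends on the fiber only, so the set
  \<open>?B\<close> and its complement in \<open>Reg\<close> have disjoint images; a measurable set
  separating these cuts the image of \<open>?B\<close> out of \<open>Yr\<close>.\<close>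

lemma seg_mem_fib_sets: "{y \<in> Yr. w \<in> seg a b ` fib y} \<in> sets Y"
proof -
  let ?B = "{x \<in> Reg. w \<in> seg a b ` cls x}"
  have disj: "p ` ?B \<inter> p ` (Reg - ?B) = {}"
  proof (rule ccontr)
    assume "p ` ?B \<inter> p ` (Reg - ?B) \<noteq> {}"
    then obtain x x' where "x \<in> ?B" "x' \<in> Reg - ?B" "p x = p x'" by auto
    then show False using fib_p[of x] fib_p[of x'] by auto
  qed
  obtain D where D: "D \<in> sets Y" "p ` ?B \<subseteq> D" "D \<inter> p ` (Reg - ?B) = {}"
  proof (rule borel_image_separation[OF Reg_sets p_measurable, where U = U and B = ?B and C = "Reg - ?B"])
    show "U n \<in> sets Y" for n by (rule U_sets)
    show "y = y'" if "y \<in> space Y" "y' \<in> space Y" "\<And>n. y \<in> U n \<longleftrightarrow> y' \<in> U n" for y y'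
      using that by (rule U_separating)
    show "?B \<in> sets borel" "Reg - ?B \<in> sets borel"
      using seg_mem_cls_sets Reg_sets by (auto intro: sets.Diff)
    show "p ` ?B \<inter> p ` (Reg - ?B) = {}" by (rule disj)
  qed auto
  have "{y \<in> Yr. w \<in> seg a b ` fib y} = p ` ?B"
    unfolding Yr_def using fib_p by auto
  also have "\<dots> = Yr \<inter> D" using D(2,3) unfolding Yr_def by blast
  finally show ?thesis using D(1) Yr_sets by simp
qed

definition YM where "YM = restrict_space Y Yr"

lemma space_YM: "space YM = Yr"
  unfolding YM_def space_restrict_space using Yr_space by blast

lemma pred_YM_iff: "Measurable.pred YM P \<longleftrightarrow> {y \<in> Yr. P y} \<in> sets Y"
proof -
  have "Yr \<inter> space Y \<in> sets Y" using Yr_sets by simp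
  then show ?thesis
    unfolding pred_def space_YM unfolding YM_def by (subst sets_restrict_space_iff) auto
qed

text \<open>The words of a fiber on a fixed window form a finite set, and there are countably many
  such sets; through \<open>enc\<close>, an arbitrary \<open>h\<close> becomes a function of a
  natural number.\<close>

lemma seg_fib_measurable [measurable]: "(\<lambda>y. h (seg a b ` fib y)) \<in> measurable YM (count_space UNIV)"
proof -
  have mem [measurable]: "Measurable.pred YM (\<lambda>y. w \<in> seg a b ` fib y)" for w
    unfolding pred_YM_iff by (rule seg_mem_fib_sets)
  have eq: "Measurable.pred YM (\<lambda>y. seg a b ` fib y = V)" for V
    unfolding set_eq_iff by measurable
  have fin: "finite (seg a b ` fib y)" if "y \<in> Yr" for y using fib_finite[OF is_fib_fib[OF that]] by blast
  have "(\<lambda>y. enc (seg a b ` fib y)) \<in> measurable YM (count_space UNIV)"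
    unfolding measurable_count_space_eq2_countable
  proof (intro conjI ballI)
    fix k
    show "(\<lambda>y. enc (seg a b ` fib y)) -` {k} \<inter> space YM \<in> sets YM"
    proof (cases "\<exists>V. finite V \<and> enc V = k")
      case True
      then obtain V where V: "finite V" "enc V = k" by blast
      have "(\<lambda>y. enc (seg a b ` fib y)) -` {k} \<inter> space YM = {y \<in> space YM. seg a b ` fib y = V}"
        using V enc_inj[OF fin V(1)] by (auto simp: space_YM)
      then show ?thesis using eq[of V] unfolding pred_def by simp
    next
      case False
      then have "(\<lambda>y. enc (seg a b ` fib y)) -` {k} \<inter> space YM = {}" using fin by (auto simp: space_YM)
      then show ?thesis by simp
    qed
  qed auto
  then have "(\<lambda>y. h (from_nat_into {V. finite V} (enc (seg a b ` fib y)))) \<in> measurable YM (count_space UNIV)"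
    by (rule measurable_compose) simp
  moreover have "from_nat_into {V. finite V} (enc (seg a b ` fib y)) = seg a b ` fib y" if "y \<in> Yr" for y
    unfolding enc_def using fin[OF that] countable_Collect_finite by (intro from_nat_into_to_nat_on) auto
  ultimately show ?thesis
    by (subst measurable_cong[where g = "\<lambda>y. h (from_nat_into {V. finite V} (enc (seg a b ` fib y)))"])
      (auto simp: space_YM)
qed

lemma hw_fib_measurable [measurable]: "(\<lambda>y. hw (fib y)) \<in> measurable YM (count_space UNIV)"
  unfolding hw_def by measurable

lemma key_fib_measurable [measurable]: "(\<lambda>y. key (fib y)) \<in> measurable YM (count_space UNIV)"
proof -
  \<comment> \<open>The half-width varies with the fiber, so it is quantified as a constant
    \<open>N\<close> before a window of that size is inspected.\<close>
  have "key F = (LEAST k. \<exists>n N. hw F = N \<and> (magic N (win N n F) \<and> enc (win N n F) = k))" for F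
    unfolding key_def by simp
  then show ?thesis by (simp only:) measurable
qed

lemma mark_fib_measurable [measurable]: "Measurable.pred YM (\<lambda>y. mark (fib y) n)"
proof -
  have "mark F n \<longleftrightarrow> (\<exists>N k. hw F = N \<and> key F = k \<and> (magic N (win N n F) \<and> enc (win N n F) = k))" for F
    unfolding mark_def by simp
  then show ?thesis by (simp only:) measurable
qed

lemma prv_fib_measurable [measurable]:
  "(\<lambda>y. prv_mark (shift_by n ` fib y)) \<in> measurable YM (count_space UNIV)"
  unfolding prv_mark_def mark_shift_by by measurable

lemma nxt_fib_measurable [measurable]:
  "(\<lambda>y. nxt_mark (shift_by n ` fib y)) \<in> measurable YM (count_space UNIV)"
  unfolding nxt_mark_def mark_shift_by by measurable

lemma lst_fib_measurable [measurable]: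
  "(\<lambda>y. lst_mark (shift_by n ` fib y)) \<in> measurable YM (count_space UNIV)"
  unfolding lst_mark_def mark_shift_by by measurable

lemma gap_next_fib_measurable [measurable]:
  "(\<lambda>y. gap_next (shift_by n ` fib y)) \<in> measurable YM (count_space UNIV)"
  unfolding gap_next_def mark_shift_by by measurable

lemma gap_last_fib_measurable [measurable]:
  "(\<lambda>y. gap_last (shift_by n ` fib y)) \<in> measurable YM (count_space UNIV)"
  unfolding gap_last_def mark_shift_by by measurable

lemma fwd_env_fib_measurable [measurable]:
  "(\<lambda>y. fwd_env (shift_by n ` fib y)) \<in> measurable YM (count_space UNIV)"
  unfolding fwd_env_def shift_by_image_add by measurable

lemma bwd_env_fib_measurable [measurable]:
  "(\<lambda>y. bwd_env (shift_by n ` fib y)) \<in> measurable YM (count_space UNIV)"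
  unfolding bwd_env_def shift_by_image_add by measurable

lemma symb_fib_measurable [measurable]:
  "Measurable.pred YM (\<lambda>y. symb (shift_by n ` fib y) = s)"
proof -
  have "symb (shift_by n ` F) = s \<longleftrightarrow> (\<exists>N k i j f b. to_nat (N, k, enc (seg (- int i - int N + n) (int j + int N + n) ` F), i, j, f, b) = s
      \<and> hw F = N \<and> key F = k \<and> prv_mark (shift_by n ` F) = i \<and> nxt_mark (shift_by n ` F) = j
      \<and> fwd_env (shift_by n ` F) = f \<and> bwd_env (shift_by n ` F) = b)" for F
    unfolding symb_def blk_def seg_shift_by_image by auto
  then show ?thesis by (simp only:) measurable
qed

lemma noncolliding_iff_windows:
  "noncolliding F \<longleftrightarrow> (\<forall>n k. \<forall>w\<in>seg (n - int k) (n + int k) ` F. \<forall>w'\<in>seg (n - int k) (n + int k) ` F.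
     w ! k = w' ! k \<longrightarrow> w = w')"
proof -
  have nth: "seg (n - int k) (n + int k) x ! k = x n" for n k and x :: "int \<Rightarrow> nat"
    using seg_nth[of "n - int k" n "n + int k" x] by simp
  have eqI: "x = y" if *: "\<And>k. seg (n - int k) (n + int k) x = seg (n - int k) (n + int k) y"
    for x y :: "int \<Rightarrow> nat" and n
  proof
    fix m
    have "seg (n - \<bar>m - n\<bar>) (n + \<bar>m - n\<bar>) x = seg (n - \<bar>m - n\<bar>) (n + \<bar>m - n\<bar>) y"
      using *[of "nat \<bar>m - n\<bar>"] by simp
    moreover have "n - \<bar>m - n\<bar> \<le> m" "m \<le> n + \<bar>m - n\<bar>" by linarith+
    ultimately show "x m = y m" unfolding seg_eq_iff by blast
  qed
  show ?thesis
  proof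
    assume "noncolliding F"
    then show "\<forall>n k. \<forall>w\<in>seg (n - int k) (n + int k) ` F. \<forall>w'\<in>seg (n - int k) (n + int k) ` F.
      w ! k = w' ! k \<longrightarrow> w = w'" unfolding noncolliding_def by (auto simp: nth)
  next
    assume *: "\<forall>n k. \<forall>w\<in>seg (n - int k) (n + int k) ` F. \<forall>w'\<in>seg (n - int k) (n + int k) ` F.
      w ! k = w' ! k \<longrightarrow> w = w'"
    show "noncolliding F" unfolding noncolliding_def
    proof (intro ballI allI impI)
      fix x y n assume "x \<in> F" "y \<in> F" "x n = y n"
      then show "x = y" using * by (intro eqI[of n]) (metis imageI nth)
    qed
  qed
qed

lemma good_fib_measurable [measurable]: "Measurable.pred YM (\<lambda>y. good (fib y))"
proof -
  have "Measurable.pred YM (\<lambda>y. noncolliding (fib y))"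
    unfolding noncolliding_iff_windows by measurable
  moreover have "Measurable.pred YM (\<lambda>y. recurrent_marks (fib y))"
    unfolding recurrent_marks_def by measurable
  moreover have "Measurable.pred YM (\<lambda>y. tame (fib y))"
    unfolding tame_def by measurable
  moreover have "Measurable.pred YM (\<lambda>y. is_fib (fib y))"
    by (subst measurable_cong[where g = "\<lambda>_. True"]) (auto simp: space_YM is_fib_fib)
  ultimately show ?thesis unfolding good_def by measurable
qed

text \<open>Coding and decoding are inverse to each other here, so the image is described by
  properties of the fiber alone, whose measurability and probability can be examined one by
  one.\<close>

lemma lift_image_eq:
  "(p \<circ> least_lift) ` regular_part UNIV (edge_paths trans) =
    {y \<in> Yr. good (fib y) \<and> (\<exists>u. \<forall>m. \<exists>n. n \<le> m \<and> symb (shift_by n ` fib y) = u) \<and>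
      (\<exists>v. \<forall>m. \<exists>n. m \<le> n \<and> symb (shift_by n ` fib y) = v)}" (is "_ = ?Z")
proof (intro equalityI subsetI)
  fix y assume "y \<in> (p \<circ> least_lift) ` regular_part UNIV (edge_paths trans)"
  then obtain z where z: "z \<in> regular_part UNIV (edge_paths trans)" "y = p (least_lift z)" by auto
  have path: "z \<in> edge_paths trans" using z(1) by (simp add: regular_part_iff)
  have mem: "least_lift z \<in> dec z" using path by (rule least_lift_mem)
  have f: "fib y = dec z" using p_mem_fib[OF mem dec_fib[OF path]] z(2) by simp
  have "y \<in> Yr" using z(2) fib_Reg[OF dec_fib[OF path] mem] by (auto simp: Yr_def)
  then show "y \<in> ?Z" using z(1) dec_regular[OF z(1)] f by (simp add: regular_part_iff)
next
  fix y assume y: "y \<in> ?Z"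
  define z where "z = (\<lambda>n. symb (shift_by n ` fib y))"
  have g: "good (fib y)" using y by blast
  have path: "z \<in> edge_paths trans" unfolding z_def using g by (rule code_path)
  have "z \<in> regular_part UNIV (edge_paths trans)"
    using y path unfolding regular_part_iff z_def by simp
  moreover have "dec z = fib y" unfolding z_def using g by (rule dec_code)
  then have "p (least_lift z) = y" using least_lift_mem[OF path] by (simp add: fib_def)
  ultimately show "y \<in> (p \<circ> least_lift) ` regular_part UNIV (edge_paths trans)" by force
qed

lemma lift_image_sets: "(p \<circ> least_lift) ` regular_part UNIV (edge_paths trans) \<in> sets Y"
proof -
  have "Measurable.pred YM (\<lambda>y. good (fib y) \<and> (\<exists>u. \<forall>m. \<exists>n. n \<le> m \<and> symb (shift_by n ` fib y) = u) \<and>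
      (\<exists>v. \<forall>m. \<exists>n. m \<le> n \<and> symb (shift_by n ` fib y) = v))" by measurable
  then show ?thesis unfolding lift_image_eq pred_YM_iff .
qed

end

lemma (in coded_shift) noncolliding_of_recurrent_changes:
  assumes F: "is_fib F"
    and recurs: "\<And>n. \<exists>x\<in>F. \<exists>y\<in>F. (x n = y n) \<noteq> (x (n + 1) = y (n + 1)) \<Longrightarrow>
      \<exists>m>n. \<exists>x\<in>F. \<exists>y\<in>F. (x m = y m) \<noteq> (x (m + 1) = y (m + 1))"
  shows "noncolliding F"
proof (rule ccontr)
  define C where "C n x y \<longleftrightarrow> (x n = y n) \<noteq> (x (n + 1) = y (n + 1))" for n :: int and x y :: "int \<Rightarrow> nat"
  assume "\<not> noncolliding F"
  then obtain x y n where xy: "x \<in> F" "y \<in> F" "x n = y n" "x \<noteq> y" unfolding noncolliding_def by blast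
  have "\<exists>n. C n x y"
  proof (rule ccontr)
    assume none: "\<nexists>n. C n x y"
    have "x m = y m" for m
    proof (induction m rule: int_induct[of _ n])
      case (step2 i)
      then show ?case using none[unfolded C_def, simplified, rule_format, of "i - 1"] by simp
    qed (use xy none in \<open>auto simp: C_def\<close>)
    then show False using xy(4) by blast
  qed
  then obtain n0 where "\<exists>x\<in>F. \<exists>y\<in>F. C n0 x y" using xy(1,2) by blast
  then have unb: "\<exists>n\<ge>m. \<exists>x\<in>F. \<exists>y\<in>F. C n x y" for m
    using int_unbounded_above[of "\<lambda>n. \<exists>x\<in>F. \<exists>y\<in>F. C n x y" n0 m] recurs by (auto simp: C_def)
  \<comment> \<open>There are finitely many pairs in the fiber, so a single pair changes infinitely
    often.\<close>
  have "infinite {n. 0 \<le> n \<and> (\<exists>q\<in>F \<times> F. C n (fst q) (snd q))}"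
    unfolding infinite_nonneg_iff using unb by fastforce
  moreover have "{n. 0 \<le> n \<and> (\<exists>q\<in>F \<times> F. C n (fst q) (snd q))} = (\<Union>q\<in>F \<times> F. {n. 0 \<le> n \<and> C n (fst q) (snd q)})" by blast
  ultimately have "infinite (\<Union>q\<in>F \<times> F. {n. 0 \<le> n \<and> C n (fst q) (snd q)})" by metis
  moreover have "finite (F \<times> F)" using fib_finite[OF F] by simp
  ultimately obtain q where q: "q \<in> F \<times> F" "infinite {n. 0 \<le> n \<and> C n (fst q) (snd q)}"
    using finite_UN_I by blast
  define x y where "x = fst q" and "y = snd q"
  have xF: "x \<in> F" and yF: "y \<in> F" using q(1) by (auto simp: x_def y_def)
  \<comment> \<open>The splice follows \<open>x\<close> up to time n and \<open>y\<close>
    afterwards. At a change the two agree at n or at n + 1, which provides the joining edge.\<close>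
  define z where "z n k = (if k \<le> n then x k else y k)" for n k :: int
  have zF: "z n \<in> F" if "C n x y" for n
  proof (rule fib_closed[OF F xF])
    show "z n \<in> edge_paths E" unfolding edge_paths_def
    proof (intro CollectI allI)
      fix k
      have "(x k, x (k + 1)) \<in> E" "(y k, y (k + 1)) \<in> E"
        using fib_path[OF F xF] fib_path[OF F yF] by (auto simp: edge_paths_def)
      then show "(z n k, z n (k + 1)) \<in> E"
        using that by (cases "k = n") (auto simp: z_def C_def)
    qed
    show "(z n k, x k) \<in> R" for k
      using fib_related[OF F xF xF] fib_related[OF F yF xF] by (auto simp: z_def)
  qed
  \<comment> \<open>A meeting and the separation following it yield the same splice, so the two
    kinds are treated apart; splices of one kind are pairwise distinct.\<close>
  let ?S = "{n. 0 \<le> n \<and> x n = y n \<and> x (n + 1) \<noteq> y (n + 1)}"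
  let ?M = "{n. 0 \<le> n \<and> x n \<noteq> y n \<and> x (n + 1) = y (n + 1)}"
  have "{n. 0 \<le> n \<and> C n x y} = ?S \<union> ?M" by (auto simp: C_def)
  then have "infinite ?S \<or> infinite ?M" using q(2) by (auto simp: x_def y_def)
  then show False
  proof
    assume inf: "infinite ?S"
    have "inj_on z ?S"
    proof (rule linorder_inj_onI)
      fix n m assume "n < m" "n \<in> ?S" "m \<in> ?S"
      then have "z n (n + 1) \<noteq> z m (n + 1)" by (auto simp: z_def)
      then show "z n \<noteq> z m" by metis
    qed auto
    moreover have "z ` ?S \<subseteq> F" using zF by (auto simp: C_def)
    ultimately show False using inf fib_finite[OF F] inj_on_finite by blast
  next
    assume inf: "infinite ?M"
    have "inj_on z ?M"
    proof (rule linorder_inj_onI)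
      fix n m assume "n < m" "n \<in> ?M" "m \<in> ?M"
      then have "z n m \<noteq> z m m" by (auto simp: z_def)
      then show "z n \<noteq> z m" by metis
    qed auto
    moreover have "z ` ?M \<subseteq> F" using zF by (auto simp: C_def)
    ultimately show False using inf fib_finite[OF F] inj_on_finite by blast
  qed
qed

section \<open>Almost sure properties of fibers\<close>

locale coded_factor_prob = coded_factor_measurable +
  fixes \<mu>
  assumes prob: "prob_space \<mu>" and sets_mu: "sets \<mu> = sets Y" and invariant: "distr \<mu> Y T = \<mu>"
    and full: "emeasure \<mu> Yr = 1"
begin

lemma space_mu: "space \<mu> = space Y"
  using sets_mu by (rule sets_eq_imp_space_eq)

lemma AE_Yr: "AE y in \<mu>. y \<in> Yr"
proof -
  interpret prob_space \<mu> by (rule prob)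
  show ?thesis using full Yr_sets sets_mu by (intro AE_prob_1) (simp add: measure_def)
qed

lemma equivariant_family_fib:
  assumes "\<And>n. Measurable.pred YM (\<lambda>y. P (shift_by n ` fib y))"
  shows "equivariant_family \<mu> T (\<lambda>n y. y \<in> Yr \<and> P (shift_by n ` fib y))"
proof (intro equivariant_family.intro equivariant_family_axioms.intro prob)
  show "T \<in> measurable \<mu> \<mu>" using T_measurable measurable_cong_sets[OF sets_mu sets_mu] by blast
  show "distr \<mu> \<mu> T = \<mu>" using invariant distr_cong[OF refl sets_mu refl] by metis
  show "{y \<in> space \<mu>. y \<in> Yr \<and> P (shift_by n ` fib y)} \<in> sets \<mu>" for n
  proof -
    have "{y \<in> space \<mu>. y \<in> Yr \<and> P (shift_by n ` fib y)} = {y \<in> Yr. P (shift_by n ` fib y)}"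
      using Yr_space space_mu by auto
    then show ?thesis using assms[of n] sets_mu unfolding pred_YM_iff by simp
  qed
  fix n y assume "y \<in> space \<mu>"
  then have y: "y \<in> space Y" by (simp add: space_mu)
  have "shift_by (n + 1) ` fib y = shift_by n ` fib (T y)" if "y \<in> Yr"
    using fib_T[OF that] by (simp only: shift_by_image_add)
  then show "(y \<in> Yr \<and> P (shift_by (n + 1) ` fib y)) = (T y \<in> Yr \<and> P (shift_by n ` fib (T y)))"
    using T_Yr_iff[OF y] by auto
qed

lemma AE_recurs:
  assumes "\<And>n. Measurable.pred YM (\<lambda>y. P (shift_by n ` fib y))"
  shows "AE y in \<mu>. \<forall>n. P (shift_by n ` fib y) \<longrightarrow>
    (\<exists>m>n. P (shift_by m ` fib y)) \<and> (\<exists>m<n. P (shift_by m ` fib y))"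
proof -
  interpret equivariant_family \<mu> T "\<lambda>n y. y \<in> Yr \<and> P (shift_by n ` fib y)"
    using assms by (rule equivariant_family_fib)
  show ?thesis using recurrence_future recurrence_past AE_Yr by eventually_elim blast
qed

lemma AE_noncolliding: "AE y in \<mu>. noncolliding (fib y)"
proof -
  define P where "P F \<longleftrightarrow> (\<exists>x\<in>F. \<exists>y\<in>F. (x 0 = y 0) \<noteq> (x 1 = y 1))" for F :: "(int \<Rightarrow> nat) set"
  have P: "P (shift_by n ` F) \<longleftrightarrow> (\<exists>x\<in>F. \<exists>y\<in>F. (x n = y n) \<noteq> (x (n + 1) = y (n + 1)))" for n F
    by (auto simp: P_def add.commute)
  have nth: "seg n (n + 1) x ! 0 = x n" "seg n (n + 1) x ! 1 = x (n + 1)" for n and x :: "int \<Rightarrow> nat"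
    using seg_nth[of n n "n + 1" x] seg_nth[of n "n + 1" "n + 1" x] by simp_all
  have win: "P (shift_by n ` F) \<longleftrightarrow> (\<exists>w\<in>seg n (n + 1) ` F. \<exists>w'\<in>seg n (n + 1) ` F.
      (w ! 0 = w' ! 0) \<noteq> (w ! 1 = w' ! 1))" for n F
  proof -
    have "(\<exists>w\<in>seg n (n + 1) ` F. \<exists>w'\<in>seg n (n + 1) ` F. (w ! 0 = w' ! 0) \<noteq> (w ! 1 = w' ! 1)) \<longleftrightarrow>
        (\<exists>x\<in>F. \<exists>y\<in>F. (seg n (n + 1) x ! 0 = seg n (n + 1) y ! 0) \<noteq> (seg n (n + 1) x ! 1 = seg n (n + 1) y ! 1))"
      by blast
    then show ?thesis unfolding P nth by (rule sym)
  qed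
  have "AE y in \<mu>. \<forall>n. P (shift_by n ` fib y) \<longrightarrow>
    (\<exists>m>n. P (shift_by m ` fib y)) \<and> (\<exists>m<n. P (shift_by m ` fib y))"
    by (rule AE_recurs) (unfold win, measurable)
  then show ?thesis using AE_Yr
  proof eventually_elim
    case (elim y)
    then show ?case unfolding P by (intro noncolliding_of_recurrent_changes is_fib_fib) blast+
  qed
qed

lemma AE_recurrent_marks: "AE y in \<mu>. recurrent_marks (fib y)"
proof -
  have "AE y in \<mu>. \<forall>n. mark (shift_by n ` fib y) 0 \<longrightarrow>
    (\<exists>m>n. mark (shift_by m ` fib y) 0) \<and> (\<exists>m<n. mark (shift_by m ` fib y) 0)"
    by (rule AE_recurs) (unfold mark_shift_by, measurable)
  then show ?thesis using AE_Yr
  proof eventually_elim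
    case (elim y)
    then have rec: "\<And>n. mark (fib y) n \<Longrightarrow> \<exists>m>n. mark (fib y) m" "\<And>n. mark (fib y) n \<Longrightarrow> \<exists>m<n. mark (fib y) m" by auto
    obtain n0 where "mark (fib y) n0" using mark_exists[OF is_fib_fib] elim by blast
    then show ?case unfolding recurrent_marks_def
      using int_unbounded_above[of "mark (fib y)" n0] int_unbounded_below[of "mark (fib y)" n0] rec by blast
  qed
qed

text \<open>Symbols are countable, so almost surely all of them recur once they occur; the symbol at
  time 0 does occur and serves for both directions.\<close>

lemma AE_symb_recurs: "AE y in \<mu>. (\<exists>u. \<forall>m. \<exists>n. n \<le> m \<and> symb (shift_by n ` fib y) = u) \<and>
      (\<exists>v. \<forall>m. \<exists>n. m \<le> n \<and> symb (shift_by n ` fib y) = v)"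
proof -
  have "AE y in \<mu>. \<forall>s. \<forall>n. symb (shift_by n ` fib y) = s \<longrightarrow>
    (\<exists>m>n. symb (shift_by m ` fib y) = s) \<and> (\<exists>m<n. symb (shift_by m ` fib y) = s)"
    by (intro AE_all_countable[THEN iffD2] allI AE_recurs symb_fib_measurable)
  then show ?thesis
  proof eventually_elim
    case (elim y)
    let ?P = "\<lambda>n. symb (shift_by n ` fib y) = symb (shift_by 0 ` fib y)"
    have "?P n \<Longrightarrow> \<exists>m>n. ?P m" "?P n \<Longrightarrow> \<exists>m<n. ?P m" for n using elim by blast+
    then have "\<exists>n\<ge>m. ?P n" "\<exists>n\<le>m. ?P n" for m
      using int_unbounded_above[of ?P 0 m] int_unbounded_below[of ?P 0 m] by blast+
    then show ?case by blast
  qed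
qed

text \<open>A marker followed by a gap longer than \<open>g\<close> has probability at most \<open>1 / g\<close>, since its first
  \<open>g\<close> translates are disjoint; so by Borel--Cantelli the gap following time \<open>k\<close> is at most \<open>2 ^ k\<close>
  for all large \<open>k\<close>.\<close>

lemma AE_eventually_not_of_disjoint:
  assumes meas: "\<And>g n. Measurable.pred YM (\<lambda>y. P g (shift_by n ` fib y))"
    and disj: "\<And>g i j F. i < g \<Longrightarrow> j < g \<Longrightarrow> i \<noteq> j \<Longrightarrow>
      \<not> (P g (shift_by (int i) ` F) \<and> P g (shift_by (int j) ` F))"
  shows "AE y in \<mu>. \<forall>\<^sub>F k in sequentially. \<not> P (2 ^ k) (shift_by (t k) ` fib y)"
proof -
  interpret prob_space \<mu> by (rule prob)
  define A where "A k = {y \<in> space \<mu>. y \<in> Yr \<and> P (2 ^ k) (shift_by (t k) ` fib y)}" for k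
  have fam: "equivariant_family \<mu> T (\<lambda>n y. y \<in> Yr \<and> P g (shift_by n ` fib y))" for g
    using meas by (rule equivariant_family_fib)
  have "AE y in \<mu>. \<forall>\<^sub>F k in sequentially. y \<in> space \<mu> - A k"
  proof (rule borel_cantelli_AE1)
    show "A k \<in> sets \<mu>" for k
      unfolding A_def by (rule equivariant_family.Q_sets[OF fam])
    show "emeasure \<mu> (A k) < \<infinity>" for k by (simp add: emeasure_eq_measure)
    have "prob (A k) \<le> (1 / 2) ^ k" for k
    proof -
      have "real (2 ^ k) * prob (A k) \<le> 1"
        unfolding A_def by (rule equivariant_family.prob_le_of_disjoint[OF fam]) (use disj in blast)
      then show ?thesis by (simp add: power_one_over field_simps)
    qed
    then show "summable (\<lambda>k. prob (A k))"
      by (intro summable_comparison_test'[OF summable_geometric[of "1 / 2 :: real"]]) auto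
  qed
  then show ?thesis using AE_Yr
  proof eventually_elim
    case (elim y)
    then have "\<forall>\<^sub>F k in sequentially. y \<notin> A k" by (auto elim: eventually_mono)
    then show ?case
      by eventually_elim (use elim Yr_space in \<open>auto simp: A_def space_mu\<close>)
  qed
qed

text \<open>For large k the gap at time k is at most 2 ^ k, so its logarithm is at most k, and
  \<open>linear_tail_bound\<close> passes to arbitrary base times. The past is treated
  symmetrically.\<close>

lemma AE_tame: "AE y in \<mu>. tame (fib y)"
proof -
  define P where "P g F \<longleftrightarrow> mark F 0 \<and> (\<forall>j. 1 \<le> j \<and> j \<le> g \<longrightarrow> \<not> mark F (int j))" for g F
  define P' where "P' g F \<longleftrightarrow> mark F 0 \<and> (\<forall>j. 1 \<le> j \<and> j \<le> g \<longrightarrow> \<not> mark F (- int j))" for g F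
  have fwd: "AE y in \<mu>. \<forall>\<^sub>F k in sequentially. \<not> P (2 ^ k) (shift_by (int k) ` fib y)"
  proof (rule AE_eventually_not_of_disjoint)
    show "Measurable.pred YM (\<lambda>y. P g (shift_by n ` fib y))" for g n
      unfolding P_def mark_shift_by by measurable
    have less: "\<not> (P g (shift_by (int i) ` F) \<and> P g (shift_by (int j) ` F))" if "i < j" "j < g" for i j g F
    proof
      assume "P g (shift_by (int i) ` F) \<and> P g (shift_by (int j) ` F)"
      then have "mark F (0 + int j)" "\<forall>k. 1 \<le> k \<and> k \<le> g \<longrightarrow> \<not> mark F (int k + int i)"
        unfolding P_def mark_shift_by by blast+
      moreover have "1 \<le> j - i" "j - i \<le> g" using that by linarith+
      ultimately have "mark F (0 + int j)" "\<not> mark F (int (j - i) + int i)" by blast+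
      moreover have "int (j - i) + int i = 0 + int j" using that by simp
      ultimately show False by (simp only: not_True_eq_False)
    qed
    show "\<not> (P g (shift_by (int i) ` F) \<and> P g (shift_by (int j) ` F))" if "i < g" "j < g" "i \<noteq> j" for i j g F
    proof (cases "i < j")
      case True
      then show ?thesis using less[of i j g F] that by blast
    next
      case False
      then have "j < i" using that by simp
      then show ?thesis using less[of j i g F] that by blast
    qed
  qed
  have bwd: "AE y in \<mu>. \<forall>\<^sub>F k in sequentially. \<not> P' (2 ^ k) (shift_by (- int k) ` fib y)"
  proof (rule AE_eventually_not_of_disjoint)
    show "Measurable.pred YM (\<lambda>y. P' g (shift_by n ` fib y))" for g n
      unfolding P'_def mark_shift_by by measurable
    have less: "\<not> (P' g (shift_by (int i) ` F) \<and> P' g (shift_by (int j) ` F))" if "i < j" "j < g" for i j g F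
    proof
      assume "P' g (shift_by (int i) ` F) \<and> P' g (shift_by (int j) ` F)"
      then have "mark F (0 + int i)" "\<forall>k. 1 \<le> k \<and> k \<le> g \<longrightarrow> \<not> mark F (- int k + int j)"
        unfolding P'_def mark_shift_by by blast+
      moreover have "1 \<le> j - i" "j - i \<le> g" using that by linarith+
      ultimately have "mark F (0 + int i)" "\<not> mark F (- int (j - i) + int j)" by blast+
      moreover have "- int (j - i) + int j = 0 + int i" using that by simp
      ultimately show False by (simp only: not_True_eq_False)
    qed
    show "\<not> (P' g (shift_by (int i) ` F) \<and> P' g (shift_by (int j) ` F))" if "i < g" "j < g" "i \<noteq> j" for i j g F
    proof (cases "i < j")
      case True
      then show ?thesis using less[of i j g F] that by blast
    next
      case False
      then have "j < i" using that by simp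
      then show ?thesis using less[of j i g F] that by blast
    qed
  qed
  show ?thesis using fwd bwd AE_Yr
  proof eventually_elim
    case (elim y)
    let ?F = "fib y"
    obtain k0 where k0: "\<And>k. k \<ge> k0 \<Longrightarrow> \<not> P (2 ^ k) (shift_by (int k) ` ?F)"
      using elim(1) unfolding eventually_sequentially by blast
    obtain k1 where k1: "\<And>k. k \<ge> k1 \<Longrightarrow> \<not> P' (2 ^ k) (shift_by (- int k) ` ?F)"
      using elim(2) unfolding eventually_sequentially by blast
    have next_le: "gap_next F \<le> k" if nP: "\<not> P (2 ^ k) F" for k F
    proof (cases "mark F 0")
      case True
      then obtain j where "1 \<le> j" "j \<le> 2 ^ k" "mark F (int j)" using True nP unfolding P_def by blast
      then have "nxt_mark F \<le> j" unfolding nxt_mark_def by (intro Least_le) simp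
      then have "nxt_mark F \<le> 2 ^ k" using \<open>j \<le> 2 ^ k\<close> by (rule le_trans)
      then show ?thesis by (simp add: gap_next_def log_ceil_le_iff)
    qed (simp add: gap_next_def)
    have last_le: "gap_last F \<le> k" if nP: "\<not> P' (2 ^ k) F" for k F
    proof (cases "mark F 0")
      case True
      then obtain j where "1 \<le> j" "j \<le> 2 ^ k" "mark F (- int j)" using True nP unfolding P'_def by blast
      then have "lst_mark F \<le> j" unfolding lst_mark_def by (intro Least_le) simp
      then have "lst_mark F \<le> 2 ^ k" using \<open>j \<le> 2 ^ k\<close> by (rule le_trans)
      then show ?thesis by (simp add: gap_last_def log_ceil_le_iff)
    qed (simp add: gap_last_def)
    show ?case unfolding tame_def
    proof (intro allI conjI)
      fix n
      show "\<exists>v. \<forall>k. gap_next (shift_by (n + int k) ` ?F) \<le> v + k"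
        by (rule linear_tail_bound[where c = "\<lambda>m. gap_next (shift_by m ` ?F)", OF next_le[OF k0]])
      have "\<exists>v. \<forall>k. gap_last (shift_by (- (- n + int k)) ` ?F) \<le> v + k"
        by (rule linear_tail_bound[where c = "\<lambda>m. gap_last (shift_by (- m) ` ?F)", OF last_le[OF k1]])
      moreover have "- (- n + int k) = n - int k" for k by simp
      ultimately show "\<exists>v. \<forall>k. gap_last (shift_by (n - int k) ` ?F) \<le> v + k" by (simp only:)
    qed
  qed
qed

lemma lift_image_full: "emeasure \<mu> ((p \<circ> least_lift) ` regular_part UNIV (edge_paths trans)) = 1"
proof -
  interpret prob_space \<mu> by (rule prob)
  have "AE y in \<mu>. y \<in> (p \<circ> least_lift) ` regular_part UNIV (edge_paths trans)"
    using AE_noncolliding AE_recurrent_marks AE_tame AE_symb_recurs AE_Yr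
    unfolding lift_image_eq by eventually_elim (simp add: good_def is_fib_fib)
  then have "prob ((p \<circ> least_lift) ` regular_part UNIV (edge_paths trans)) = 1"
    using lift_image_sets sets_mu by (intro prob_eq_1[THEN iffD2]) simp_all
  then show ?thesis by (simp add: emeasure_eq_measure)
qed

end

section \<open>Local finiteness from local compactness\<close>

context coded_factor
begin

lemma lift_semiconjugacy: "semiconjugacy shift_map (edge_paths trans) T (space Y) (p \<circ> least_lift)"
  unfolding semiconjugacy_def
proof (intro conjI funcsetI ballI)
  fix z assume z: "z \<in> edge_paths trans"
  have F: "is_fib (dec z)" and x: "least_lift z \<in> dec z" using dec_fib[OF z] least_lift_mem[OF z] by auto
  have xR: "least_lift z \<in> Reg" using fib_Reg[OF F x] .
  show "(p \<circ> least_lift) z \<in> space Y" using p_space[OF xR] by simp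
  have z1: "shift_by 1 z \<in> edge_paths trans" using z by simp
  have "least_lift (shift_by 1 z) \<in> shift_by 1 ` dec z"
    using least_lift_mem[OF z1] dec_shift_by by simp
  moreover have "shift_by 1 (least_lift z) \<in> shift_by 1 ` dec z" using x by simp
  moreover have F1: "is_fib (shift_by 1 ` dec z)" using F by simp
  ultimately have "p (least_lift (shift_by 1 z)) = p (shift_by 1 (least_lift z))"
    using fib_related[OF F1] fib_Reg[OF F1] by (subst p_eq) blast+
  then show "(p \<circ> least_lift) (shift_map z) = T ((p \<circ> least_lift) z)"
    using p_shift[OF xR] by (simp add: shift_map_eq)
qed

text \<open>The image point determines the decoded fiber, and along a regular path the symbols are
  recovered from that fiber.\<close>

lemma lift_inj_on: "inj_on (p \<circ> least_lift) (regular_part UNIV (edge_paths trans))"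
proof (rule inj_onI)
  fix z z' assume z: "z \<in> regular_part UNIV (edge_paths trans)" "z' \<in> regular_part UNIV (edge_paths trans)"
    and eq: "(p \<circ> least_lift) z = (p \<circ> least_lift) z'"
  have path: "z \<in> edge_paths trans" "z' \<in> edge_paths trans" using z by (simp_all add: regular_part_iff)
  have "dec z = fib (p (least_lift z))"
    by (rule sym, rule p_mem_fib[OF least_lift_mem[OF path(1)] dec_fib[OF path(1)]])
  also have "\<dots> = fib (p (least_lift z'))" using eq by simp
  also have "\<dots> = dec z'"
    by (rule p_mem_fib[OF least_lift_mem[OF path(2)] dec_fib[OF path(2)]])
  finally have d: "dec z = dec z'" .
  show "z = z'"
  proof
    fix n show "z n = z' n" using dec_regular(2)[OF z(1), of n] dec_regular(2)[OF z(2), of n] d by simp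
  qed
qed

lemma lift_full:
  assumes "prob_space \<mu>" "sets \<mu> = sets Y" "distr \<mu> Y T = \<mu>" "emeasure \<mu> (p ` Reg) = 1"
  shows "emeasure \<mu> ((p \<circ> least_lift) ` regular_part UNIV (edge_paths trans)) = 1"
proof -
  \<comment> \<open>\<open>emeasure\<close> is 0 outside the \<sigma>-algebra, so the value 1 forces
    the image to be measurable.\<close>
  have "p ` Reg \<in> sets Y"
  proof (rule ccontr)
    assume "p ` Reg \<notin> sets Y"
    then have "emeasure \<mu> (p ` Reg) = 0" using assms(2) by (intro emeasure_notin_sets) simp
    then show False using assms(4) by simp
  qed
  then have "Yr \<in> sets Y" "emeasure \<mu> Yr = 1" using assms(4) by (simp_all add: Yr_def)
  then interpret coded_factor_prob E R Y T p U \<mu>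
    using assms(1-3)
    by (intro coded_factor_prob.intro coded_factor_measurable.intro coded_factor_axioms
        coded_factor_measurable_axioms.intro coded_factor_prob_axioms.intro)
  show ?thesis by (rule lift_image_full)
qed

end

text \<open>A path through \<open>a\<close> whose past is recurrent yields a periodic path from which \<open>a\<close> can be
  reached after any prescribed time, so all edges leaving \<open>a\<close> are seen in one compact cylinder.\<close>

lemma finite_successors_of_recurrent:
  assumes lcf: "\<And>p. p \<in> edge_paths E \<Longrightarrow> \<exists>n. \<forall>j. finite {q j | q. q \<in> edge_paths E \<and> agree_upto n p q}"
    and x: "x \<in> edge_paths E" and u: "\<And>m. \<exists>n\<le>m::int. x n = u"
  shows "finite {y 1 | y. y \<in> edge_paths E \<and> y 0 = x 0}"
proof -
  have xE: "(x k, x (k + 1)) \<in> E" for k using x by (simp add: edge_paths_def)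
  obtain m where m: "m \<le> 0" "x m = u" using u by blast
  obtain m' where m': "m' \<le> m - 1" "x m' = u" using u by blast
  define q where "q = m - m'"
  have q: "q > 0" using m' by (simp add: q_def)
  \<comment> \<open>The stretch of \<open>x\<close> between its visits to u at times m' and m is
    repeated with period q, so \<open>p\<close> is at u at all multiples of q.\<close>
  define p where "p k = x (m' + k mod q)" for k
  have p: "p \<in> edge_paths E" unfolding edge_paths_def
  proof (intro CollectI allI)
    fix k
    show "(p k, p (k + 1)) \<in> E"
    proof (cases "k mod q = q - 1")
      case True
      then have "(k + 1) mod q = 0" by (metis diff_add_cancel mod_add_left_eq mod_self)
      then have "p (k + 1) = x (m' + (q - 1) + 1)" using m m' by (simp add: p_def q_def)
      then show ?thesis using True xE[of "m' + (q - 1)"] by (simp add: p_def)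
    next
      case False
      have "0 \<le> k mod q" "k mod q < q" using q by auto
      then have "(k mod q + 1) mod q = k mod q + 1" using False by (intro mod_pos_pos_trivial) auto
      then have "(k + 1) mod q = k mod q + 1" by (simp add: mod_add_left_eq)
      then show ?thesis using xE[of "m' + k mod q"] by (simp add: p_def add.assoc)
    qed
  qed
  obtain n where n: "\<And>j. finite {q j | q. q \<in> edge_paths E \<and> agree_upto n p q}" using lcf[OF p] by blast
  \<comment> \<open>A multiple of the period that is at least n: at time s the path \<open>p\<close>
    is at u, and the whole window of radius n lies no later.\<close>
  define s where "s = int n * q"
  have "int n * 1 \<le> int n * q" using q by (intro mult_left_mono) auto
  then have s: "int n \<le> s" "p s = x m" using m m' by (auto simp: s_def p_def)
  have "{y 1 | y. y \<in> edge_paths E \<and> y 0 = x 0} \<subseteq> {q (s - m + 1) | q. q \<in> edge_paths E \<and> agree_upto n p q}"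
  proof
    fix b assume "b \<in> {y 1 | y. y \<in> edge_paths E \<and> y 0 = x 0}"
    then obtain y where y: "y \<in> edge_paths E" "y 0 = x 0" "b = y 1" by blast
    \<comment> \<open>From u at time s the path follows \<open>x\<close> from time m to time 0, and
      \<open>y\<close> from there on; the letter \<open>y 1\<close> always appears at the fixed time
      s - m + 1.\<close>
    define w where "w k = (if k \<le> s then p k else if k \<le> s - m then x (k - s + m) else y (k - s + m))" for k
    have "w \<in> edge_paths E" unfolding edge_paths_def
    proof (intro CollectI allI)
      fix k
      have e: "(p k, p (k + 1)) \<in> E" "(x (k - s + m), x (k - s + m + 1)) \<in> E"
        "(y (k - s + m), y (k - s + m + 1)) \<in> E"
        using p x y(1) by (auto simp: edge_paths_def)
      have shift: "k + 1 - s + m = k - s + m + 1" by simp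
      consider "k < s" | "k = s" "s < s - m" | "k = s" "m = 0" | "s < k" "k < s - m" | "s < k" "k = s - m" | "k > s - m" "k > s"
        using m(1) by linarith
      then show "(w k, w (k + 1)) \<in> E"
      proof cases
        case 1
        then show ?thesis using e by (simp add: w_def)
      next
        case 2
        then show ?thesis using e(2) s(2) unfolding w_def shift by simp
      next
        case 3
        then show ?thesis using e(3) s(2) y(2) unfolding w_def shift by simp
      next
        case 4
        then show ?thesis using e(2) unfolding w_def shift by simp
      next
        case 5
        then show ?thesis using e(3) y(2) unfolding w_def shift by simp
      next
        case 6
        then show ?thesis using e(3) unfolding w_def shift by simp
      qed
    qed
    moreover have "agree_upto n p w" using s(1) by (auto simp: agree_upto_def w_def)
    moreover have "b = w (s - m + 1)" using y(3) m(1) by (simp add: w_def)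
    ultimately show "b \<in> {q (s - m + 1) | q. q \<in> edge_paths E \<and> agree_upto n p q}" by blast
  qed
  then show ?thesis using n finite_subset by blast
qed

lemma edge_paths_reverse: "(\<lambda>n. x (- n)) \<in> edge_paths (E\<inverse>) \<longleftrightarrow> x \<in> edge_paths E"
proof -
  have "(\<forall>n. (x (- n), x (- (n + 1))) \<in> E\<inverse>) \<longleftrightarrow> (\<forall>n. (x n, x (n + 1)) \<in> E)"
  proof (intro iffI allI)
    fix n assume "\<forall>n. (x (- n), x (- (n + 1))) \<in> E\<inverse>"
    from this[rule_format, of "- n - 1"] show "(x n, x (n + 1)) \<in> E" by (simp add: add.commute)
  next
    fix n assume "\<forall>n. (x n, x (n + 1)) \<in> E"
    from this[rule_format, of "- n - 1"] show "(x (- n), x (- (n + 1))) \<in> E\<inverse>" by simp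
  qed
  then show ?thesis by (simp add: edge_paths_def)
qed

text \<open>Time reversal exchanges predecessors and successors, and symmetric windows are preserved
  by it.\<close>

lemma finite_predecessors_of_recurrent:
  assumes lcf: "\<And>p. p \<in> edge_paths E \<Longrightarrow> \<exists>n. \<forall>j. finite {q j | q. q \<in> edge_paths E \<and> agree_upto n p q}"
    and x: "x \<in> edge_paths E" and v: "\<And>m. \<exists>n\<ge>m::int. x n = v"
  shows "finite {y (-1) | y. y \<in> edge_paths E \<and> y 0 = x 0}"
proof -
  define rv where "rv z = (\<lambda>n. z (- n))" for z :: "int \<Rightarrow> 'a"
  have rv: "rv z \<in> edge_paths (E\<inverse>) \<longleftrightarrow> z \<in> edge_paths E" "rv z \<in> edge_paths E \<longleftrightarrow> z \<in> edge_paths (E\<inverse>)" for z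
    using edge_paths_reverse[of z E] edge_paths_reverse[of z "E\<inverse>"] by (simp_all add: rv_def)
  have rv2: "rv (rv z) = z" for z by (simp add: rv_def)
  have "finite {y 1 | y. y \<in> edge_paths (E\<inverse>) \<and> y 0 = rv x 0}"
  proof (rule finite_successors_of_recurrent)
    fix p assume "p \<in> edge_paths (E\<inverse>)"
    then have "rv p \<in> edge_paths E" by (simp add: rv)
    then obtain n where n: "\<And>j. finite {q j | q. q \<in> edge_paths E \<and> agree_upto n (rv p) q}" using lcf by blast
    have "{q j | q. q \<in> edge_paths (E\<inverse>) \<and> agree_upto n p q} \<subseteq> {q (- j) | q. q \<in> edge_paths E \<and> agree_upto n (rv p) q}" for j
    proof
      fix b assume "b \<in> {q j | q. q \<in> edge_paths (E\<inverse>) \<and> agree_upto n p q}"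
      then obtain q where q: "b = q j" "q \<in> edge_paths (E\<inverse>)" "agree_upto n p q" by blast
      then have "b = rv q (- j)" "rv q \<in> edge_paths E" "agree_upto n (rv p) (rv q)"
        using rv by (auto simp: rv_def agree_upto_def)
      then show "b \<in> {q (- j) | q. q \<in> edge_paths E \<and> agree_upto n (rv p) q}" by blast
    qed
    then show "\<exists>n. \<forall>j. finite {q j | q. q \<in> edge_paths (E\<inverse>) \<and> agree_upto n p q}"
      using n finite_subset by blast
  next
    show "rv x \<in> edge_paths (E\<inverse>)" using x by (simp add: rv)
    fix m
    obtain n where "n \<ge> - m" "x n = v" using v by blast
    then show "\<exists>n\<le>m. rv x n = v" by (intro exI[of _ "- n"]) (auto simp: rv_def)
  qed
  moreover have "{y (-1) | y. y \<in> edge_paths E \<and> y 0 = x 0} \<subseteq> {y 1 | y. y \<in> edge_paths (E\<inverse>) \<and> y 0 = rv x 0}"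
  proof
    fix b assume "b \<in> {y (-1) | y. y \<in> edge_paths E \<and> y 0 = x 0}"
    then obtain y where "b = y (-1)" "y \<in> edge_paths E" "y 0 = x 0" by blast
    then have "b = rv y 1" "rv y \<in> edge_paths (E\<inverse>)" "rv y 0 = rv x 0" using rv by (auto simp: rv_def)
    then show "b \<in> {y 1 | y. y \<in> edge_paths (E\<inverse>) \<and> y 0 = rv x 0}" by blast
  qed
  ultimately show ?thesis by (rule rev_finite_subset)
qed

text \<open>A countable base separates the points of a Hausdorff space. The empty set is added so
  that the enumeration covers the base even when the base is empty.\<close>

lemma standard_borel_separating:
  assumes "standard_borel_space Y"
  obtains U :: "nat \<Rightarrow> 'y set" where "\<And>n. U n \<in> sets (Y :: 'y measure)"
    "\<And>y y'. y \<in> space Y \<Longrightarrow> y' \<in> space Y \<Longrightarrow> (\<And>n. y \<in> U n \<longleftrightarrow> y' \<in> U n) \<Longrightarrow> y = y'"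
proof -
  obtain \<T> where T: "completely_metrizable_space \<T>" "second_countable \<T>" "space Y = topspace \<T>"
    "sets Y = sets (borel_of_topology \<T>)" using assms unfolding standard_borel_space_def by blast
  obtain \<B> where B: "countable \<B>" "\<And>V. V \<in> \<B> \<Longrightarrow> openin \<T> V"
    "\<And>W x. openin \<T> W \<Longrightarrow> x \<in> W \<Longrightarrow> \<exists>V\<in>\<B>. x \<in> V \<and> V \<subseteq> W"
    using T(2) unfolding second_countable_def by metis
  define U where "U = from_nat_into (insert {} \<B>)"
  have range: "range U = insert {} \<B>" unfolding U_def using B(1) by (intro range_from_nat_into) auto
  show thesis
  proof (rule that)
    fix n
    have "U n \<in> insert {} \<B>" using range by blast
    then have "openin \<T> (U n)" using B(2) by auto
    moreover have "{W. openin \<T> W} \<subseteq> Pow (topspace \<T>)" using openin_subset by blast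
    ultimately show "U n \<in> sets Y" unfolding T(4) borel_of_topology_def by (simp add: sigma_sets.Basic)
  next
    fix y y' assume y: "y \<in> space Y" "y' \<in> space Y" and eq: "\<And>n. y \<in> U n \<longleftrightarrow> y' \<in> U n"
    show "y = y'"
    proof (rule ccontr)
      assume "y \<noteq> y'"
      have "Hausdorff_space \<T>"
        using T(1) completely_metrizable_imp_metrizable_space metrizable_imp_Hausdorff_space by blast
      then obtain W W' where W: "openin \<T> W" "y \<in> W" "y' \<in> W'" "disjnt W W'"
        using y \<open>y \<noteq> y'\<close> T(3) unfolding Hausdorff_space_def by metis
      then obtain V where V: "V \<in> \<B>" "y \<in> V" "V \<subseteq> W" using B(3) by blast
      then obtain n where "V = U n" using range by (metis insertCI rangeE)
      then show False using eq V W by (auto simp: disjnt_def)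
    qed
  qed
qed

section \<open>The theorem\<close>

lemma finite_Image_map_prod:
  assumes e: "inj_on e A" and E: "E \<subseteq> A \<times> A" and fin: "\<And>a. finite (E `` {a})"
  shows "finite ((map_prod e e ` E) `` {c})"
proof (rule finite_subset)
  show "(map_prod e e ` E) `` {c} \<subseteq> e ` (E `` {inv_into A e c})"
  proof
    fix b assume "b \<in> (map_prod e e ` E) `` {c}"
    then obtain a' b' where ab: "(a', b') \<in> E" "c = e a'" "b = e b'" by auto
    then have "inv_into A e c = a'" using inv_into_f_f[OF e] E by blast
    then show "b \<in> e ` (E `` {inv_into A e c})" using ab by blast
  qed
qed (use fin in blast)

text \<open>Letters become natural numbers, which gives all paths a common type with countable
  alphabet and makes least letters available.\<close>

locale letter_coding =
  fixes A :: "'a set" and E0 :: "('a \<times> 'a) set" and Z :: "(int \<Rightarrow> 'a) set" and e :: "'a \<Rightarrow> nat"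
  assumes e_inj: "inj_on e A" and E0_letters: "E0 \<subseteq> A \<times> A" and Z_eq: "Z = regular_part A (edge_paths E0)"
begin

definition coded_edges :: "(nat \<times> nat) set" where
  "coded_edges = map_prod e e ` E0"

definition decode :: "(int \<Rightarrow> nat) \<Rightarrow> int \<Rightarrow> 'a" where
  "decode z = (\<lambda>n. inv_into A e (z n))"

lemma Z_letters: "x \<in> Z \<Longrightarrow> x n \<in> A"
  using E0_letters unfolding Z_eq regular_part_iff edge_paths_def by blast

lemma decode_encode: "x \<in> Z \<Longrightarrow> decode (e \<circ> x) = x"
  using Z_letters inv_into_f_f[OF e_inj] by (auto simp: decode_def fun_eq_iff)

lemma coded_regular: "regular_part UNIV (edge_paths coded_edges) = (\<lambda>x. e \<circ> x) ` Z"
proof (intro equalityI subsetI)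
  fix z assume "z \<in> regular_part UNIV (edge_paths coded_edges)"
  then obtain u v where z: "\<And>n. (z n, z (n + 1)) \<in> coded_edges" and u: "\<And>m. \<exists>n\<le>m. z n = u"
    and v: "\<And>m. \<exists>n\<ge>m. z n = v" unfolding regular_part_iff edge_paths_def by blast
  have edge: "(decode z n, decode z (n + 1)) \<in> E0 \<and> e (decode z n) = z n" for n
  proof -
    obtain a b where ab: "(a, b) \<in> E0" "z n = e a" "z (n + 1) = e b"
      using z[of n] unfolding coded_edges_def by auto
    then have "a \<in> A" "b \<in> A" using E0_letters by auto
    then have "decode z n = a" "decode z (n + 1) = b"
      using ab inv_into_f_f[OF e_inj] by (simp_all add: decode_def)
    then show ?thesis using ab by simp
  qed
  have letters: "decode z n \<in> A" for n using edge[of n] E0_letters by blast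
  have "\<exists>n\<le>m. decode z n = inv_into A e u" "\<exists>n\<ge>m. decode z n = inv_into A e v" for m
    using u[of m] v[of m] by (auto simp: decode_def)
  moreover have "inv_into A e u \<in> A" "inv_into A e v \<in> A"
    using u[of 0] v[of 0] letters by (auto simp: decode_def)
  ultimately have "decode z \<in> Z"
    unfolding Z_eq regular_part_iff using edge by (auto simp: edge_paths_def)
  moreover have "z = e \<circ> decode z" using edge by (simp add: fun_eq_iff)
  ultimately show "z \<in> (\<lambda>x. e \<circ> x) ` Z" by blast
next
  fix z assume "z \<in> (\<lambda>x. e \<circ> x) ` Z"
  then obtain x where "x \<in> Z" and zx: "z = e \<circ> x" by blast
  then obtain u v where x2: "\<And>n. (x n, x (n + 1)) \<in> E0" and u: "\<And>m. \<exists>n\<le>m. x n = u"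
    and v: "\<And>m. \<exists>n\<ge>m. x n = v" unfolding Z_eq regular_part_iff edge_paths_def by blast
  note x = zx x2
  have "(z n, z (n + 1)) \<in> coded_edges" for n
    using x(2)[of n] unfolding x(1) coded_edges_def by force
  moreover have "\<exists>n\<le>m. z n = e u" "\<exists>n\<ge>m. z n = e v" for m
    using u[of m] v[of m] unfolding x(1) by auto
  ultimately show "z \<in> regular_part UNIV (edge_paths coded_edges)"
    unfolding regular_part_iff edge_paths_def by blast
qed

lemma encode_inj: "inj_on (\<lambda>x. e \<circ> x) Z"
  using decode_encode by (metis inj_on_inverseI)

lemma encode_agree_iff:
  "x \<in> Z \<Longrightarrow> y \<in> Z \<Longrightarrow> agree_upto n (e \<circ> x) (e \<circ> y) \<longleftrightarrow> agree_upto n x y"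
  unfolding agree_upto_def using Z_letters inj_onD[OF e_inj] by fastforce

text \<open>Induction over the \<sigma>-algebra: coding is injective on \<open>Z\<close>, so images
  commute with complements, and the coded \<open>Z\<close> is itself Borel.\<close>

lemma encode_borel:
  assumes coded_Z: "(\<lambda>x. e \<circ> x) ` Z \<in> sets borel"
    and S: "S \<in> sets (borel_of_topology (seq_topology Z))"
  shows "(\<lambda>x. e \<circ> x) ` S \<in> sets borel"
proof -
  have "{U. openin (seq_topology Z) U} \<subseteq> Pow Z" using openin_subset by fastforce
  then have "S \<in> sigma_sets Z {U. openin (seq_topology Z) U}"
    using S by (simp add: borel_of_topology_def)
  then show ?thesis
  proof (induction rule: sigma_sets.induct)
    case (Basic U)
    then have U: "U \<subseteq> Z" "\<And>x. x \<in> U \<Longrightarrow> \<exists>n. \<forall>y\<in>Z. agree_upto n x y \<longrightarrow> y \<in> U"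
      unfolding mem_Collect_eq openin_seq_topology by blast+
    \<comment> \<open>A union of cylinders around coded points of U, hence open among all sequences;
      inside the coded \<open>Z\<close> it cuts out exactly the image of U.\<close>
    define Op where "Op = {z. \<exists>x\<in>U. \<exists>n. (\<forall>y\<in>Z. agree_upto n x y \<longrightarrow> y \<in> U) \<and> agree_upto n (e \<circ> x) z}"
    have "open Op" unfolding Op_def
    proof (rule open_finite_window)
      fix z assume "\<exists>x\<in>U. \<exists>n. (\<forall>y\<in>Z. agree_upto n x y \<longrightarrow> y \<in> U) \<and> agree_upto n (e \<circ> x) z"
      then obtain x n where "x \<in> U" "\<forall>y\<in>Z. agree_upto n x y \<longrightarrow> y \<in> U" "agree_upto n (e \<circ> x) z" by blast
      then show "\<exists>k. \<forall>z'. agree_upto k z z' \<longrightarrow>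
          (\<exists>x\<in>U. \<exists>n. (\<forall>y\<in>Z. agree_upto n x y \<longrightarrow> y \<in> U) \<and> agree_upto n (e \<circ> x) z')"
        using agree_upto_trans by blast
    qed
    moreover have "(\<lambda>x. e \<circ> x) ` U = (\<lambda>x. e \<circ> x) ` Z \<inter> Op"
    proof (intro equalityI subsetI)
      fix z assume "z \<in> (\<lambda>x. e \<circ> x) ` U"
      then obtain x where x: "x \<in> U" "z = e \<circ> x" by blast
      then show "z \<in> (\<lambda>x. e \<circ> x) ` Z \<inter> Op"
        using U(1) U(2)[OF x(1)] agree_upto_refl unfolding Op_def by blast
    next
      fix z assume "z \<in> (\<lambda>x. e \<circ> x) ` Z \<inter> Op"
      then obtain y x n where "y \<in> Z" "z = e \<circ> y" "x \<in> U" "\<forall>y\<in>Z. agree_upto n x y \<longrightarrow> y \<in> U"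
        "agree_upto n (e \<circ> x) z" unfolding Op_def by blast
      then show "z \<in> (\<lambda>x. e \<circ> x) ` U" using encode_agree_iff[of x y n] U(1) by blast
    qed
    moreover have "(\<lambda>x. e \<circ> x) ` Z \<inter> Op \<in> sets borel" using coded_Z \<open>open Op\<close> by (intro sets.Int) auto
    ultimately show ?case by (simp only:)
  next
    case Empty
    then show ?case by simp
  next
    case (Compl S)
    have "S \<subseteq> Z" using sigma_sets_into_sp[OF \<open>_ \<subseteq> Pow Z\<close> Compl.hyps] .
    then have "(\<lambda>x. e \<circ> x) ` (Z - S) = (\<lambda>x. e \<circ> x) ` Z - (\<lambda>x. e \<circ> x) ` S"
      by (intro inj_on_image_set_diff[OF encode_inj]) auto
    moreover have "(\<lambda>x. e \<circ> x) ` Z - (\<lambda>x. e \<circ> x) ` S \<in> sets borel" using coded_Z Compl.IH by (rule sets.Diff)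
    ultimately show ?case by (simp only:)
  next
    case (Union S)
    have "(\<lambda>x. e \<circ> x) ` (\<Union>i. S i) = (\<Union>i. (\<lambda>x. e \<circ> x) ` S i)" by blast
    moreover have "(\<Union>i. (\<lambda>x. e \<circ> x) ` S i) \<in> sets borel" using Union.IH by blast
    ultimately show ?case by (simp only:)
  qed
qed

end

theorem theoremB1:
  fixes A :: "'a set" and X :: "(int \<Rightarrow> 'a) set"
    and Y :: "'y measure" and T :: "'y \<Rightarrow> 'y"
    and \<pi> :: "(int \<Rightarrow> 'a) \<Rightarrow> 'y" and R :: "('a \<times> 'a) set"
  assumes "markov_shift A X"
    and "locally_compact_space (seq_topology X)"
    and "borel_automorphism Y T"
    and "semiconjugacy shift_map (regular_part A X) T (space Y) \<pi>"
    and "\<pi> \<in> measurable (borel_of_topology (seq_topology (regular_part A X))) Y"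
    and "\<And>y. y \<in> space Y \<Longrightarrow> finite {x \<in> regular_part A X. \<pi> x = y}"
    and "locally_finite_rel A R"
    and "bowen_property (regular_part A X) \<pi> A R"
  shows "\<exists>(A' :: nat set) X' \<phi>.
    markov_shift A' X' \<and>
    locally_compact_space (seq_topology X') \<and>
    one_lipschitz X' (regular_part A X) \<phi> \<and>
    semiconjugacy shift_map X' T (space Y) (\<pi> \<circ> \<phi>) \<and>
    inj_on (\<pi> \<circ> \<phi>) (regular_part A' X') \<and>
    (\<forall>\<mu>. ergodic_invariant_prob Y T \<mu> \<and> emeasure \<mu> (\<pi> ` regular_part A X) = 1 \<longrightarrow>
         emeasure \<mu> ((\<pi> \<circ> \<phi>) ` regular_part A' X') = 1)"
proof -
  define Z where "Z = regular_part A X"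
  obtain E where E: "E \<subseteq> A \<times> A" "X = {x. (\<forall>n. x n \<in> A) \<and> (\<forall>n. (x n, x (n + 1)) \<in> E)}" and A: "countable A"
    using assms(1) unfolding markov_shift_def by blast
  have X: "X = edge_paths E"
  proof -
    have "x n \<in> A" if "\<And>n. (x n, x (n + 1)) \<in> E" for x :: "int \<Rightarrow> 'a" and n
      using that[of n] E(1) by blast
    then show ?thesis unfolding E(2) edge_paths_def by (intro Collect_cong) metis
  qed
  have lcf: "\<exists>n. \<forall>j. finite {q j | q. q \<in> edge_paths E \<and> agree_upto n p q}" if "p \<in> edge_paths E" for p
    by (rule locally_compact_finite_coordinates[OF assms(2)[unfolded X] that]) blast
  have Z_shift: "shift_by k x \<in> Z" if x: "x \<in> Z" for k x
  proof -
    obtain u v where uv: "u \<in> A" "v \<in> A" "\<And>m. \<exists>n\<le>m. x n = u" "\<And>m. \<exists>n\<ge>m. x n = v"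
      using x unfolding Z_def regular_part_iff by blast
    have "\<exists>n\<le>m. shift_by k x n = u" "\<exists>n\<ge>m. shift_by k x n = v" for m
    proof -
      obtain n n' where "n \<le> m + k" "x n = u" "n' \<ge> m + k" "x n' = v" using uv(3,4) by meson
      then show "\<exists>n\<le>m. shift_by k x n = u" "\<exists>n\<ge>m. shift_by k x n = v"
        by (intro exI[of _ "n - k"], simp, intro exI[of _ "n' - k"], simp)
    qed
    moreover have "shift_by k x \<in> X" using x unfolding Z_def regular_part_iff X by simp
    ultimately show ?thesis using uv(1,2) unfolding Z_def regular_part_iff by blast
  qed
  \<comment> \<open>Local compactness yields finite degrees only at letters met by recurrent paths.
    Keeping just the edges of regular paths leaves the regular part unchanged.\<close>
  define E0 where "E0 = {(x n, x (n + 1)) | x n. x \<in> Z}"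
  have E0_sub: "E0 \<subseteq> E" unfolding E0_def Z_def regular_part_iff X edge_paths_def by blast
  have Z_path: "x \<in> edge_paths E" if "x \<in> Z" for x
    using that unfolding Z_def regular_part_iff X by blast
  have E0_out: "finite (E0 `` {a})" for a
  proof (cases "\<exists>x\<in>Z. x 0 = a")
    case True
    then obtain x where x: "x \<in> Z" "x 0 = a" by blast
    then obtain u where u: "\<And>m. \<exists>n\<le>m. x n = u" unfolding Z_def regular_part_iff by blast
    have "E0 `` {a} \<subseteq> {y 1 | y. y \<in> edge_paths E \<and> y 0 = x 0}"
    proof
      fix b assume "b \<in> E0 `` {a}"
      then obtain y n where "y \<in> Z" "y n = a" "y (n + 1) = b" unfolding E0_def by blast
      then have "shift_by n y \<in> edge_paths E" "shift_by n y 0 = x 0" "b = shift_by n y 1"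
        using Z_path x(2) by (auto simp: add.commute)
      then show "b \<in> {y 1 | y. y \<in> edge_paths E \<and> y 0 = x 0}" by blast
    qed
    then show ?thesis
      using finite_successors_of_recurrent[OF lcf Z_path[OF x(1)] u] finite_subset by blast
  next
    case False
    have "E0 `` {a} = {}"
    proof (rule ccontr)
      assume "E0 `` {a} \<noteq> {}"
      then obtain y n where "y \<in> Z" "y n = a" unfolding E0_def by blast
      then show False using False Z_shift[of y n] by force
    qed
    then show ?thesis by simp
  qed
  have E0_in: "finite (E0\<inverse> `` {a})" for a
  proof (cases "\<exists>x\<in>Z. x 0 = a")
    case True
    then obtain x where x: "x \<in> Z" "x 0 = a" by blast
    then obtain v where v: "\<And>m. \<exists>n\<ge>m. x n = v" unfolding Z_def regular_part_iff by blast
    have "E0\<inverse> `` {a} \<subseteq> {y (-1) | y. y \<in> edge_paths E \<and> y 0 = x 0}"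
    proof
      fix b assume "b \<in> E0\<inverse> `` {a}"
      then obtain y n where "y \<in> Z" "y n = b" "y (n + 1) = a" unfolding E0_def by blast
      then have "shift_by (n + 1) y \<in> edge_paths E" "shift_by (n + 1) y 0 = x 0" "b = shift_by (n + 1) y (-1)"
        using Z_path x(2) by auto
      then show "b \<in> {y (-1) | y. y \<in> edge_paths E \<and> y 0 = x 0}" by blast
    qed
    then show ?thesis
      using finite_predecessors_of_recurrent[OF lcf Z_path[OF x(1)] v] finite_subset by blast
  next
    case False
    have "E0\<inverse> `` {a} = {}"
    proof (rule ccontr)
      assume "E0\<inverse> `` {a} \<noteq> {}"
      then obtain y n where "y \<in> Z" "y (n + 1) = a" unfolding E0_def by blast
      then show False using False Z_shift[of y "n + 1"] by force
    qed
    then show ?thesis by simp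
  qed
  have Z_eq: "Z = regular_part A (edge_paths E0)"
  proof (intro equalityI subsetI)
    fix x assume "x \<in> Z"
    then have "x \<in> edge_paths E0" unfolding E0_def edge_paths_def by blast
    then show "x \<in> regular_part A (edge_paths E0)"
      using \<open>x \<in> Z\<close> unfolding Z_def regular_part_iff by blast
  next
    fix x assume "x \<in> regular_part A (edge_paths E0)"
    moreover have "edge_paths E0 \<subseteq> edge_paths E" using E0_sub unfolding edge_paths_def by blast
    ultimately show "x \<in> Z" unfolding Z_def regular_part_iff X by blast
  qed
  define e where "e = to_nat_on A"
  have e_inj: "inj_on e A" unfolding e_def using A by (rule inj_on_to_nat_on)
  interpret letter_coding A E0 Z e
    using e_inj E0_sub E(1) Z_eq by unfold_locales auto
  let ?ec = "\<lambda>x. e \<circ> x"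
  define R1 where "R1 = map_prod e e ` R"
  define p1 where "p1 z = \<pi> (decode z)" for z
  have R: "R \<subseteq> A \<times> A" "refl_on A R" "sym R"
    and bowen: "\<And>x y. x \<in> Z \<Longrightarrow> y \<in> Z \<Longrightarrow> \<pi> x = \<pi> y \<longleftrightarrow> (\<forall>n. (x n, y n) \<in> R)"
    using assms(8) unfolding bowen_property_def Z_def by auto
  have R1_iff: "(e a, e b) \<in> R1 \<longleftrightarrow> (a, b) \<in> R" if "a \<in> A" "b \<in> A" for a b
  proof
    assume "(e a, e b) \<in> R1"
    then obtain a' b' where ab: "(a', b') \<in> R" "e a = e a'" "e b = e b'" unfolding R1_def by auto
    then have "a' \<in> A" "b' \<in> A" using R(1) by auto
    then have "a = a'" "b = b'" using ab inj_onD[OF e_inj] that by blast+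
    then show "(a, b) \<in> R" using ab by simp
  qed (force simp: R1_def)
  have R1_Z: "(e (x n), e (y n)) \<in> R1 \<longleftrightarrow> (x n, y n) \<in> R" if "x \<in> Z" "y \<in> Z" for x y n
    using R1_iff Z_letters that by blast
  have p1_ec: "p1 (?ec x) = \<pi> x" if "x \<in> Z" for x
    unfolding p1_def using decode_encode[OF that] by simp
  have p1_bowen: "p1 (?ec x) = p1 (?ec y) \<longleftrightarrow> (\<forall>n. (?ec x n, ?ec y n) \<in> R1)" if "x \<in> Z" "y \<in> Z" for x y
    using bowen[OF that] R1_Z[OF that] p1_ec that by simp
  have \<pi>_space: "\<pi> x \<in> space Y" and \<pi>_shift: "\<pi> (shift_by 1 x) = T (\<pi> x)" if "x \<in> Z" for x
    using assms(4) that unfolding semiconjugacy_def Z_def shift_map_eq by auto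
  have R_out: "finite (R `` {a})" for a
  proof (cases "a \<in> A")
    case True
    then have "finite {b \<in> A. (b, a) \<in> R}" using assms(7) unfolding locally_finite_rel_def by blast
    moreover have "R `` {a} \<subseteq> {b \<in> A. (b, a) \<in> R}" using R(1) symD[OF R(3)] by blast
    ultimately show ?thesis using finite_subset by blast
  next
    case False
    then have "R `` {a} = {}" using R(1) by blast
    then show ?thesis by simp
  qed
  interpret C: coded_shift coded_edges R1
  proof
    fix a
    show "finite (coded_edges `` {a})"
      unfolding coded_edges_def by (rule finite_Image_map_prod[OF e_inj E0_letters E0_out])
    have "coded_edges\<inverse> = map_prod e e ` (E0\<inverse>)" unfolding coded_edges_def by force
    moreover have "E0\<inverse> \<subseteq> A \<times> A" using E0_letters by blast
    ultimately show "finite (coded_edges\<inverse> `` {a})"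
      using finite_Image_map_prod[OF e_inj _ E0_in] by metis
    show "(b, a) \<in> R1" if ab1: "(a, b) \<in> R1" for b
    proof -
      obtain a' b' where ab: "(a', b') \<in> R" "a = e a'" "b = e b'" using ab1 unfolding R1_def by auto
      then have "(b', a') \<in> R" using symD[OF R(3)] by blast
      then show ?thesis unfolding R1_def ab by force
    qed
    show "finite (R1 `` {a})"
      unfolding R1_def by (rule finite_Image_map_prod[OF e_inj R(1) R_out])
  next
    fix z n assume "z \<in> regular_part UNIV (edge_paths coded_edges)"
    then obtain x where "x \<in> Z" "z = ?ec x" unfolding coded_regular by blast
    then show "(z n, z n) \<in> R1" using R1_Z[of x x n] refl_onD[OF R(2) Z_letters[of x n]] by simp
  next
    fix z1 z2 z3 n
    assume z: "z1 \<in> regular_part UNIV (edge_paths coded_edges)" "z2 \<in> regular_part UNIV (edge_paths coded_edges)"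
      "z3 \<in> regular_part UNIV (edge_paths coded_edges)"
      and rel: "\<And>n. (z1 n, z2 n) \<in> R1" "\<And>n. (z2 n, z3 n) \<in> R1"
    obtain x1 x2 x3 where x: "x1 \<in> Z" "x2 \<in> Z" "x3 \<in> Z" "z1 = ?ec x1" "z2 = ?ec x2" "z3 = ?ec x3"
      using z unfolding coded_regular by blast
    have "p1 (?ec x1) = p1 (?ec x2)" "p1 (?ec x2) = p1 (?ec x3)"
      using p1_bowen[OF x(1,2)] p1_bowen[OF x(2,3)] rel x by auto
    then have "p1 (?ec x1) = p1 (?ec x3)" by simp
    then show "(z1 n, z3 n) \<in> R1" using p1_bowen[OF x(1,3)] x by auto
  next
    fix z assume "z \<in> regular_part UNIV (edge_paths coded_edges)"
    then obtain x where x: "x \<in> Z" "z = ?ec x" unfolding coded_regular by blast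
    have "{y \<in> regular_part UNIV (edge_paths coded_edges). \<forall>n. (y n, z n) \<in> R1} \<subseteq> ?ec ` {y \<in> Z. \<pi> y = \<pi> x}"
    proof
      fix y assume "y \<in> {y \<in> regular_part UNIV (edge_paths coded_edges). \<forall>n. (y n, z n) \<in> R1}"
      then obtain y' where y': "y' \<in> Z" "y = ?ec y'" "\<forall>n. (y n, z n) \<in> R1" unfolding coded_regular by blast
      then have "\<pi> y' = \<pi> x" using p1_bowen[OF y'(1) x(1)] p1_ec x y' by auto
      then show "y \<in> ?ec ` {y \<in> Z. \<pi> y = \<pi> x}" using y' by blast
    qed
    moreover have "finite {y \<in> Z. \<pi> y = \<pi> x}" using assms(6)[OF \<pi>_space[OF x(1)]] unfolding Z_def .
    ultimately show "finite {y \<in> regular_part UNIV (edge_paths coded_edges). \<forall>n. (y n, z n) \<in> R1}"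
      using finite_subset by blast
  qed
  have Reg: "C.Reg = ?ec ` Z" unfolding C.Reg_def by (rule coded_regular)
  have aut: "standard_borel_space Y" "bij_betw T (space Y) (space Y)" "T \<in> measurable Y Y"
    using assms(3) unfolding borel_automorphism_def by blast+
  obtain U :: "nat \<Rightarrow> 'y set" where U: "\<And>n. U n \<in> sets Y"
    "\<And>y y'. y \<in> space Y \<Longrightarrow> y' \<in> space Y \<Longrightarrow> (\<And>n. y \<in> U n \<longleftrightarrow> y' \<in> U n) \<Longrightarrow> y = y'"
    using standard_borel_separating[OF aut(1)] by blast
  interpret C: coded_factor coded_edges R1 Y T p1 U
  proof
    show "p1 \<in> measurable (restrict_space borel C.Reg) Y"
    proof (rule measurableI)
      fix z assume "z \<in> space (restrict_space borel C.Reg)"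
      then have "z \<in> C.Reg" by (simp add: space_restrict_space)
      then obtain x where "x \<in> Z" "z = ?ec x" unfolding Reg by blast
      then show "p1 z \<in> space Y" using p1_ec \<pi>_space by simp
    next
      fix S assume S: "S \<in> sets Y"
      have pre: "\<pi> -` S \<inter> Z \<in> sets (borel_of_topology (seq_topology Z))"
        using measurable_sets[OF assms(5) S]
        by (simp add: Z_def borel_of_topology_def space_measure_of_conv)
      have "?ec ` (\<pi> -` S \<inter> Z) \<in> sets borel"
        by (rule encode_borel[OF C.Reg_sets[unfolded Reg] pre])
      moreover have "?ec ` (\<pi> -` S \<inter> Z) \<subseteq> C.Reg" unfolding Reg by blast
      ultimately have "?ec ` (\<pi> -` S \<inter> Z) \<in> sets (restrict_space borel C.Reg)"
        using C.Reg_sets by (subst sets_restrict_space_iff) (simp_all del: comp_apply)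
      moreover have "p1 -` S \<inter> C.Reg = ?ec ` (\<pi> -` S \<inter> Z)"
      proof (intro equalityI subsetI)
        fix z assume "z \<in> p1 -` S \<inter> C.Reg"
        then obtain x where "x \<in> Z" "z = ?ec x" "p1 z \<in> S" unfolding Reg by blast
        then show "z \<in> ?ec ` (\<pi> -` S \<inter> Z)" using p1_ec by (intro image_eqI[of _ _ x]) auto
      next
        fix z assume "z \<in> ?ec ` (\<pi> -` S \<inter> Z)"
        then obtain x where "x \<in> Z" "z = ?ec x" "\<pi> x \<in> S" by blast
        then show "z \<in> p1 -` S \<inter> C.Reg" using p1_ec unfolding Reg by blast
      qed
      moreover have "space (restrict_space borel C.Reg) = C.Reg" by (simp add: space_restrict_space)
      ultimately show "p1 -` S \<inter> space (restrict_space borel C.Reg) \<in> sets (restrict_space borel C.Reg)"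
        by (simp only:)
    qed
    show "p1 z \<in> space Y" if z: "z \<in> C.Reg" for z
    proof -
      obtain x where "x \<in> Z" "z = ?ec x" using z unfolding Reg by blast
      then show ?thesis using p1_ec \<pi>_space by simp
    qed
    show "p1 (shift_by 1 z) = T (p1 z)" if z: "z \<in> C.Reg" for z
    proof -
      obtain x where x: "x \<in> Z" "z = ?ec x" using z unfolding Reg by blast
      have "shift_by 1 z = ?ec (shift_by 1 x)" unfolding x(2) by (simp add: fun_eq_iff)
      then show ?thesis using p1_ec[OF Z_shift[OF x(1), of 1]] p1_ec[OF x(1)] \<pi>_shift[OF x(1)] x(2) by simp
    qed
    show "p1 z = p1 z' \<longleftrightarrow> (\<forall>n. (z n, z' n) \<in> R1)" if z: "z \<in> C.Reg" "z' \<in> C.Reg" for z z'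
    proof -
      obtain x x' where "x \<in> Z" "z = ?ec x" "x' \<in> Z" "z' = ?ec x'" using z unfolding Reg by blast
      then show ?thesis using p1_bowen[of x x'] by simp
    qed
    show "inj_on T (space Y)" using aut(2) by (simp add: bij_betw_def)
    show "T \<in> measurable Y Y" by (rule aut(3))
    show "U n \<in> sets Y" for n by (rule U(1))
    show "y = y'" if "y \<in> space Y" "y' \<in> space Y" "\<And>n. y \<in> U n \<longleftrightarrow> y' \<in> U n" for y y'
      using that by (rule U(2))
  qed
  let ?X' = "edge_paths C.trans"
  define \<phi> where "\<phi> z = decode (C.least_lift z)" for z
  have comp: "\<pi> \<circ> \<phi> = p1 \<circ> C.least_lift" by (simp add: fun_eq_iff \<phi>_def p1_def)
  have \<phi>_mem: "\<phi> z \<in> Z" if z: "z \<in> ?X'" for z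
  proof -
    have "C.least_lift z \<in> C.Reg" by (rule C.fib_Reg[OF C.dec_fib[OF z] C.least_lift_mem[OF z]])
    then show ?thesis unfolding Reg \<phi>_def using decode_encode by auto
  qed
  \<comment> \<open>All natural numbers serve as vertices; those that are not symbols have no
    edges.\<close>
  have "markov_shift (UNIV :: nat set) ?X'"
    unfolding markov_shift_def by (auto simp: edge_paths_def)
  moreover have "locally_compact_space (seq_topology ?X')"
    by (rule locally_compact_edge_paths[OF C.finite_trans_out C.finite_trans_in])
  moreover have "one_lipschitz ?X' (regular_part A X) \<phi>"
  proof (rule one_lipschitzI)
    show "\<phi> z \<in> regular_part A X" if "z \<in> ?X'" for z using \<phi>_mem[OF that] by (simp add: Z_def)
    fix z z' n assume "z \<in> ?X'" "z' \<in> ?X'" "agree_upto n z z'"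
    then have "agree_upto n (C.least_lift z) (C.least_lift z')" by (rule C.least_lift_agree)
    then show "agree_upto n (\<phi> z) (\<phi> z')" by (simp add: agree_upto_def \<phi>_def decode_def)
  qed
  moreover have "semiconjugacy shift_map ?X' T (space Y) (\<pi> \<circ> \<phi>)"
    unfolding comp by (rule C.lift_semiconjugacy)
  moreover have "inj_on (\<pi> \<circ> \<phi>) (regular_part UNIV ?X')"
    unfolding comp by (rule C.lift_inj_on)
  moreover have "emeasure \<mu> ((\<pi> \<circ> \<phi>) ` regular_part UNIV ?X') = 1"
    if \<mu>: "ergodic_invariant_prob Y T \<mu>" "emeasure \<mu> (\<pi> ` regular_part A X) = 1" for \<mu>
  proof -
    have "p1 ` C.Reg = \<pi> ` regular_part A X"
      unfolding Reg image_image Z_def[symmetric] by (rule image_cong[OF refl p1_ec])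
    then show ?thesis unfolding comp
      using \<mu> by (intro C.lift_full) (auto simp: ergodic_invariant_prob_def)
  qed
  ultimately show ?thesis by blast
qed

end
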